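(* Consider the irreversible investment problem $$V(x)=\sup_{\theta\in\mathcal{A}}E_x\left[\int_0^\infty p(\theta_t)q(X_t)e^{-rt}\,dt-\int_0^\infty Ke^{-rt}\,d\theta_t\right],$$ in which the intervention cost is a constant $K>0$, $q:\mathbb{R}\to(0,\infty)$ is continuous and strictly increasing, and $p:\mathbb{R}_+\to\mathbb{R}_+$ is continuously differentiable, concave and increasing, with derivative $p_\theta(\theta):=\frac{d}{d\theta}p(\theta)$ strictly decreasing and tending to $0$ as $\theta\to\infty$; moreover $X$ is a Lévy process such that the running cost $c(t,x,\theta)=-p(\theta)q(x)$ satisfies Assumptions 2–4 of the context (with $k_t=K$). Denote by $p_\theta^{-1}$ the inverse of $p_\theta$. Let $$L(x)=p_\theta^{-1}\left(\frac{rK}{E_0\left[q(x+\underline{X}_{T(r)})\right]}\right)$$ and suppose that $p,q$ are such that $L$ is well-defined for all $x\in\mathbb{R}$. Then the optimal control $\theta^*$ for the problem (i.e. the control attaining the supremum) is given by $$\theta^*_t=\sup_{0\le u\le t}L(X_u)\qquad\text{for all }t\ge0.$$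
   Context: $(\Omega,\mathcal{F},\mathbb{F}=(\mathcal{F}_t)_{t\ge0},(P_x)_{x\in\mathbb{R}})$ are filtered probability spaces, $X=(X_t)_{t\ge0}$ is a real-valued $\mathbb{F}$-adapted Lévy process with $X_0=x$ under $P_x$, $E_x$ is expectation under $P_x$, and $r>0$ is a constant. $\mathcal{A}$ is the set of singular controls: increasing (nondecreasing) adapted càdlàg processes $\theta$ with $\theta_{0-}=0$ and $\left\|\int_0^\infty e^{-rt}\,d\theta_t\right\|_{L^2(P_x)}<\infty$. Integrals $\int_0^\infty\cdot\,d\theta_t$ are over $[0,\infty)$ and include the jump of $\theta$ at time $0$. $\underline{X}_t=\inf_{0\le s\le t}X_s$, and $T(r)$ is an exponentially distributed random variable with parameter $r$ independent of $X$. Assumptions on a running cost $c(t,x,\theta)$ and intervention cost $k$: Assumption 2: for each $(t,x)$ the map $\theta\mapsto c(t,x,\theta)$ has a continuous, strictly increasing first derivative $c_\theta(t,x,\theta)$, and this derivative is bounded, uniformly in $t$ and $x$. Assumption 3: there is $y\in\mathbb{R}_+$ such that for all $x\in\mathbb{R}$, $E_x[\int_0^\infty c(t,X_t,y)e^{-rt}\,dt]<+\infty$. Assumption 4: with $C(t,x,k)=\inf_{z\ge0}(c(t,x,z)+rkz)$, one has $E_x[\int_0^\infty C(t,X_t,k_t)e^{-rt}\,dt]>-\infty$. *)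

theory Defs
  imports "HOL-Probability.Probability"
begin

text \<open>Time is the half-line of nonnegative reals. Processes and filtrations are indexed by
  \<^typ>\<open>real\<close>, but their values at negative times are never used.\<close>

definition filtered_space :: "'a measure \<Rightarrow> (real \<Rightarrow> 'a measure) \<Rightarrow> bool" where
  "filtered_space M F \<longleftrightarrow>
     (\<forall>t\<ge>0. subalgebra M (F t)) \<and> (\<forall>s t. 0 \<le> s \<and> s \<le> t \<longrightarrow> subalgebra (F t) (F s))"

definition adapted :: "(real \<Rightarrow> 'a measure) \<Rightarrow> (real \<Rightarrow> 'a \<Rightarrow> real) \<Rightarrow> bool" where
  "adapted F Y \<longleftrightarrow> (\<forall>t\<ge>0. Y t \<in> borel_measurable (F t))"

definition cadlag :: "(real \<Rightarrow> real) \<Rightarrow> bool" where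
  "cadlag f \<longleftrightarrow>
     (\<forall>t\<ge>0. continuous (at_right t) f) \<and> (\<forall>t>0. \<exists>l. (f \<longlongrightarrow> l) (at_left t))"

definition sample_path :: "(real \<Rightarrow> 'a \<Rightarrow> real) \<Rightarrow> 'a \<Rightarrow> real \<Rightarrow> real" where
  "sample_path Y \<omega> = (\<lambda>t\<in>{0..}. Y t \<omega>)"

abbreviation path_space :: "(real \<Rightarrow> real) measure" where
  "path_space \<equiv> \<Pi>\<^sub>M t\<in>{0..}. borel"

text \<open>A Levy process relative to the filtration: an increment is independent of the whole
  sigma-algebra \<open>F s\<close> at the beginning of the increment, not only of the past of \<open>Y\<close> itself.
  Continuity in probability follows from right-continuity and stationarity.\<close>

definition levy_process ::
  "'a measure \<Rightarrow> (real \<Rightarrow> 'a measure) \<Rightarrow> (real \<Rightarrow> 'a \<Rightarrow> real) \<Rightarrow> real \<Rightarrow> bool" where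
  "levy_process N F Y x \<longleftrightarrow>
     prob_space N \<and> filtered_space N F \<and> adapted F Y \<and>
     (\<forall>\<omega>\<in>space N. cadlag (\<lambda>t. Y t \<omega>)) \<and>
     (AE \<omega> in N. Y 0 \<omega> = x) \<and>
     (\<forall>s t. 0 \<le> s \<and> s \<le> t \<longrightarrow>
        prob_space.indep_set N (sets (F s))
          (sets (vimage_algebra (space N) (\<lambda>\<omega>. Y t \<omega> - Y s \<omega>) borel))) \<and>
     (\<forall>s t. 0 \<le> s \<and> s \<le> t \<longrightarrow>
        distr N borel (\<lambda>\<omega>. Y t \<omega> - Y s \<omega>) = distr N borel (\<lambda>\<omega>. Y (t - s) \<omega> - Y 0 \<omega>))"

text \<open>The measures \<open>P x\<close> belong to one Levy process: under \<open>P x\<close> the process has the law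
  of the process started at \<open>0\<close>, shifted by \<open>x\<close>.\<close>

definition levy_family ::
  "'a measure \<Rightarrow> (real \<Rightarrow> 'a measure) \<Rightarrow> (real \<Rightarrow> 'a measure) \<Rightarrow> (real \<Rightarrow> 'a \<Rightarrow> real) \<Rightarrow> bool" where
  "levy_family M F P X \<longleftrightarrow>
     (\<forall>x. sets (P x) = sets M \<and> levy_process (P x) F X x \<and>
        distr (P x) path_space (sample_path (\<lambda>t \<omega>. X t \<omega> - x)) = distr (P 0) path_space (sample_path X))"

definition independent_exponential ::
  "real \<Rightarrow> 'a measure \<Rightarrow> (real \<Rightarrow> 'a \<Rightarrow> real) \<Rightarrow> ('a \<Rightarrow> real) \<Rightarrow> bool" where
  "independent_exponential r N Y T \<longleftrightarrow>
     distributed N lborel T (exponential_density r) \<and>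
     prob_space.indep_set N (sets (vimage_algebra (space N) T borel))
       (sets (vimage_algebra (space N) (sample_path Y) path_space))"

definition running_inf :: "(real \<Rightarrow> 'a \<Rightarrow> real) \<Rightarrow> real \<Rightarrow> 'a \<Rightarrow> real" where
  "running_inf Y t \<omega> = (INF s\<in>{0..t}. Y s \<omega>)"

text \<open>Integral with values in the extended reals; \<^const>\<open>e2ennreal\<close> maps negative numbers
  to \<open>0\<close>, so this is the integral of the positive part minus that of the negative part.
  If both are infinite, the value is \<open>\<infinity>\<close> by the conventions of \<^typ>\<open>ereal\<close>.\<close>

definition ereal_integral :: "'a measure \<Rightarrow> ('a \<Rightarrow> ereal) \<Rightarrow> ereal" where
  "ereal_integral M f =
     enn2ereal (\<integral>\<^sup>+x. e2ennreal (f x) \<partial>M) - enn2ereal (\<integral>\<^sup>+x. e2ennreal (- f x) \<partial>M)"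

definition discounted_integral :: "real \<Rightarrow> (real \<Rightarrow> ereal) \<Rightarrow> ereal" where
  "discounted_integral r f =
     ereal_integral (restrict_space lborel {0..}) (\<lambda>t. f t * ereal (exp (- r * t)))"

text \<open>Lebesgue-Stieltjes integral over the closed half-line; extending \<open>g\<close> by \<open>0\<close> to
  negative times encodes \<open>g(0-) = 0\<close> and gives the point \<open>0\<close> the mass \<open>g 0\<close>.\<close>

definition stieltjes_integral :: "(real \<Rightarrow> real) \<Rightarrow> (real \<Rightarrow> real) \<Rightarrow> ennreal" where
  "stieltjes_integral g f =
     (\<integral>\<^sup>+t\<in>{0..}. ennreal (f t) \<partial>interval_measure (\<lambda>t. if t < 0 then 0 else g t))"

text \<open>In view of \<open>\<theta>(0-) = 0\<close>, a control is increasing if it is increasing on the half-line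
  and \<open>\<theta> 0 \<ge> 0\<close>.\<close>

definition singular_controls ::
  "real \<Rightarrow> 'a measure \<Rightarrow> (real \<Rightarrow> 'a measure) \<Rightarrow> (real \<Rightarrow> 'a \<Rightarrow> real) set" where
  "singular_controls r N F =
     {\<theta>. adapted F \<theta> \<and>
        (\<forall>\<omega>\<in>space N. cadlag (\<lambda>t. \<theta> t \<omega>) \<and> mono_on {0..} (\<lambda>t. \<theta> t \<omega>) \<and> 0 \<le> \<theta> 0 \<omega>) \<and>
        (\<integral>\<^sup>+\<omega>. (stieltjes_integral (\<lambda>t. \<theta> t \<omega>) (\<lambda>t. exp (- r * t)))\<^sup>2 \<partial>N) < \<infinity>}"

definition regular_running_cost :: "(real \<Rightarrow> real \<Rightarrow> real \<Rightarrow> real) \<Rightarrow> bool" where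
  "regular_running_cost c \<longleftrightarrow>
     (\<exists>c'. (\<forall>t\<ge>0. \<forall>x. (\<forall>z\<ge>0. (c t x has_real_derivative c' t x z) (at z within {0..})) \<and>
              continuous_on {0..} (c' t x) \<and> strict_mono_on {0..} (c' t x)) \<and>
           (\<exists>b. \<forall>t\<ge>0. \<forall>x. \<forall>z\<ge>0. \<bar>c' t x z\<bar> \<le> b))"

definition finite_cost_of_constant_control ::
  "real \<Rightarrow> (real \<Rightarrow> 'a measure) \<Rightarrow> (real \<Rightarrow> 'a \<Rightarrow> real) \<Rightarrow> (real \<Rightarrow> real \<Rightarrow> real \<Rightarrow> real) \<Rightarrow> bool" where
  "finite_cost_of_constant_control r P X c \<longleftrightarrow>
     (\<exists>y\<ge>0. \<forall>x. ereal_integral (P x)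
        (\<lambda>\<omega>. discounted_integral r (\<lambda>t. ereal (c t (X t \<omega>) y))) < \<infinity>)"

definition minimal_cost ::
  "real \<Rightarrow> (real \<Rightarrow> real \<Rightarrow> real \<Rightarrow> real) \<Rightarrow> real \<Rightarrow> real \<Rightarrow> real \<Rightarrow> ereal" where
  "minimal_cost r c t x k = (INF z\<in>{0..}. ereal (c t x z + r * k * z))"

definition finite_minimal_cost ::
  "real \<Rightarrow> (real \<Rightarrow> 'a measure) \<Rightarrow> (real \<Rightarrow> 'a \<Rightarrow> real) \<Rightarrow> (real \<Rightarrow> real \<Rightarrow> real \<Rightarrow> real)
    \<Rightarrow> (real \<Rightarrow> 'a \<Rightarrow> real) \<Rightarrow> bool" where
  "finite_minimal_cost r P X c k \<longleftrightarrow>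
     (\<forall>x. ereal_integral (P x)
        (\<lambda>\<omega>. discounted_integral r (\<lambda>t. minimal_cost r c t (X t \<omega>) (k t \<omega>))) > -\<infinity>)"

definition investment_payoff ::
  "real \<Rightarrow> real \<Rightarrow> (real \<Rightarrow> real) \<Rightarrow> (real \<Rightarrow> real) \<Rightarrow> (real \<Rightarrow> 'a \<Rightarrow> real)
    \<Rightarrow> 'a measure \<Rightarrow> (real \<Rightarrow> 'a \<Rightarrow> real) \<Rightarrow> ereal" where
  "investment_payoff r K p q X N \<theta> =
     ereal_integral N (\<lambda>\<omega>.
       discounted_integral r (\<lambda>t. ereal (p (\<theta> t \<omega>) * q (X t \<omega>)))
       - enn2ereal (stieltjes_integral (\<lambda>t. \<theta> t \<omega>) (\<lambda>t. K * exp (- r * t))))"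

definition investment_value ::
  "real \<Rightarrow> real \<Rightarrow> (real \<Rightarrow> real) \<Rightarrow> (real \<Rightarrow> real) \<Rightarrow> (real \<Rightarrow> 'a \<Rightarrow> real)
    \<Rightarrow> (real \<Rightarrow> 'a measure) \<Rightarrow> (real \<Rightarrow> 'a measure) \<Rightarrow> real \<Rightarrow> ereal" where
  "investment_value r K p q X F P x =
     (SUP \<theta>\<in>singular_controls r (P x) F. investment_payoff r K p q X (P x) \<theta>)"

text \<open>Optimal controls are determined only up to indistinguishability.\<close>

definition is_the_optimal_control ::
  "real \<Rightarrow> real \<Rightarrow> (real \<Rightarrow> real) \<Rightarrow> (real \<Rightarrow> real) \<Rightarrow> (real \<Rightarrow> 'a \<Rightarrow> real)
    \<Rightarrow> (real \<Rightarrow> 'a measure) \<Rightarrow> (real \<Rightarrow> 'a measure) \<Rightarrow> real \<Rightarrow> (real \<Rightarrow> 'a \<Rightarrow> real) \<Rightarrow> bool" where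
  "is_the_optimal_control r K p q X F P x \<theta> \<longleftrightarrow>
     \<theta> \<in> singular_controls r (P x) F \<and>
     investment_payoff r K p q X (P x) \<theta> = investment_value r K p q X F P x \<and>
     (\<forall>\<eta>\<in>singular_controls r (P x) F.
        investment_payoff r K p q X (P x) \<eta> = investment_value r K p q X F P x \<longrightarrow>
        (AE \<omega> in P x. \<forall>t\<ge>0. \<eta> t \<omega> = \<theta> t \<omega>))"

end

theory Submission
  imports Defs
begin

text \<open>Write \<open>M t\<close> for the running supremum of \<open>X\<close> and \<open>\<theta>* = L (M t)\<close> for the candidate;
since \<open>L\<close> is continuous and increasing, this is the supremum of \<open>L (X u)\<close> over \<open>u \<le> t\<close>.
Integration by parts replaces the cost \<open>K exp (- r t) d\<theta>\<close> by \<open>r K \<theta> exp (- r t) dt\<close>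
(\<open>stieltjes_integral_exp\<close>), so the payoff of a control becomes the expectation of the integral
of \<open>p \<theta> * q X - r K \<theta>\<close> against \<open>exp (- r t) dt\<close>. This functional is strictly concave
in \<open>\<theta>\<close>, and \<open>\<theta>*\<close> is its unique maximizer as soon as it satisfies the first-order conditions
of the problem over increasing processes: with \<open>Y = p' \<theta>* * q X - r K\<close>, the
discounted mean of \<open>Y * \<theta>\<close> is at most \<open>0\<close> for every admissible \<open>\<theta>\<close>
(\<open>marginal_profit_nonpos\<close>), and it is \<open>0\<close> for \<open>\<theta>*\<close> itself (\<open>marginal_profit_best\<close>). The tangent
of \<open>p\<close> at \<open>\<theta>*\<close> then gives optimality (\<open>best_optimal\<close>), and equality in the tangent inequality
gives uniqueness (\<open>best_unique\<close>).

Both conditions are consequences of the Wiener-Hopf factorization. At an independent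
exponential time \<open>T\<close> the variables \<open>M T\<close> and \<open>X T - M T\<close> are independent, and the second one has
the law of the running infimum of the process started at \<open>0\<close>. Hence
\<open>E [h (M T) * q (X T)] = E [h (M T) * g (M T)]\<close> with \<open>g m = E [q (m + inf X)]\<close>, the infimum being taken
up to \<open>T\<close> (\<open>Wiener_Hopf_levy\<close>).
The function \<open>L\<close> is defined by \<open>p' (L m) * g m = r K\<close>. Taking \<open>h = p' \<circ> L\<close> shows that a unit
bought at a fixed time \<open>s\<close> returns exactly its cost \<open>K\<close> if its marginal revenue is computed
from the supremum of \<open>X\<close> since \<open>s\<close>. The supremum since time \<open>0\<close> is larger and \<open>p' \<circ> L\<close> is decreasing,
so the true return is at most \<open>K\<close>; approximating \<open>\<theta>\<close> by step processes with jumps at fixed times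
yields the inequality (\<open>control_gain_le\<close>). Taking \<open>h = L * (p' \<circ> L)\<close> at \<open>s = 0\<close> yields the equality
for \<open>\<theta>*\<close> without any analysis of its points of increase.

The factorization is first proved for random walks at geometric times: cutting a path at its
first maximum makes the two parts independent (\<open>occupation_eq_records_descents\<close>), and reversing
the order of the steps identifies the law of the second part (\<open>running_Min_eq_drawdown_in_law\<close>). The
increments of \<open>X\<close> over a grid form such a walk, also conditionally on \<open>F s\<close>, and refining the grid
turns geometric times into exponential ones. Dominated convergence applies because \<open>q\<close> is
bounded: the bound on the derivative of the running cost, read at the zero control, bounds
\<open>p' 0 * q\<close> (\<open>regular_cost_bounded_price\<close>). For the same reason \<open>L\<close> is bounded, which makes
\<open>\<theta>*\<close> admissible. Sums and integrals of nonnegative quantities are taken in \<^typ>\<open>ennreal\<close>, where they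
may be interchanged without integrability conditions.\<close>

section \<open>The Wiener-Hopf factorization of a random walk\<close>

definition partial_sum :: "(nat \<Rightarrow> real) \<Rightarrow> nat \<Rightarrow> real" where
  "partial_sum y n = (\<Sum>i<n. y i)"

definition running_Max :: "(nat \<Rightarrow> real) \<Rightarrow> nat \<Rightarrow> real" where
  "running_Max a n = Max (a ` {..n})"

definition running_Min :: "(nat \<Rightarrow> real) \<Rightarrow> nat \<Rightarrow> real" where
  "running_Min a n = Min (a ` {..n})"

definition strict_record :: "(nat \<Rightarrow> real) \<Rightarrow> nat \<Rightarrow> bool" where
  "strict_record a k \<longleftrightarrow> (\<forall>i<k. a i < a k)"

definition stays_nonpos :: "(nat \<Rightarrow> real) \<Rightarrow> nat \<Rightarrow> bool" where
  "stays_nonpos a j \<longleftrightarrow> (\<forall>i\<le>j. a i \<le> 0)"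

lemma running_Max_0 [simp]: "running_Max a 0 = a 0"
  by (simp add: running_Max_def)

lemma running_Max_Suc: "running_Max a (Suc n) = max (running_Max a n) (a (Suc n))"
  unfolding running_Max_def atMost_Suc by (simp add: Max_insert max.commute)

lemma running_Min_0 [simp]: "running_Min a 0 = a 0"
  by (simp add: running_Min_def)

lemma running_Min_Suc: "running_Min a (Suc n) = min (running_Min a n) (a (Suc n))"
  unfolding running_Min_def atMost_Suc by (simp add: Min_insert min.commute)

lemma running_Max_minus: "running_Max (\<lambda>i. - a i) n = - running_Min a n"
  by (induction n) (simp_all add: running_Max_Suc running_Min_Suc minus_min_eq_max)

lemma running_Max_add: "running_Max (\<lambda>i. c + a i) n = c + running_Max a n"
  by (induction n) (simp_all add: running_Max_Suc max_add_distrib_right)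

lemma running_Min_add: "running_Min (\<lambda>i. c + a i) n = c + running_Min a n"
  by (induction n) (simp_all add: running_Min_Suc min_add_distrib_right)

lemma running_Min_cong: "(\<And>i. i \<le> n \<Longrightarrow> a i = b i) \<Longrightarrow> running_Min a n = running_Min b n"
  unfolding running_Min_def by (intro arg_cong[where f = Min] image_cong) auto

text \<open>Exactly one summand is nonzero, namely the one whose index is the first time at which the
maximum is attained. The condition in it is the conjunction of one on the path up to \<open>k\<close> and
one on the increments after \<open>k\<close>, which are independent for a random walk.\<close>

lemma first_maximum_split:
  fixes \<phi> :: "real \<Rightarrow> real \<Rightarrow> ennreal"
  shows "\<phi> (running_Max a n) (a n - running_Max a n) =
    (\<Sum>k\<le>n. if strict_record a k \<and> stays_nonpos (\<lambda>i. a (k + i) - a k) (n - k)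
             then \<phi> (a k) (a n - a k) else 0)"
proof -
  let ?P = "\<lambda>k. strict_record a k \<and> stays_nonpos (\<lambda>i. a (k + i) - a k) (n - k)"
  have after: "stays_nonpos (\<lambda>i. a (k + i) - a k) (n - k) \<longleftrightarrow> (\<forall>i. k \<le> i \<and> i \<le> n \<longrightarrow> a i \<le> a k)"
    if "k \<le> n" for k
    unfolding stays_nonpos_def using that
    by (auto simp: le_iff_add)
  define k where "k = (LEAST k. k \<le> n \<and> a k = running_Max a n)"
  have "running_Max a n \<in> a ` {..n}"
    unfolding running_Max_def by (rule Max_in) auto
  then have "\<exists>k\<le>n. a k = running_Max a n" by auto
  then have k: "k \<le> n" "a k = running_Max a n"
    using LeastI_ex[of "\<lambda>k. k \<le> n \<and> a k = running_Max a n"] unfolding k_def by auto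
  have le: "a i \<le> a k" if "i \<le> n" for i
    using that unfolding k(2) running_Max_def by (intro Max_ge) auto
  have less: "a i < a k" if "i < k" for i
    using not_less_Least[of i "\<lambda>k. k \<le> n \<and> a k = running_Max a n"] le[of i] that k
    unfolding k_def by auto
  have Pk: "?P k"
    using after[OF k(1)] le less by (auto simp: strict_record_def)
  have uniq: "j = k" if "j \<le> n" "?P j" for j
  proof (rule ccontr)
    assume "j \<noteq> k"
    then consider "j < k" | "k < j" by linarith
    then show False
    proof cases
      case 1
      then have "a k \<le> a j" using that(2) k(1) after[OF that(1)] by auto
      then show False using less[OF 1] by simp
    next
      case 2
      then have "a k < a j" using that by (auto simp: strict_record_def)
      then show False using le[OF that(1)] by simp
    qed
  qed
  have "(\<Sum>j\<le>n. if ?P j then \<phi> (a j) (a n - a j) else 0) =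
        (\<Sum>j\<in>{k}. if ?P j then \<phi> (a j) (a n - a j) else 0)"
  proof (rule sum.mono_neutral_right)
    show "\<forall>j\<in>{..n} - {k}. (if ?P j then \<phi> (a j) (a n - a j) else 0) = 0"
    proof
      fix j assume "j \<in> {..n} - {k}"
      then have "\<not> ?P j" using uniq[of j] by blast
      then show "(if ?P j then \<phi> (a j) (a n - a j) else 0) = 0" by (rule if_not_P)
    qed
  qed (use k(1) in auto)
  also have "\<dots> = \<phi> (a k) (a n - a k)"
    by (simp only: sum.insert finite.emptyI empty_iff not_False_eq_True sum.empty if_P[OF Pk] add_0_right)
  finally show ?thesis unfolding k(2) by (rule sym)
qed

lemma suminf_Cauchy_product_ennreal:
  fixes c :: "nat \<Rightarrow> nat \<Rightarrow> ennreal"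
  shows "(\<Sum>n. \<Sum>k\<le>n. c k (n - k)) = (\<Sum>k. \<Sum>j. c k j)"
proof -
  let ?d = "\<lambda>n k. if k \<le> n then c k (n - k) else 0"
  have "(\<Sum>n. \<Sum>k\<le>n. c k (n - k)) = (\<Sum>n. \<Sum>k. ?d n k)"
  proof (rule suminf_cong)
    fix n
    have "(\<Sum>k. ?d n k) = (\<Sum>k\<le>n. ?d n k)" by (rule suminf_finite) auto
    then show "(\<Sum>k\<le>n. c k (n - k)) = (\<Sum>k. ?d n k)" by simp
  qed
  also have "\<dots> = (\<Sum>k. \<Sum>n. ?d n k)"
    using nn_integral_fst_count_space[of "\<lambda>(n, k). ?d n k"]
      nn_integral_snd_count_space[of "\<lambda>(n, k). ?d n k"]
    by (simp add: nn_integral_count_space_nat)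
  also have "\<dots> = (\<Sum>k. \<Sum>j. c k j)"
  proof (rule suminf_cong)
    fix k
    have "(\<Sum>n. ?d n k) = (\<Sum>n. ?d (n + k) k)"
      by (subst suminf_offset[where i = k]) simp_all
    then show "(\<Sum>n. ?d n k) = (\<Sum>j. c k j)" by simp
  qed
  finally show ?thesis .
qed

text \<open>\<open>M\<close> is the law of a single step; the sequence space \<open>S\<close> carries independent steps with this law.\<close>

locale random_walk = sequence_space M for M :: "real measure" +
  assumes sets_steps [measurable_cong, simp]: "sets M = sets borel"
begin

lemma space_steps [simp]: "space M = UNIV"
  using sets_eq_imp_space_eq[OF sets_steps] by simp

lemma measurable_step [measurable]: "(\<lambda>y. y i) \<in> borel_measurable S"
proof -
  have "(\<lambda>y. y i) \<in> measurable S M" by measurable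
  then show ?thesis by (simp cong: measurable_cong_sets)
qed

lemma measurable_partial_sum [measurable]: "(\<lambda>y. partial_sum y n) \<in> borel_measurable S"
  unfolding partial_sum_def by measurable

lemma measurable_running_Max [measurable]:
  "(\<lambda>y. running_Max (partial_sum y) n) \<in> borel_measurable S"
  by (induction n) (simp_all add: running_Max_Suc)

lemma measurable_running_Min [measurable]:
  "(\<lambda>y. running_Min (partial_sum y) n) \<in> borel_measurable S"
  by (induction n) (simp_all add: running_Min_Suc)

lemma measurable_strict_record [measurable]: "Measurable.pred S (\<lambda>y. strict_record (partial_sum y) k)"
  unfolding strict_record_def by measurable

lemma measurable_stays_nonpos [measurable]: "Measurable.pred S (\<lambda>y. stays_nonpos (partial_sum y) k)"
  unfolding stays_nonpos_def by measurable

lemma partial_sum_comb_seq_le: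
  "i \<le> k \<Longrightarrow> partial_sum (comb_seq k y z) i = partial_sum y i"
  unfolding partial_sum_def by (intro sum.cong) (auto simp: comb_seq_less)

lemma partial_sum_comb_seq_add:
  "partial_sum (comb_seq k y z) (k + i) = partial_sum y k + partial_sum z i"
proof (induction i)
  case 0 then show ?case by (simp add: partial_sum_comb_seq_le) (simp add: partial_sum_def)
next
  case (Suc i)
  have "comb_seq k y z (k + i) = z i" using comb_seq_add[of k y z i] by (simp add: add.commute)
  with Suc show ?case by (simp add: partial_sum_def)
qed

text \<open>Up to the factor \<open>1 - b\<close>, \<open>occupation\<close> is the law of the maximum and the final drawdown at a geometric
time with parameter \<open>b\<close>; \<open>records\<close> is the discounted renewal measure of the strict record values,
and \<open>descents\<close> the discounted occupation measure of the walk until it first becomes positive.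
All three are written as functionals on nonnegative test functions.\<close>

definition occupation :: "ennreal \<Rightarrow> (real \<Rightarrow> real \<Rightarrow> ennreal) \<Rightarrow> ennreal" where
  "occupation b \<phi> = (\<Sum>n. b ^ n * (\<integral>\<^sup>+y. \<phi> (running_Max (partial_sum y) n)
       (partial_sum y n - running_Max (partial_sum y) n) \<partial>S))"

definition records :: "ennreal \<Rightarrow> (real \<Rightarrow> ennreal) \<Rightarrow> ennreal" where
  "records b \<phi> = (\<Sum>k. b ^ k * (\<integral>\<^sup>+y. (if strict_record (partial_sum y) k
       then \<phi> (partial_sum y k) else 0) \<partial>S))"

definition descents :: "ennreal \<Rightarrow> (real \<Rightarrow> ennreal) \<Rightarrow> ennreal" where
  "descents b \<phi> = (\<Sum>j. b ^ j * (\<integral>\<^sup>+y. (if stays_nonpos (partial_sum y) j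
       then \<phi> (partial_sum y j) else 0) \<partial>S))"

lemma records_cmult:
  assumes [measurable]: "\<phi> \<in> borel_measurable borel" shows "records b (\<lambda>a. \<phi> a * c) = records b \<phi> * c"
proof -
  have "(\<integral>\<^sup>+y. (if strict_record (partial_sum y) k then \<phi> (partial_sum y k) * c else 0) \<partial>S) =
      (\<integral>\<^sup>+y. (if strict_record (partial_sum y) k then \<phi> (partial_sum y k) else 0) \<partial>S) * c" for k
    by (subst nn_integral_multc[symmetric]) (auto intro!: nn_integral_cong)
  then show ?thesis
    unfolding records_def by (subst ennreal_suminf_multc[symmetric]) (simp add: mult.assoc)
qed

lemma descents_cmult:
  assumes [measurable]: "\<phi> \<in> borel_measurable borel" shows "descents b (\<lambda>a. c * \<phi> a) = c * descents b \<phi>"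
proof -
  have "(\<integral>\<^sup>+y. (if stays_nonpos (partial_sum y) k then c * \<phi> (partial_sum y k) else 0) \<partial>S) =
      c * (\<integral>\<^sup>+y. (if stays_nonpos (partial_sum y) k then \<phi> (partial_sum y k) else 0) \<partial>S)" for k
    by (subst nn_integral_cmult[symmetric]) (auto intro!: nn_integral_cong)
  then show ?thesis
    unfolding descents_def by (subst ennreal_suminf_cmult[symmetric]) (simp add: mult_ac)
qed

lemma measurable_descents [measurable]:
  assumes [measurable]: "case_prod \<phi> \<in> borel_measurable (borel \<Otimes>\<^sub>M borel)"
  shows "(\<lambda>a. descents b (\<phi> a)) \<in> borel_measurable borel"
  unfolding descents_def by measurable

text \<open>Integration over a sequence of independent steps may be carried out in two stages, first over
the steps after time \<open>k\<close>, which form a fresh sequence.\<close>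

lemma nn_integral_comb_seq:
  assumes [measurable]: "\<psi> \<in> borel_measurable S"
  shows "(\<integral>\<^sup>+y. \<psi> y \<partial>S) = (\<integral>\<^sup>+y. \<integral>\<^sup>+z. \<psi> (comb_seq k y z) \<partial>S \<partial>S)"
proof -
  have "(\<integral>\<^sup>+y. \<psi> y \<partial>S) = (\<integral>\<^sup>+y. \<psi> y \<partial>distr (S \<Otimes>\<^sub>M S) S (\<lambda>(y, z). comb_seq k y z))"
    by (simp only: PiM_comb_seq)
  also have "\<dots> = (\<integral>\<^sup>+p. \<psi> (case p of (y, z) \<Rightarrow> comb_seq k y z) \<partial>(S \<Otimes>\<^sub>M S))"
    using assms by (intro nn_integral_distr measurable_comb_seq) simp
  also have "\<dots> = (\<integral>\<^sup>+y. \<integral>\<^sup>+z. \<psi> (comb_seq k y z) \<partial>S \<partial>S)"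
    by (subst P.nn_integral_fst[symmetric]) (simp_all add: case_prod_unfold)
  finally show ?thesis .
qed

text \<open>A path is cut at its first maximum. The two parts are independent and the weight
\<open>b ^ n\<close> factors accordingly, so that the joint law of the maximum and the drawdown at a geometric
time is a product measure.\<close>

theorem occupation_eq_records_descents:
  assumes [measurable]: "case_prod \<phi> \<in> borel_measurable (borel \<Otimes>\<^sub>M borel)"
  shows "occupation b \<phi> = records b (\<lambda>a. descents b (\<phi> a))"
proof -
  have rec: "strict_record (partial_sum (comb_seq k y z)) k = strict_record (partial_sum y) k" for k y z
    by (auto simp: strict_record_def partial_sum_comb_seq_le)
  have des: "stays_nonpos (\<lambda>i. partial_sum (comb_seq k y z) (k + i) - partial_sum y k) j
      = stays_nonpos (partial_sum z) j" for k y z j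
    by (simp add: partial_sum_comb_seq_add partial_sum_comb_seq_le)
  let ?D = "\<lambda>n k a. \<integral>\<^sup>+z. (if stays_nonpos (partial_sum z) (n - k)
      then \<phi> a (partial_sum z (n - k)) else 0) \<partial>S"
  let ?R = "\<lambda>n k y. if strict_record (partial_sum y) k \<and>
      stays_nonpos (\<lambda>i. partial_sum y (k + i) - partial_sum y k) (n - k)
      then \<phi> (partial_sum y k) (partial_sum y n - partial_sum y k) else 0"
  let ?c = "\<lambda>k j. b ^ k * (\<integral>\<^sup>+y. (if strict_record (partial_sum y) k
       then b ^ j * (\<integral>\<^sup>+z. (if stays_nonpos (partial_sum z) j
      then \<phi> (partial_sum y k) (partial_sum z j) else 0) \<partial>S) else 0) \<partial>S)"
  have meas[measurable]: "?R n k \<in> borel_measurable S" for n k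
    unfolding stays_nonpos_def by measurable
  have step: "b ^ n * (\<integral>\<^sup>+y. ?R n k y \<partial>S) = ?c k (n - k)" if "k \<le> n" for n k
  proof -
    have "(\<integral>\<^sup>+y. ?R n k y \<partial>S) = (\<integral>\<^sup>+y. \<integral>\<^sup>+z. ?R n k (comb_seq k y z) \<partial>S \<partial>S)"
      by (rule nn_integral_comb_seq) measurable
    also have "\<dots> = (\<integral>\<^sup>+y. \<integral>\<^sup>+z. (if strict_record (partial_sum y) k then
        if stays_nonpos (partial_sum z) (n - k) then \<phi> (partial_sum y k) (partial_sum z (n - k)) else 0
        else 0) \<partial>S \<partial>S)"
    proof (intro nn_integral_cong)
      fix y z
      have "partial_sum (comb_seq k y z) n = partial_sum y k + partial_sum z (n - k)"
        using partial_sum_comb_seq_add[of k y z "n - k"] that by simp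
      then show "?R n k (comb_seq k y z) = (if strict_record (partial_sum y) k then
        if stays_nonpos (partial_sum z) (n - k) then \<phi> (partial_sum y k) (partial_sum z (n - k)) else 0
        else 0)"
        by (simp only: rec des partial_sum_comb_seq_le[OF order_refl]) simp
    qed
    also have "\<dots> = (\<integral>\<^sup>+y. (if strict_record (partial_sum y) k then ?D n k (partial_sum y k) else 0) \<partial>S)"
      by (intro nn_integral_cong) simp
    finally have "b ^ n * (\<integral>\<^sup>+y. ?R n k y \<partial>S) = b ^ k * (b ^ (n - k) *
        (\<integral>\<^sup>+y. (if strict_record (partial_sum y) k then ?D n k (partial_sum y k) else 0) \<partial>S))"
      using that by (simp add: mult.assoc[symmetric] power_add[symmetric])
    also have "\<dots> = ?c k (n - k)"
      by (subst nn_integral_cmult[symmetric]) (auto intro!: nn_integral_cong arg_cong2[where f = "(*)"])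
    finally show ?thesis .
  qed
  have "occupation b \<phi> = (\<Sum>n. \<Sum>k\<le>n. b ^ n * (\<integral>\<^sup>+y. ?R n k y \<partial>S))"
    unfolding occupation_def
    by (subst first_maximum_split) (simp add: nn_integral_sum sum_distrib_left)
  also have "\<dots> = (\<Sum>n. \<Sum>k\<le>n. ?c k (n - k))"
    using step by (intro suminf_cong sum.cong) auto
  also have "\<dots> = (\<Sum>k. \<Sum>j. ?c k j)"
    by (rule suminf_Cauchy_product_ennreal)
  also have "\<dots> = (\<Sum>k. b ^ k * (\<integral>\<^sup>+y. (\<Sum>j. if strict_record (partial_sum y) k
       then b ^ j * (\<integral>\<^sup>+z. (if stays_nonpos (partial_sum z) j
      then \<phi> (partial_sum y k) (partial_sum z j) else 0) \<partial>S) else 0) \<partial>S))"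
    by (subst nn_integral_suminf) (simp_all)
  also have "\<dots> = records b (\<lambda>a. descents b (\<phi> a))"
    unfolding records_def descents_def
    by (intro suminf_cong arg_cong2[where f = "(*)"] nn_integral_cong refl) auto
  finally show ?thesis .
qed

text \<open>Reversing the order of the first \<open>n\<close> steps preserves the law of the walk and replaces the partial
sum at \<open>i\<close> by the difference of the partial sums at \<open>n\<close> and \<open>n - i\<close>. The minimum of the reversed
walk is therefore the final drawdown of the original one.\<close>

lemma running_Min_eq_drawdown_in_law:
  assumes [measurable]: "\<psi> \<in> borel_measurable borel"
  shows "(\<integral>\<^sup>+y. \<psi> (running_Min (partial_sum y) n) \<partial>S) =
    (\<integral>\<^sup>+y. \<psi> (partial_sum y n - running_Max (partial_sum y) n) \<partial>S)"
proof -
  define rv where "rv i = (if i < n then n - 1 - i else i)" for i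
  have inj: "inj rv"
    unfolding rv_def by (auto simp: inj_on_def split: if_splits)
  have law: "distr S S (\<lambda>y i. y (rv i)) = S"
    using distr_PiM_reindex[of UNIV "\<lambda>_. M" rv UNIV] inj prob_space_axioms
    by (simp add: restrict_UNIV prob_space)
  have meas [measurable]: "(\<lambda>y i. y (rv i)) \<in> measurable S S"
    by (rule measurable_PiM_single') (auto simp: space_PiM)
  have ps: "partial_sum (\<lambda>i. y (rv i)) i = partial_sum y n - partial_sum y (n - i)" if "i \<le> n" for y i
    using that
  proof (induction i)
    case 0 then show ?case by (simp add: partial_sum_def)
  next
    case (Suc i)
    have "partial_sum y (n - i) = partial_sum y (n - Suc i) + y (n - Suc i)"
      using Suc.prems by (simp add: partial_sum_def Suc_diff_Suc flip: sum.lessThan_Suc)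
    with Suc show ?case by (simp add: partial_sum_def rv_def)
  qed
  have "running_Min (partial_sum (\<lambda>i. y (rv i))) n = partial_sum y n - running_Max (partial_sum y) n" for y
  proof -
    have "running_Min (partial_sum (\<lambda>i. y (rv i))) n = running_Min (\<lambda>i. partial_sum y n + - partial_sum y (n - i)) n"
      using ps by (intro running_Min_cong) simp
    also have "\<dots> = partial_sum y n - running_Max (\<lambda>i. partial_sum y (n - i)) n"
      unfolding running_Min_add using running_Max_minus[of "\<lambda>i. - partial_sum y (n - i)" n] by simp
    also have "running_Max (\<lambda>i. partial_sum y (n - i)) n = running_Max (partial_sum y) n"
      unfolding running_Max_def
    proof (rule arg_cong[where f = Max])
      have "(\<lambda>i. n - i) ` {..n} = {..n}"
        by (auto simp: image_iff) (metis atMost_iff diff_diff_cancel diff_le_self)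
      then show "(\<lambda>i. partial_sum y (n - i)) ` {..n} = partial_sum y ` {..n}"
        by (metis image_image)
    qed
    finally show ?thesis .
  qed
  note reversed = this
  have "(\<integral>\<^sup>+y. \<psi> (running_Min (partial_sum y) n) \<partial>S) =
      (\<integral>\<^sup>+y. \<psi> (running_Min (partial_sum y) n) \<partial>distr S S (\<lambda>y i. y (rv i)))"
    by (simp only: law)
  also have "\<dots> = (\<integral>\<^sup>+y. \<psi> (running_Min (partial_sum (\<lambda>i. y (rv i))) n) \<partial>S)"
  proof (rule nn_integral_distr[OF meas])
    have "(\<lambda>y. \<psi> (running_Min (partial_sum y) n)) \<in> borel_measurable S"
      by (rule measurable_compose[OF measurable_running_Min assms])
    then show "(\<lambda>y. \<psi> (running_Min (partial_sum y) n)) \<in> borel_measurable (distr S S (\<lambda>y i. y (rv i)))"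
      by (simp only: law)
  qed
  finally show ?thesis by (simp only: reversed)
qed

text \<open>By the product form, averaging over the drawdown replaces \<open>q\<close> by a function of the maximum
alone; by time reversal this function is a mean over the running minimum. The factor \<open>\<Sum> b ^ n\<close>
stands for the normalization \<open>1 / (1 - b)\<close> and keeps division out of the extended reals.\<close>

theorem Wiener_Hopf_random_walk:
  fixes f q :: "real \<Rightarrow> ennreal"
  assumes [measurable]: "f \<in> borel_measurable borel" "q \<in> borel_measurable borel"
  shows "(\<Sum>n. b ^ n * (\<integral>\<^sup>+y. f (running_Max (partial_sum y) n) * q (partial_sum y n) \<partial>S)) * (\<Sum>n. b ^ n) =
    (\<Sum>n. b ^ n * (\<integral>\<^sup>+y. f (running_Max (partial_sum y) n) *
       (\<Sum>m. b ^ m * (\<integral>\<^sup>+z. q (running_Max (partial_sum y) n + running_Min (partial_sum z) m) \<partial>S)) \<partial>S))"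
proof -
  define V where "V a = descents b (\<lambda>x. q (a + x))" for a
  have [measurable]: "V \<in> borel_measurable borel"
    unfolding V_def by (rule measurable_descents) measurable
  \<comment> \<open>A constant test function turns the product form into a product of total masses.\<close>
  have total: "(\<Sum>n. b ^ n) = records b (\<lambda>_. 1) * descents b (\<lambda>_. 1)"
    using occupation_eq_records_descents[of "\<lambda>_ _. 1" b] records_cmult[of "\<lambda>_. 1" b "descents b (\<lambda>_. 1)"]
    by (simp add: occupation_def P.emeasure_space_1)
  have G: "(\<Sum>m. b ^ m * (\<integral>\<^sup>+z. q (a + running_Min (partial_sum z) m) \<partial>S)) = V a * records b (\<lambda>_. 1)" for a
  proof -
    have "(\<Sum>m. b ^ m * (\<integral>\<^sup>+z. q (a + running_Min (partial_sum z) m) \<partial>S)) = occupation b (\<lambda>_ x. q (a + x))"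
      unfolding occupation_def by (subst running_Min_eq_drawdown_in_law) simp_all
    also have "\<dots> = records b (\<lambda>_. V a)"
      unfolding V_def by (rule occupation_eq_records_descents) measurable
    also have "\<dots> = V a * records b (\<lambda>_. 1)"
      using records_cmult[of "\<lambda>_. 1" b "V a"] by (simp add: mult.commute)
    finally show ?thesis .
  qed
  have "(\<Sum>n. b ^ n * (\<integral>\<^sup>+y. f (running_Max (partial_sum y) n) * q (partial_sum y n) \<partial>S)) =
      occupation b (\<lambda>a x. f a * q (a + x))"
    by (simp add: occupation_def)
  also have "\<dots> = records b (\<lambda>a. f a * V a)"
    unfolding V_def by (subst occupation_eq_records_descents) (simp_all add: descents_cmult)
  finally have "(\<Sum>n. b ^ n * (\<integral>\<^sup>+y. f (running_Max (partial_sum y) n) * q (partial_sum y n) \<partial>S)) * (\<Sum>n. b ^ n)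
    = records b (\<lambda>a. f a * V a) * (records b (\<lambda>_. 1) * descents b (\<lambda>_. 1))"
    using total by simp
  also have "\<dots> = records b (\<lambda>a. descents b (\<lambda>x. f a * V a * records b (\<lambda>_. 1)))"
  proof -
    have "records b (\<lambda>a. f a * V a * (R * D)) = records b (\<lambda>a. f a * V a) * (R * D)" for R D
      by (rule records_cmult[where \<phi> = "\<lambda>a. f a * V a"]) measurable
    note const = this[of "records b (\<lambda>_. 1)" "descents b (\<lambda>_. 1)"]
    have "descents b (\<lambda>x. c) = c * descents b (\<lambda>_. 1)" for c
      using descents_cmult[of "\<lambda>_. 1" b c] by simp
    note const_descents = this
    have "descents b (\<lambda>x. f a * V a * records b (\<lambda>_. 1)) =
        f a * V a * (records b (\<lambda>_. 1) * descents b (\<lambda>_. 1))" for a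
      by (subst const_descents) (rule mult.assoc)
    then show ?thesis by (simp only: const[symmetric])
  qed
  also have "\<dots> = occupation b (\<lambda>a x. f a * V a * records b (\<lambda>_. 1))"
    by (rule occupation_eq_records_descents[symmetric]) measurable
  also have "\<dots> = (\<Sum>n. b ^ n * (\<integral>\<^sup>+y. f (running_Max (partial_sum y) n) *
       (\<Sum>m. b ^ m * (\<integral>\<^sup>+z. q (running_Max (partial_sum y) n + running_Min (partial_sum z) m) \<partial>S)) \<partial>S))"
    unfolding occupation_def G by (simp add: mult.assoc)
  finally show ?thesis .
qed

end

section \<open>The increments of a Levy process on a grid\<close>

locale levy =
  fixes N :: "'a measure" and F :: "real \<Rightarrow> 'a measure" and Y :: "real \<Rightarrow> 'a \<Rightarrow> real" and x :: real
  assumes levy: "levy_process N F Y x"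

sublocale levy \<subseteq> prob_space N
  using levy by (simp add: levy_process_def)

context levy
begin

text \<open>A name for the fact that survives when a second probability space is interpreted.\<close>

lemma prob_space_N: "prob_space N"
  by (rule prob_space_axioms)

lemma subalgebra_F: "0 \<le> t \<Longrightarrow> subalgebra N (F t)"
  and subalgebra_mono: "0 \<le> s \<Longrightarrow> s \<le> t \<Longrightarrow> subalgebra (F t) (F s)"
  using levy by (auto simp: levy_process_def filtered_space_def)

lemma space_F: "0 \<le> t \<Longrightarrow> space (F t) = space N"
  using subalgebra_F[of t] by (simp add: subalgebra_def)

lemma measurable_Y_F: "0 \<le> s \<Longrightarrow> s \<le> t \<Longrightarrow> Y s \<in> borel_measurable (F t)"
  using levy measurable_from_subalg[OF subalgebra_mono[of s t], of "Y s" borel]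
  by (auto simp: levy_process_def adapted_def)

lemma measurable_Y [measurable]: "0 \<le> s \<Longrightarrow> Y s \<in> borel_measurable N"
  by (rule measurable_from_subalg[OF subalgebra_F measurable_Y_F]) auto

lemma cadlag_Y: "\<omega> \<in> space N \<Longrightarrow> cadlag (\<lambda>t. Y t \<omega>)"
  using levy by (simp add: levy_process_def)

lemma Y_0: "AE \<omega> in N. Y 0 \<omega> = x"
  using levy by (simp add: levy_process_def)

definition step_law :: "real \<Rightarrow> real measure" where
  "step_law h = distr N borel (\<lambda>\<omega>. Y h \<omega> - Y 0 \<omega>)"

definition increments :: "real \<Rightarrow> real \<Rightarrow> 'a \<Rightarrow> nat \<Rightarrow> real" where
  "increments s h \<omega> k = Y (s + real (Suc k) * h) \<omega> - Y (s + real k * h) \<omega>"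

lemma sets_step_law [simp, measurable_cong]: "sets (step_law h) = sets borel"
  by (simp add: step_law_def)

lemma random_walk_step_law: "0 \<le> h \<Longrightarrow> random_walk (step_law h)"
proof -
  assume h: "0 \<le> h"
  interpret M: prob_space "step_law h"
    unfolding step_law_def using h by (intro prob_space_distr) simp
  show ?thesis by unfold_locales simp
qed

lemma emeasure_step_law_UNIV: "0 \<le> h \<Longrightarrow> emeasure (step_law h) UNIV = 1"
  unfolding step_law_def by (simp add: emeasure_distr emeasure_space_1)

lemma measurable_increments [measurable]:
  assumes "0 \<le> s" "0 \<le> h"
  shows "increments s h \<in> measurable N (\<Pi>\<^sub>M i\<in>UNIV. step_law h)"
proof (rule measurable_PiM_single')
  fix k
  have "(\<lambda>\<omega>. increments s h \<omega> k) \<in> borel_measurable N"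
    unfolding increments_def using assms
    by (intro borel_measurable_diff measurable_Y add_nonneg_nonneg mult_nonneg_nonneg) auto
  then show "(\<lambda>\<omega>. increments s h \<omega> k) \<in> measurable N (step_law h)"
    by (simp cong: measurable_cong_sets)
qed (auto simp: step_law_def space_PiM)

lemma partial_sum_increments:
  "partial_sum (increments s h \<omega>) k = Y (s + real k * h) \<omega> - Y s \<omega>"
  by (induction k) (simp_all add: partial_sum_def increments_def)

lemma emeasure_increment:
  assumes "0 \<le> s" "0 \<le> h" and A: "A \<in> sets (F (s + real k * h))" and B: "B \<in> sets borel"
  shows "emeasure N (A \<inter> {\<omega>\<in>space N. increments s h \<omega> k \<in> B}) = emeasure N A * emeasure (step_law h) B"
proof -
  let ?a = "s + real k * h" and ?b = "s + real (Suc k) * h"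
  have ab: "0 \<le> ?a" "?a \<le> ?b" using assms by (auto simp: algebra_simps)
  have meas: "(\<lambda>\<omega>. Y ?b \<omega> - Y ?a \<omega>) \<in> borel_measurable N"
    using ab order_trans[OF ab] by (intro borel_measurable_diff measurable_Y) auto
  have eq: "{\<omega>\<in>space N. increments s h \<omega> k \<in> B} = (\<lambda>\<omega>. Y ?b \<omega> - Y ?a \<omega>) -` B \<inter> space N"
    by (auto simp: increments_def)
  have ind: "indep_set (sets (F ?a)) (sets (vimage_algebra (space N) (\<lambda>\<omega>. Y ?b \<omega> - Y ?a \<omega>) borel))"
    using levy ab unfolding levy_process_def by blast
  have "prob (A \<inter> {\<omega>\<in>space N. increments s h \<omega> k \<in> B}) = prob A * prob {\<omega>\<in>space N. increments s h \<omega> k \<in> B}"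
    unfolding eq by (rule indep_setD[OF ind A in_vimage_algebra[OF B]])
  then have "emeasure N (A \<inter> {\<omega>\<in>space N. increments s h \<omega> k \<in> B}) =
      emeasure N A * emeasure N {\<omega>\<in>space N. increments s h \<omega> k \<in> B}"
    by (simp add: emeasure_eq_measure ennreal_mult)
  also have "emeasure N {\<omega>\<in>space N. increments s h \<omega> k \<in> B} =
      emeasure (distr N borel (\<lambda>\<omega>. Y ?b \<omega> - Y ?a \<omega>)) B"
    unfolding eq by (rule emeasure_distr[OF meas B, symmetric])
  also have "distr N borel (\<lambda>\<omega>. Y ?b \<omega> - Y ?a \<omega>) = step_law h"
  proof -
    have "?b - ?a = h" by (simp add: algebra_simps)
    then show ?thesis using levy ab unfolding levy_process_def step_law_def by metis
  qed
  finally show ?thesis .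
qed

text \<open>The next increment is independent of the \<open>\<sigma>\<close>-algebra at its left end point, which contains \<open>A\<close>
and the events about all earlier increments. The measurability statement keeps the induction going.\<close>

lemma emeasure_increments_box:
  assumes s: "0 \<le> s" "0 \<le> h" and A: "A \<in> sets (F s)" and B: "\<And>j. B j \<in> sets borel"
  shows "A \<inter> {\<omega>\<in>space N. \<forall>j<n. increments s h \<omega> j \<in> B j} \<in> sets (F (s + real n * h)) \<and>
    emeasure N (A \<inter> {\<omega>\<in>space N. \<forall>j<n. increments s h \<omega> j \<in> B j}) =
    emeasure N A * (\<Prod>j<n. emeasure (step_law h) (B j))"
proof (induction n)
  case 0
  have "A \<subseteq> space N"
    using sets.sets_into_space[OF A] space_F[OF s(1)] by simp
  then have "A \<inter> {\<omega> \<in> space N. \<forall>j<0. increments s h \<omega> j \<in> B j} = A" by auto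
  then show ?case using A by simp
next
  case (Suc n)
  let ?A = "A \<inter> {\<omega>\<in>space N. \<forall>j<n. increments s h \<omega> j \<in> B j}"
  have split: "A \<inter> {\<omega>\<in>space N. \<forall>j<Suc n. increments s h \<omega> j \<in> B j} =
      ?A \<inter> {\<omega>\<in>space N. increments s h \<omega> n \<in> B n}"
    by (auto simp: less_Suc_eq)
  have le: "0 \<le> s + real n * h" "s + real n * h \<le> s + real (Suc n) * h" using s by (auto simp: algebra_simps)
  have [measurable]: "(\<lambda>\<omega>. increments s h \<omega> n) \<in> borel_measurable (F (s + real (Suc n) * h))"
    unfolding increments_def using le by (intro borel_measurable_diff measurable_Y_F) auto
  have "?A \<in> sets (F (s + real (Suc n) * h))"
    using Suc.IH subalgebra_mono[OF le] by (auto simp: subalgebra_def)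
  moreover have "{\<omega>\<in>space N. increments s h \<omega> n \<in> B n} \<in> sets (F (s + real (Suc n) * h))"
  proof -
    have "{\<omega>\<in>space (F (s + real (Suc n) * h)). increments s h \<omega> n \<in> B n} \<in> sets (F (s + real (Suc n) * h))"
      using B by measurable
    then show ?thesis using space_F[of "s + real (Suc n) * h"] le by simp
  qed
  ultimately show ?case
    unfolding split using Suc.IH B[of n] s
    by (auto simp: emeasure_increment mult.assoc)
qed

text \<open>Independence of \<open>A\<close> and finitely many increments extends to the whole sequence, because finite
measures on the sequence space that agree on boxes are equal.\<close>

lemma emeasure_increments:
  assumes s: "0 \<le> s" "0 \<le> h" and A: "A \<in> sets (F s)" and B: "B \<in> sets (\<Pi>\<^sub>M i\<in>UNIV. step_law h)"
  shows "emeasure N (A \<inter> increments s h -` B \<inter> space N) =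
    emeasure N A * emeasure (\<Pi>\<^sub>M i\<in>UNIV. step_law h) B"
proof -
  let ?S = "\<Pi>\<^sub>M i\<in>(UNIV :: nat set). step_law h"
  interpret random_walk "step_law h" by (rule random_walk_step_law) fact
  have AN: "A \<in> sets N" using A subalgebra_F[OF s(1)] by (auto simp: subalgebra_def)
  have [measurable]: "increments s h \<in> measurable N ?S" using s by measurable
  define P1 where "P1 = distr (density N (indicator A)) ?S (increments s h)"
  define P2 where "P2 = density ?S (\<lambda>_. emeasure N A)"
  have P1: "emeasure P1 B = emeasure N (A \<inter> increments s h -` B \<inter> space N)" if [measurable]: "B \<in> sets ?S" for B
  proof -
    have "emeasure P1 B = emeasure (density N (indicator A)) (increments s h -` B \<inter> space N)"
      unfolding P1_def by (subst emeasure_distr) simp_all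
    also have "\<dots> = emeasure N (A \<inter> (increments s h -` B \<inter> space N))"
      using AN by (subst emeasure_density) (auto simp: indicator_inter_arith[symmetric] intro!: nn_integral_indicator)
    finally show ?thesis by (simp add: Int_assoc)
  qed
  have P2: "emeasure P2 B = emeasure N A * emeasure ?S B" if [measurable]: "B \<in> sets ?S" for B
    unfolding P2_def by (simp add: emeasure_density nn_integral_cmult_indicator)
  have "P1 = P2"
  proof (rule measure_eqI_PiM_infinite)
    show "sets P1 = sets ?S" "sets P2 = sets ?S" by (simp_all add: P1_def P2_def)
    show "finite_measure P1"
    proof
      have "space P1 = space ?S" by (simp add: P1_def)
      then have "emeasure P1 (space P1) = emeasure N (A \<inter> increments s h -` space ?S \<inter> space N)"
        using P1[OF sets.top] by simp
      then show "emeasure P1 (space P1) \<noteq> \<infinity>" by simp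
    qed
    fix C :: "nat \<Rightarrow> real set" and J :: "nat set"
    assume J: "finite J" and C: "\<And>i. i \<in> J \<Longrightarrow> C i \<in> sets (step_law h)"
    obtain n where n: "J \<subseteq> {..<n}" using finite_nat_bounded[OF J] by blast
    define D where "D j = (if j \<in> J then C j else UNIV)" for j
    have D: "D j \<in> sets borel" for j using C by (auto simp: D_def)
    have E: "prod_emb UNIV (\<lambda>_. step_law h) J (Pi\<^sub>E J C) \<in> sets ?S"
      using J C by (intro sets_PiM_I) auto
    have "increments s h -` prod_emb UNIV (\<lambda>_. step_law h) J (Pi\<^sub>E J C) \<inter> space N =
       {\<omega>\<in>space N. \<forall>j<n. increments s h \<omega> j \<in> D j}"
      using subsetD[OF n] by (auto simp: prod_emb_def space_PiM D_def PiE_iff restrict_def extensional_def)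
    then have "emeasure P1 (prod_emb UNIV (\<lambda>_. step_law h) J (Pi\<^sub>E J C)) =
        emeasure N (A \<inter> {\<omega>\<in>space N. \<forall>j<n. increments s h \<omega> j \<in> D j})"
      using P1[OF E] by (simp add: Int_assoc)
    also have "\<dots> = emeasure N A * (\<Prod>j<n. emeasure (step_law h) (D j))"
      using emeasure_increments_box[of s h A D n] s A D by simp
    also have "(\<Prod>j<n. emeasure (step_law h) (D j)) = (\<Prod>j\<in>J. emeasure (step_law h) (C j))"
      using n emeasure_step_law_UNIV s by (intro prod.mono_neutral_cong_right) (auto simp: D_def)
    also have "\<dots> = emeasure ?S (prod_emb UNIV (\<lambda>_. step_law h) J (Pi\<^sub>E J C))"
      using J C by (intro emeasure_PiM_emb[symmetric]) auto
    finally show "emeasure P1 (prod_emb UNIV (\<lambda>_. step_law h) J (Pi\<^sub>E J C)) =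
      emeasure P2 (prod_emb UNIV (\<lambda>_. step_law h) J (Pi\<^sub>E J C))"
      using P2[OF E] by simp
  qed
  then show ?thesis using P1[OF B] P2[OF B] by simp
qed

text \<open>The Markov property at the fixed time \<open>s\<close>: given \<open>F s\<close>, the values of \<open>Z\<close> and \<open>Y s\<close> are constants
and the later increments are the steps of a fresh random walk.\<close>

lemma nn_integral_increments:
  assumes s: "0 \<le> s" "0 \<le> h"
    and Z [measurable]: "Z \<in> borel_measurable (F s)"
    and H [measurable]: "case_prod H \<in> borel_measurable (borel \<Otimes>\<^sub>M (\<Pi>\<^sub>M i\<in>UNIV. step_law h))"
  shows "(\<integral>\<^sup>+\<omega>. Z \<omega> * H (Y s \<omega>) (increments s h \<omega>) \<partial>N) =
    (\<integral>\<^sup>+\<omega>. Z \<omega> * (\<integral>\<^sup>+y. H (Y s \<omega>) y \<partial>(\<Pi>\<^sub>M i\<in>UNIV. step_law h)) \<partial>N)"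
proof -
  let ?S = "\<Pi>\<^sub>M i\<in>(UNIV :: nat set). step_law h"
  let ?W = "\<lambda>\<omega>. (Z \<omega>, Y s \<omega>)" and ?B = "(borel :: ennreal measure) \<Otimes>\<^sub>M (borel :: real measure)"
  interpret random_walk "step_law h" by (rule random_walk_step_law) fact
  have incr [measurable]: "increments s h \<in> measurable N ?S" using s by measurable
  have YF [measurable]: "Y s \<in> borel_measurable (F s)" using s by (intro measurable_Y_F) auto
  have WF: "?W \<in> measurable (F s) ?B" by measurable
  have W [measurable]: "?W \<in> measurable N ?B" by (rule measurable_from_subalg[OF subalgebra_F[OF s(1)] WF])
  interpret W: prob_space "distr N ?B ?W" by (rule prob_space.prob_space_distr[OF prob_space_N]) fact
  have prod: "distr N ?B ?W \<Otimes>\<^sub>M ?S = distr N (?B \<Otimes>\<^sub>M ?S) (\<lambda>\<omega>. (?W \<omega>, increments s h \<omega>))"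
  proof (rule pair_measure_eqI)
    show "sigma_finite_measure (distr N ?B ?W)" "sigma_finite_measure ?S" by unfold_locales
    fix A B assume A: "A \<in> sets (distr N ?B ?W)" and B: "B \<in> sets ?S"
    have A': "?W -` A \<inter> space N \<in> sets (F s)"
      using measurable_sets[OF WF, of A] A space_F[OF s(1)] by simp
    have "emeasure (distr N (?B \<Otimes>\<^sub>M ?S) (\<lambda>\<omega>. (?W \<omega>, increments s h \<omega>))) (A \<times> B) =
       emeasure N ((\<lambda>\<omega>. (?W \<omega>, increments s h \<omega>)) -` (A \<times> B) \<inter> space N)"
      using A B by (intro emeasure_distr measurable_Pair W incr) auto
    also have "(\<lambda>\<omega>. (?W \<omega>, increments s h \<omega>)) -` (A \<times> B) \<inter> space N =
       (?W -` A \<inter> space N) \<inter> increments s h -` B \<inter> space N" by auto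
    also have "emeasure N \<dots> = emeasure N (?W -` A \<inter> space N) * emeasure ?S B"
      by (rule emeasure_increments[OF s A' B])
    also have "emeasure N (?W -` A \<inter> space N) = emeasure (distr N ?B ?W) A"
      using A by (intro emeasure_distr[symmetric] W) auto
    finally show "emeasure (distr N ?B ?W) A * emeasure ?S B =
      emeasure (distr N (?B \<Otimes>\<^sub>M ?S) (\<lambda>\<omega>. (?W \<omega>, increments s h \<omega>))) (A \<times> B)" by simp
  qed simp
  let ?H = "\<lambda>p. fst (fst p) * H (snd (fst p)) (snd p)"
  have "(\<lambda>p. case_prod H (snd (fst p), snd p)) \<in> borel_measurable (?B \<Otimes>\<^sub>M ?S)" by measurable
  then have [measurable]: "?H \<in> borel_measurable (?B \<Otimes>\<^sub>M ?S)" by measurable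
  have "(\<integral>\<^sup>+\<omega>. Z \<omega> * H (Y s \<omega>) (increments s h \<omega>) \<partial>N) =
     (\<integral>\<^sup>+p. ?H p \<partial>distr N (?B \<Otimes>\<^sub>M ?S) (\<lambda>\<omega>. (?W \<omega>, increments s h \<omega>)))"
    by (subst nn_integral_distr) simp_all
  also have "\<dots> = (\<integral>\<^sup>+w. \<integral>\<^sup>+y. ?H (w, y) \<partial>?S \<partial>distr N ?B ?W)"
    unfolding prod[symmetric] by (rule P.nn_integral_fst[symmetric]) simp
  also have "\<dots> = (\<integral>\<^sup>+\<omega>. \<integral>\<^sup>+y. ?H (?W \<omega>, y) \<partial>?S \<partial>N)"
    by (subst nn_integral_distr) simp_all
  also have "\<dots> = (\<integral>\<^sup>+\<omega>. Z \<omega> * (\<integral>\<^sup>+y. H (Y s \<omega>) y \<partial>?S) \<partial>N)"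
    by (intro nn_integral_cong) (simp add: nn_integral_cmult)
  finally show ?thesis .
qed

lemma law_of_increments:
  assumes h: "0 \<le> h" and [measurable]: "H \<in> borel_measurable (\<Pi>\<^sub>M i\<in>UNIV. step_law h)"
  shows "(\<integral>\<^sup>+\<omega>. H (increments 0 h \<omega>) \<partial>N) = (\<integral>\<^sup>+y. H y \<partial>(\<Pi>\<^sub>M i\<in>UNIV. step_law h))"
  using nn_integral_increments[of 0 h "\<lambda>_. 1" "\<lambda>_. H"] h by (simp add: emeasure_space_1)

lemma grid_running_Max:
  "running_Max (\<lambda>k. Y (s + real k * h) \<omega>) n = Y s \<omega> + running_Max (partial_sum (increments s h \<omega>)) n"
  unfolding running_Max_add[symmetric] partial_sum_increments by simp

text \<open>Conditionally on \<open>F s\<close> the process on the grid is a random walk started at \<open>Y s\<close>. The factorization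
for walks, applied to the shifted functions \<open>f\<close> and \<open>q\<close>, therefore persists under any weight known
at time \<open>s\<close>.\<close>

lemma grid_Wiener_Hopf:
  fixes f q :: "real \<Rightarrow> ennreal" and b :: ennreal
  assumes s: "0 \<le> s" "0 \<le> h" and Z [measurable]: "Z \<in> borel_measurable (F s)"
    and [measurable]: "f \<in> borel_measurable borel" "q \<in> borel_measurable borel"
  defines "G \<equiv> \<lambda>a. \<Sum>m. b ^ m *
      (\<integral>\<^sup>+z. q (a + running_Min (partial_sum z) m) \<partial>(\<Pi>\<^sub>M i\<in>UNIV. step_law h))"
  shows "(\<Sum>n. b ^ n * (\<integral>\<^sup>+\<omega>. Z \<omega> * (f (running_Max (\<lambda>k. Y (s + real k * h) \<omega>) n) *
            q (Y (s + real n * h) \<omega>)) \<partial>N)) * (\<Sum>n. b ^ n) =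
         (\<Sum>n. b ^ n * (\<integral>\<^sup>+\<omega>. Z \<omega> * (f (running_Max (\<lambda>k. Y (s + real k * h) \<omega>) n) *
            G (running_Max (\<lambda>k. Y (s + real k * h) \<omega>) n)) \<partial>N))"
proof -
  let ?S = "\<Pi>\<^sub>M i\<in>(UNIV :: nat set). step_law h"
  interpret random_walk "step_law h" by (rule random_walk_step_law) fact
  have YF [measurable]: "Y s \<in> borel_measurable (F s)" using s by (intro measurable_Y_F) auto
  have [measurable]: "Z \<in> borel_measurable N" "Y s \<in> borel_measurable N"
    by (rule measurable_from_subalg[OF subalgebra_F[OF s(1)]], fact)+
  have [measurable]: "G \<in> borel_measurable borel"
    unfolding G_def by measurable
  have end_pt: "Y (s + real n * h) \<omega> = Y s \<omega> + partial_sum (increments s h \<omega>) n" for n \<omega>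
    by (simp add: partial_sum_increments)
  define A where "A n a y = f (a + running_Max (partial_sum y) n) * q (a + partial_sum y n)" for n a y
  define B where "B n a y = f (a + running_Max (partial_sum y) n) * G (a + running_Max (partial_sum y) n)" for n a y
  have [measurable]: "case_prod (A n) \<in> borel_measurable (borel \<Otimes>\<^sub>M ?S)"
      "case_prod (B n) \<in> borel_measurable (borel \<Otimes>\<^sub>M ?S)" for n
    unfolding A_def B_def by measurable
  have move: "(\<Sum>n. b ^ n * (\<integral>\<^sup>+\<omega>. Z \<omega> * C n (Y s \<omega>) (increments s h \<omega>) \<partial>N)) =
      (\<integral>\<^sup>+\<omega>. Z \<omega> * (\<Sum>n. b ^ n * (\<integral>\<^sup>+y. C n (Y s \<omega>) y \<partial>?S)) \<partial>N)"
    if [measurable]: "\<And>n. case_prod (C n) \<in> borel_measurable (borel \<Otimes>\<^sub>M ?S)" for C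
  proof -
    have "(\<Sum>n. b ^ n * (\<integral>\<^sup>+\<omega>. Z \<omega> * C n (Y s \<omega>) (increments s h \<omega>) \<partial>N)) =
      (\<Sum>n. \<integral>\<^sup>+\<omega>. b ^ n * (Z \<omega> * (\<integral>\<^sup>+y. C n (Y s \<omega>) y \<partial>?S)) \<partial>N)"
      by (subst nn_integral_increments[OF s Z that]) (simp add: nn_integral_cmult)
    also have "\<dots> = (\<integral>\<^sup>+\<omega>. (\<Sum>n. Z \<omega> * (b ^ n * (\<integral>\<^sup>+y. C n (Y s \<omega>) y \<partial>?S))) \<partial>N)"
      by (subst nn_integral_suminf[symmetric]) (simp_all add: mult.left_commute)
    finally show ?thesis by simp
  qed
  have walk: "(\<Sum>n. b ^ n * (\<integral>\<^sup>+y. A n a y \<partial>?S)) * (\<Sum>n. b ^ n) = (\<Sum>n. b ^ n * (\<integral>\<^sup>+y. B n a y \<partial>?S))" for a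
    unfolding A_def B_def G_def
    using Wiener_Hopf_random_walk[of "\<lambda>x. f (a + x)" "\<lambda>x. q (a + x)" b] by (simp add: add.assoc)
  have "(\<Sum>n. b ^ n * (\<integral>\<^sup>+\<omega>. Z \<omega> * A n (Y s \<omega>) (increments s h \<omega>) \<partial>N)) * (\<Sum>n. b ^ n) =
      (\<integral>\<^sup>+\<omega>. Z \<omega> * ((\<Sum>n. b ^ n * (\<integral>\<^sup>+y. A n (Y s \<omega>) y \<partial>?S)) * (\<Sum>n. b ^ n)) \<partial>N)"
    by (subst move) (simp_all add: nn_integral_multc[symmetric] mult.assoc)
  also have "\<dots> = (\<Sum>n. b ^ n * (\<integral>\<^sup>+\<omega>. Z \<omega> * B n (Y s \<omega>) (increments s h \<omega>) \<partial>N))"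
    by (subst move) (simp_all add: walk)
  finally show ?thesis
    unfolding grid_running_Max unfolding end_pt A_def B_def .
qed

lemma grid_running_Min_law:
  assumes h: "0 \<le> h" and [measurable]: "q \<in> borel_measurable borel"
  shows "(\<integral>\<^sup>+z. q (a + running_Min (partial_sum z) m) \<partial>(\<Pi>\<^sub>M i\<in>UNIV. step_law h)) =
    (\<integral>\<^sup>+\<omega>. q (a + running_Min (\<lambda>k. Y (real k * h) \<omega> - Y 0 \<omega>) m) \<partial>N)"
proof -
  interpret random_walk "step_law h" by (rule random_walk_step_law) fact
  have "(\<integral>\<^sup>+\<omega>. q (a + running_Min (partial_sum (increments 0 h \<omega>)) m) \<partial>N) =
    (\<integral>\<^sup>+z. q (a + running_Min (partial_sum z) m) \<partial>(\<Pi>\<^sub>M i\<in>UNIV. step_law h))"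
    by (rule law_of_increments[OF h]) measurable
  moreover have "partial_sum (increments 0 h \<omega>) = (\<lambda>k. Y (real k * h) \<omega> - Y 0 \<omega>)" for \<omega>
    by (rule ext) (simp add: partial_sum_increments)
  ultimately show ?thesis by simp
qed

end

section \<open>Right-continuous paths and their values on a grid\<close>

lemma cadlag_continuous_at_right: "cadlag f \<Longrightarrow> 0 \<le> t \<Longrightarrow> continuous (at_right t) f"
  by (simp add: cadlag_def)

text \<open>A cadlag function is bounded near each point, on the right by right-continuity and on the left by
the existence of the left limit; compactness does the rest.\<close>

lemma cadlag_bounded:
  assumes f: "cadlag f"
  shows "\<exists>B. \<forall>s\<in>{0..t}. \<bar>f s\<bar> \<le> B"
proof -
  define C where "C = {U. open U \<and> (\<exists>B. \<forall>u\<in>U \<inter> {0..}. \<bar>f u\<bar> \<le> B)}"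
  have "\<exists>U\<in>C. s \<in> U" if "s \<in> {0..t}" for s
  proof -
    have "(f \<longlongrightarrow> f s) (at_right s)"
      using cadlag_continuous_at_right[OF f, of s] that by (simp add: continuous_within)
    then have "\<forall>\<^sub>F u in at_right s. dist (f u) (f s) < 1" by (rule tendstoD) simp
    then obtain b where b: "s < b" "\<And>u. s < u \<Longrightarrow> u < b \<Longrightarrow> dist (f u) (f s) < 1"
      unfolding eventually_at_right_field by blast
    obtain a l where a: "a < s" "\<And>u. a < u \<Longrightarrow> u < s \<Longrightarrow> 0 \<le> u \<Longrightarrow> dist (f u) l < 1"
    proof (cases "s = 0")
      case True
      then show ?thesis by (intro that[of "-1"]) auto
    next
      case False
      then have "0 < s" using \<open>s \<in> {0..t}\<close> by auto
      then obtain l where "(f \<longlongrightarrow> l) (at_left s)" using f unfolding cadlag_def by blast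
      then have "\<forall>\<^sub>F u in at_left s. dist (f u) l < 1" by (rule tendstoD) simp
      then show ?thesis unfolding eventually_at_left_field using that by blast
    qed
    have "\<bar>f u\<bar> \<le> \<bar>f s\<bar> + \<bar>l\<bar> + 1" if "u \<in> {a<..<b} \<inter> {0..}" for u
    proof -
      consider "u < s" | "u = s" | "s < u" by linarith
      then show ?thesis
        using that a(2)[of u] b(2)[of u] by cases (auto simp: dist_real_def)
    qed
    then have "\<exists>B. \<forall>u\<in>{a<..<b} \<inter> {0..}. \<bar>f u\<bar> \<le> B" by blast
    then have "{a<..<b} \<in> C" unfolding C_def by simp
    with a b show ?thesis by (intro bexI[of _ "{a<..<b}"]) auto
  qed
  then have "{0..t} \<subseteq> \<Union>C" by blast
  moreover have "\<And>U. U \<in> C \<Longrightarrow> open U" by (simp add: C_def)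
  ultimately obtain D where D: "D \<subseteq> C" "finite D" "{0..t} \<subseteq> \<Union>D"
    using compactE[OF compact_Icc] by metis
  have "\<forall>U\<in>D. \<exists>B. \<forall>u\<in>U \<inter> {0..}. \<bar>f u\<bar> \<le> B" using D(1) by (auto simp: C_def)
  then obtain b where b: "\<And>U u. U \<in> D \<Longrightarrow> u \<in> U \<Longrightarrow> 0 \<le> u \<Longrightarrow> \<bar>f u\<bar> \<le> b U"
    by (auto dest!: bchoice)
  have "\<bar>f s\<bar> \<le> (\<Sum>U\<in>D. \<bar>b U\<bar>)" if s: "s \<in> {0..t}" for s
  proof -
    obtain U where U: "U \<in> D" "s \<in> U" using D(3) s by auto
    then have "\<bar>f s\<bar> \<le> \<bar>b U\<bar>" using b[OF U] s by auto
    also have "\<dots> \<le> (\<Sum>U\<in>D. \<bar>b U\<bar>)" by (rule member_le_sum) (use U D in auto)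
    finally show ?thesis .
  qed
  then show ?thesis by blast
qed

lemma cadlag_bdd:
  assumes "cadlag f"
  shows "bdd_above (f ` {0..t})" "bdd_below (f ` {0..t})"
proof -
  obtain B where "\<forall>s\<in>{0..t}. \<bar>f s\<bar> \<le> B" using cadlag_bounded[OF assms] by blast
  then show "bdd_above (f ` {0..t})" "bdd_below (f ` {0..t})"
    by (auto intro!: bdd_aboveI[of _ B] bdd_belowI[of _ "-B"] simp: abs_le_iff)
qed

lemma cadlag_shift:
  assumes f: "cadlag f" and s: "0 \<le> s" shows "cadlag (\<lambda>t. f (s + t))"
  unfolding cadlag_def
proof safe
  fix t :: real assume "0 \<le> t"
  then have "(f \<longlongrightarrow> f (s + t)) (at_right (s + t))"
    using cadlag_continuous_at_right[OF f, of "s + t"] s by (simp add: continuous_within)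
  moreover have "filterlim (\<lambda>u. s + u) (at_right (s + t)) (at_right t)"
    by (auto simp: filterlim_at eventually_at_filter intro!: tendsto_intros)
  ultimately show "continuous (at_right t) (\<lambda>t. f (s + t))"
    unfolding continuous_within by (rule filterlim_compose)
next
  fix t :: real assume "0 < t"
  then obtain l where "(f \<longlongrightarrow> l) (at_left (s + t))"
    using f s unfolding cadlag_def by (metis add_nonneg_pos)
  moreover have "filterlim (\<lambda>u. s + u) (at_left (s + t)) (at_left t)"
    by (auto simp: filterlim_at eventually_at_filter intro!: tendsto_intros)
  ultimately show "\<exists>l. ((\<lambda>t. f (s + t)) \<longlongrightarrow> l) (at_left t)"
    by (blast intro: filterlim_compose)
qed

definition mesh :: "nat \<Rightarrow> real" where "mesh n = 1 / real (Suc n)"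

text \<open>The index of the first grid point strictly after \<open>t\<close>. Approximation from the right is what the
right-continuity of the paths asks for.\<close>

definition next_grid :: "nat \<Rightarrow> real \<Rightarrow> nat" where
  "next_grid n t = Suc (nat \<lfloor>real (Suc n) * t\<rfloor>)"

lemma mesh_pos: "0 < mesh n"
  by (simp add: mesh_def)

lemma mesh_tendsto_0: "mesh \<longlonglongrightarrow> 0"
  unfolding mesh_def using lim_inverse_n' LIMSEQ_Suc by blast

lemma next_grid_gt: "0 \<le> t \<Longrightarrow> t < real (next_grid n t) * mesh n"
  and next_grid_le: "0 \<le> t \<Longrightarrow> real (next_grid n t) * mesh n \<le> t + mesh n"
proof -
  assume t: "0 \<le> t"
  have "real (nat \<lfloor>real (Suc n) * t\<rfloor>) = of_int \<lfloor>real (Suc n) * t\<rfloor>" using t by simp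
  then have "real (Suc n) * t < real (next_grid n t)" "real (next_grid n t) \<le> real (Suc n) * t + 1"
    unfolding next_grid_def by linarith+
  moreover have "real (Suc n) * t * mesh n = t" by (simp add: mesh_def)
  ultimately show "t < real (next_grid n t) * mesh n" "real (next_grid n t) * mesh n \<le> t + mesh n"
    using mult_strict_right_mono[OF _ mesh_pos[of n], of "real (Suc n) * t" "real (next_grid n t)"]
      mult_right_mono[OF _ less_imp_le[OF mesh_pos[of n]], of "real (next_grid n t)" "real (Suc n) * t + 1"]
    by (simp_all add: distrib_right)
qed

lemma next_grid_mono: "s \<le> t \<Longrightarrow> next_grid n s \<le> next_grid n t"
  unfolding next_grid_def by (intro Suc_le_mono[THEN iffD2] nat_mono floor_mono mult_left_mono) auto

lemma next_grid_tendsto: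
  assumes "0 \<le> t" shows "filterlim (\<lambda>n. real (next_grid n t) * mesh n) (at_right t) sequentially"
proof -
  have "(\<lambda>n. real (next_grid n t) * mesh n) \<longlonglongrightarrow> t"
  proof (rule tendsto_sandwich[OF always_eventually always_eventually tendsto_const])
    show "(\<lambda>n. t + mesh n) \<longlonglongrightarrow> t" using tendsto_add[OF tendsto_const mesh_tendsto_0, of t] by simp
    show "\<forall>n. t \<le> real (next_grid n t) * mesh n" using next_grid_gt[OF assms] by (simp add: less_imp_le)
    show "\<forall>n. real (next_grid n t) * mesh n \<le> t + mesh n" using next_grid_le[OF assms] by simp
  qed
  then show ?thesis
    using next_grid_gt[OF assms] less_imp_neq[OF next_grid_gt[OF assms], symmetric]
    by (simp add: filterlim_at)
qed

lemma grid_value_tendsto: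
  assumes "continuous (at_right t) f" "0 \<le> t"
  shows "(\<lambda>n. f (real (next_grid n t) * mesh n)) \<longlonglongrightarrow> f t"
  using assms by (intro filterlim_compose[OF _ next_grid_tendsto]) (auto simp: continuous_within)

text \<open>Grid points approach every time before \<open>t\<close> from the right, so the grid maximum eventually exceeds
every value below the supremum. The only grid point beyond \<open>t\<close> is within one mesh of it, so that
right-continuity at \<open>t\<close> prevents an overshoot in the limit.\<close>

lemma running_Max_grid_tendsto:
  assumes f: "\<And>u. 0 \<le> u \<Longrightarrow> continuous (at_right u) f" and bdd: "bdd_above (f ` {0..t})" and t: "0 \<le> t"
  shows "(\<lambda>n. running_Max (\<lambda>k. f (real k * mesh n)) (next_grid n t)) \<longlonglongrightarrow> (SUP u\<in>{0..t}. f u)"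
proof (rule order_tendstoI)
  fix c assume "c < (SUP u\<in>{0..t}. f u)"
  then obtain s where s: "s \<in> {0..t}" "c < f s"
    using t by (auto simp: less_cSUP_iff[OF _ bdd])
  then have "\<forall>\<^sub>F n in sequentially. c < f (real (next_grid n s) * mesh n)"
    using grid_value_tendsto[OF f[of s]] by (auto dest: order_tendstoD)
  then show "\<forall>\<^sub>F n in sequentially. c < running_Max (\<lambda>k. f (real k * mesh n)) (next_grid n t)"
  proof eventually_elim
    case (elim n)
    have "next_grid n s \<le> next_grid n t" using s by (intro next_grid_mono) auto
    then have "f (real (next_grid n s) * mesh n) \<le> running_Max (\<lambda>k. f (real k * mesh n)) (next_grid n t)"
      unfolding running_Max_def by (intro Max_ge) auto
    with elim show ?case by simp
  qed
next
  fix c assume c: "(SUP u\<in>{0..t}. f u) < c"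
  then have le: "f u < c" if "u \<in> {0..t}" for u
    using cSUP_upper[OF that bdd] by simp
  have "(f \<longlongrightarrow> f t) (at_right t)" using f[OF t] by (simp add: continuous_within)
  then have "\<forall>\<^sub>F u in at_right t. f u < c" using le[of t] t by (auto dest: order_tendstoD)
  then obtain d where d: "t < d" "\<And>u. t < u \<Longrightarrow> u < d \<Longrightarrow> f u < c"
    unfolding eventually_at_right_field by blast
  have "\<forall>\<^sub>F n in sequentially. mesh n < d - t"
    using order_tendstoD(2)[OF mesh_tendsto_0] d by simp
  then show "\<forall>\<^sub>F n in sequentially. running_Max (\<lambda>k. f (real k * mesh n)) (next_grid n t) < c"
  proof eventually_elim
    case (elim n)
    have "f (real k * mesh n) < c" if "k \<le> next_grid n t" for k
    proof -
      have "real k * mesh n \<le> real (next_grid n t) * mesh n" using that mesh_pos[of n] by simp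
      then have "real k * mesh n < d" using next_grid_le[OF t, of n] elim by linarith
      moreover have "0 \<le> real k * mesh n" using mesh_pos[of n] by simp
      ultimately show ?thesis using le[of "real k * mesh n"] d(2)[of "real k * mesh n"] by fastforce
    qed
    then show ?case unfolding running_Max_def by (subst Max_less_iff) auto
  qed
qed

lemma running_Min_grid_tendsto:
  assumes f: "\<And>u. 0 \<le> u \<Longrightarrow> continuous (at_right u) f" and bdd: "bdd_below (f ` {0..t})" and t: "0 \<le> t"
  shows "(\<lambda>n. running_Min (\<lambda>k. f (real k * mesh n)) (next_grid n t)) \<longlonglongrightarrow> (INF u\<in>{0..t}. f u)"
proof -
  have "(\<lambda>n. running_Max (\<lambda>k. - f (real k * mesh n)) (next_grid n t)) \<longlonglongrightarrow> (SUP u\<in>{0..t}. - f u)"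
    using bdd by (intro running_Max_grid_tendsto f t continuous_minus)
      (auto simp: bdd_above_def bdd_below_def intro: le_imp_neg_le)
  then have "(\<lambda>n. - running_Max (\<lambda>k. - f (real k * mesh n)) (next_grid n t)) \<longlonglongrightarrow> - (SUP u\<in>{0..t}. - f u)"
    by (rule tendsto_minus)
  then show ?thesis unfolding running_Max_minus by (simp add: Inf_real_def image_image)
qed

section \<open>Geometric times on a grid and exponential discounting\<close>

text \<open>The measure \<open>exp (- r t) dt\<close> on the nonnegative half-line; \<open>r\<close> times it is the exponential law.\<close>

definition discount_measure :: "real \<Rightarrow> real measure" where
  "discount_measure r = density (restrict_space lborel {0..}) (\<lambda>t. ennreal (exp (- r * t)))"

lemma space_discount_measure [simp]: "space (discount_measure r) = {0..}"
  by (simp add: discount_measure_def space_restrict_space)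

lemma sets_discount_measure [measurable_cong, simp]: "sets (discount_measure r) = sets (restrict_space borel {0..})"
  by (simp add: discount_measure_def sets_restrict_space)

lemma nn_integral_discount_measure:
  assumes [measurable]: "g \<in> borel_measurable (restrict_space borel {0..})"
  shows "(\<integral>\<^sup>+t. g t \<partial>discount_measure r) = (\<integral>\<^sup>+t. g t * ennreal (exp (- r * t)) \<partial>restrict_space lborel {0..})"
  unfolding discount_measure_def
proof (subst nn_integral_density)
  show "g \<in> borel_measurable (restrict_space lborel {0..})"
    using assms by (simp cong: measurable_cong_sets add: sets_restrict_space)
qed (simp_all add: mult.commute measurable_restrict_space1)

lemma emeasure_discount_measure:
  assumes [measurable]: "A \<in> sets borel" and A: "A \<subseteq> {0..}"
  shows "emeasure (discount_measure r) A = (\<integral>\<^sup>+t. ennreal (exp (- r * t)) * indicator A t \<partial>lborel)"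
proof -
  have "emeasure (discount_measure r) A =
      (\<integral>\<^sup>+t. ennreal (exp (- r * t)) * indicator A t \<partial>restrict_space lborel {0..})"
    unfolding discount_measure_def using A
    by (subst emeasure_density) (auto simp: sets_restrict_space_iff measurable_restrict_space1)
  also have "\<dots> = (\<integral>\<^sup>+t. ennreal (exp (- r * t)) * indicator A t * indicator {0..} t \<partial>lborel)"
    by (subst nn_integral_restrict_space) simp_all
  also have "\<dots> = (\<integral>\<^sup>+t. ennreal (exp (- r * t)) * indicator A t \<partial>lborel)"
    using A by (intro nn_integral_cong) (auto simp: indicator_def)
  finally show ?thesis .
qed

lemma emeasure_discount_measure_interval:
  assumes r: "0 < r" and ab: "0 \<le> a" "a \<le> b"
  shows "emeasure (discount_measure r) {a..<b} = ennreal ((exp (- r * a) - exp (- r * b)) / r)"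
proof -
  have "emeasure (discount_measure r) {a..<b} =
      (\<integral>\<^sup>+t. ennreal (exp (- r * t)) * indicator {a..<b} t \<partial>lborel)"
    using ab by (intro emeasure_discount_measure) auto
  also have "\<dots> = (\<integral>\<^sup>+t. ennreal (exp (- r * t)) * indicator {a..b} t \<partial>lborel)"
  proof (rule nn_integral_cong_AE)
    show "AE t in lborel. ennreal (exp (- r * t)) * indicator {a..<b} t =
        ennreal (exp (- r * t)) * indicator {a..b} t"
      using AE_lborel_singleton[of b] by eventually_elim (use ab in \<open>auto simp: indicator_def\<close>)
  qed
  also have "\<dots> = ennreal (- exp (- r * b) / r - (- exp (- r * a) / r))"
    using r ab
    by (intro nn_integral_FTC_Icc) (auto intro!: derivative_eq_intros)
  also have "\<dots> = ennreal ((exp (- r * a) - exp (- r * b)) / r)"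
    by (simp add: diff_divide_distrib)
  finally show ?thesis .
qed

lemma grid_cell: "{t\<in>{0..}. next_grid n t = Suc k} = {real k * mesh n..<real (Suc k) * mesh n}"
proof -
  have eq: "next_grid n t = Suc k \<longleftrightarrow> real k * mesh n \<le> t \<and> t < real (Suc k) * mesh n" if "0 \<le> t" for t
  proof -
    have "0 \<le> \<lfloor>real (Suc n) * t\<rfloor>" using that by simp
    then have "next_grid n t = Suc k \<longleftrightarrow> \<lfloor>real (Suc n) * t\<rfloor> = int k" unfolding next_grid_def by auto
    also have "\<dots> \<longleftrightarrow> real k \<le> real (Suc n) * t \<and> real (Suc n) * t < real k + 1"
      by (auto simp: floor_eq_iff)
    also have "\<dots> \<longleftrightarrow> real k * mesh n \<le> t \<and> t < real (Suc k) * mesh n"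
      unfolding mesh_def by (auto simp: field_simps)
    finally show ?thesis .
  qed
  have "0 \<le> real k * mesh n" using mesh_pos[of n] by simp
  then have "0 \<le> t" if "real k * mesh n \<le> t" for t using that by linarith
  then show ?thesis unfolding set_eq_iff mem_Collect_eq atLeast_iff atLeastLessThan_iff using eq by blast
qed

lemma emeasure_grid_cell:
  assumes "0 < r"
  shows "emeasure (discount_measure r) {t\<in>{0..}. next_grid n t = Suc k} =
    ennreal (exp (- r * mesh n) ^ k * (1 - exp (- r * mesh n)) / r)"
proof -
  have "exp (- r * (real k * mesh n)) = exp (- r * mesh n) ^ k" for k
    by (simp add: exp_of_nat_mult[symmetric] algebra_simps)
  note power = this
  have "0 \<le> real k * mesh n" "real k * mesh n \<le> real (Suc k) * mesh n" using mesh_pos[of n] by simp_all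
  then have "emeasure (discount_measure r) {t\<in>{0..}. next_grid n t = Suc k} =
      ennreal ((exp (- r * mesh n) ^ k - exp (- r * mesh n) ^ Suc k) / r)"
    unfolding grid_cell using assms by (subst emeasure_discount_measure_interval) (simp_all only: power)
  then show ?thesis by (simp add: algebra_simps)
qed

lemma nn_integral_grid:
  assumes r: "0 < r"
  shows "(\<integral>\<^sup>+t. c (next_grid n t) \<partial>discount_measure r) =
    (\<Sum>k. ennreal (exp (- r * mesh n) ^ k * (1 - exp (- r * mesh n)) / r) * c (Suc k))"
proof -
  have cell: "{t\<in>{0..}. next_grid n t = Suc k} \<in> sets (discount_measure r)" for k
  proof -
    have "0 \<le> real k * mesh n" using mesh_pos[of n] by simp
    then have "{real k * mesh n..<real (Suc k) * mesh n} \<subseteq> {0..}" by auto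
    then show ?thesis unfolding grid_cell by (subst sets_discount_measure, subst sets_restrict_space_iff) simp_all
  qed
  have "(\<integral>\<^sup>+t. c (next_grid n t) \<partial>discount_measure r) =
     (\<integral>\<^sup>+t. (\<Sum>k. c (Suc k) * indicator {t\<in>{0..}. next_grid n t = Suc k} t) \<partial>discount_measure r)"
  proof (rule nn_integral_cong)
    fix t assume t: "t \<in> space (discount_measure r)"
    have "(\<Sum>k. c (Suc k) * indicator {t\<in>{0..}. next_grid n t = Suc k} t) =
       (\<Sum>k\<in>{nat \<lfloor>real (Suc n) * t\<rfloor>}. c (Suc k) * indicator {t\<in>{0..}. next_grid n t = Suc k} t)"
      by (rule suminf_finite) (auto simp: next_grid_def indicator_def)
    also have "\<dots> = c (next_grid n t)"
      using t by (simp add: next_grid_def)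
    finally show "c (next_grid n t) = (\<Sum>k. c (Suc k) * indicator {t\<in>{0..}. next_grid n t = Suc k} t)"
      by (rule sym)
  qed
  also have "\<dots> = (\<Sum>k. c (Suc k) * emeasure (discount_measure r) {t\<in>{0..}. next_grid n t = Suc k})"
    using cell by (subst nn_integral_suminf) (auto simp: nn_integral_cmult_indicator)
  finally show ?thesis
    by (simp only: emeasure_grid_cell[OF r] mult.commute)
qed

text \<open>The number of complete cells before an exponential time is geometric. Since \<open>next_grid\<close> exceeds this
number by one, the index is shifted and \<open>c 0\<close> remains as a boundary term, whose weight vanishes with
the mesh.\<close>

lemma geometric_sum_eq_exponential_integral:
  fixes c :: "nat \<Rightarrow> ennreal" and n :: nat
  assumes r: "0 < r"
  defines "b \<equiv> exp (- r * mesh n)"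
  shows "ennreal ((1 - b) / r) * (\<Sum>k. ennreal b ^ k * c k) =
    ennreal ((1 - b) / r) * c 0 + ennreal b * (\<integral>\<^sup>+t. c (next_grid n t) \<partial>discount_measure r)"
proof -
  have b: "0 < b" "b < 1" using r mesh_pos[of n] by (auto simp: b_def)
  have "(\<Sum>k. ennreal b ^ k * c k) = c 0 + (\<Sum>k. ennreal b ^ Suc k * c (Suc k))"
    by (subst suminf_offset[where i = 1]) simp_all
  moreover have "ennreal ((1 - b) / r) * (\<Sum>k. ennreal b ^ Suc k * c (Suc k)) =
      ennreal b * (\<integral>\<^sup>+t. c (next_grid n t) \<partial>discount_measure r)"
    unfolding nn_integral_grid[OF r] ennreal_suminf_cmult[symmetric] b_def[symmetric]
  proof (rule suminf_cong)
    fix k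
    have "ennreal ((1 - b) / r) * ennreal b ^ Suc k = ennreal b * ennreal (b ^ k * (1 - b) / r)"
      unfolding ennreal_power[OF less_imp_le[OF b(1)]] using b r
      by (subst (1 2) ennreal_mult[symmetric]) (simp_all add: mult_ac)
    then show "ennreal ((1 - b) / r) * (ennreal b ^ Suc k * c (Suc k)) =
        ennreal b * (ennreal (b ^ k * (1 - b) / r) * c (Suc k))"
      by (simp only: mult.assoc[symmetric])
  qed
  ultimately show ?thesis by (simp add: distrib_left)
qed

lemma suminf_geometric_ennreal:
  assumes "0 \<le> b" "b < 1" shows "(\<Sum>k. ennreal b ^ k) = ennreal (1 / (1 - b))"
proof -
  have "(\<lambda>k. b ^ k) sums (1 / (1 - b))" using assms by (intro geometric_sums) simp
  then have "(\<Sum>k. ennreal (b ^ k)) = ennreal (1 / (1 - b))"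
    using assms by (intro suminf_ennreal_eq) auto
  then show ?thesis by (simp only: ennreal_power[OF assms(1)])
qed

definition grid_discount :: "real \<Rightarrow> nat \<Rightarrow> real" where
  "grid_discount r n = exp (- r * mesh n)"

lemma grid_discount_bounds: "0 < r \<Longrightarrow> 0 < grid_discount r n" "0 < r \<Longrightarrow> grid_discount r n < 1"
  using mesh_pos[of n] by (auto simp: grid_discount_def)

lemma grid_discount_tendsto: "(\<lambda>n. grid_discount r n) \<longlonglongrightarrow> 1"
proof -
  have "(\<lambda>n. exp (- r * mesh n)) \<longlonglongrightarrow> exp (- r * 0)"
    by (intro tendsto_intros mesh_tendsto_0)
  then show ?thesis by (simp add: grid_discount_def)
qed

text \<open>The mean of \<open>c\<close> at a geometric time, divided by \<open>r\<close> to match the total mass of the discount measure.\<close>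

definition geometric_mean :: "real \<Rightarrow> nat \<Rightarrow> (nat \<Rightarrow> ennreal) \<Rightarrow> ennreal" where
  "geometric_mean r n c = ennreal ((1 - grid_discount r n) / r) * (\<Sum>k. ennreal (grid_discount r n) ^ k * c k)"

lemma geometric_mean_eq:
  "0 < r \<Longrightarrow> geometric_mean r n c = ennreal ((1 - grid_discount r n) / r) * c 0 +
     ennreal (grid_discount r n) * (\<integral>\<^sup>+t. c (next_grid n t) \<partial>discount_measure r)"
  unfolding geometric_mean_def grid_discount_def by (rule geometric_sum_eq_exponential_integral)

lemma geometric_mean_const:
  assumes r: "0 < r" shows "geometric_mean r n (\<lambda>_. w) = ennreal (1 / r) * w"
proof -
  let ?b = "grid_discount r n"
  have b: "0 \<le> ?b" "?b < 1" using grid_discount_bounds[OF r, of n] by simp_all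
  have "geometric_mean r n (\<lambda>_. w) = ennreal ((1 - ?b) / r) * (ennreal (1 / (1 - ?b)) * w)"
    unfolding geometric_mean_def by (simp add: suminf_geometric_ennreal[OF b])
  also have "\<dots> = ennreal ((1 - ?b) / r * (1 / (1 - ?b))) * w"
    using b r by (subst ennreal_mult) (simp_all add: mult.assoc)
  also have "(1 - ?b) / r * (1 / (1 - ?b)) = 1 / r" using b by simp
  finally show ?thesis .
qed

lemma geometric_mean_mono: "(\<And>k. c k \<le> d k) \<Longrightarrow> geometric_mean r n c \<le> geometric_mean r n d"
  unfolding geometric_mean_def by (intro mult_left_mono suminf_le) auto

lemma measurable_next_grid [measurable]:
  "next_grid n \<in> measurable (discount_measure r) (count_space UNIV)"
proof -
  have "next_grid n \<in> measurable borel (count_space UNIV)" unfolding next_grid_def by measurable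
  then show ?thesis
    unfolding measurable_cong_sets[OF sets_discount_measure refl] by (rule measurable_restrict_space1)
qed

lemma borel_measurable_next_grid: "(\<lambda>t. c (next_grid n t)) \<in> borel_measurable (discount_measure r)"
  by (rule measurable_compose[OF measurable_next_grid]) simp

lemma emeasure_discount_measure_space:
  assumes r: "0 < r" shows "emeasure (discount_measure r) {0..} = ennreal (1 / r)"
proof -
  have "(\<integral>\<^sup>+t. ennreal (exp (- r * t)) * indicator {0..} t \<partial>lborel) = ennreal (0 - (- exp (- r * 0) / r))"
  proof (rule nn_integral_FTC_atLeast)
    have "((\<lambda>t. exp (- r * t)) \<longlongrightarrow> 0) at_top"
      using r by (intro filterlim_compose[OF exp_at_bot] filterlim_tendsto_neg_mult_at_bot[OF tendsto_const])
        (auto intro: filterlim_ident)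
    then have "((\<lambda>t. - (exp (- r * t) / r)) \<longlongrightarrow> - (0 / r)) at_top"
      using r by (intro tendsto_intros) auto
    then show "((\<lambda>t. - exp (- r * t) / r) \<longlongrightarrow> 0) at_top" by simp
  qed (use r in \<open>auto intro!: derivative_eq_intros\<close>)
  then show ?thesis by (subst emeasure_discount_measure) simp_all
qed

lemma grid_discount_gap_vanishes:
  fixes w :: "nat \<Rightarrow> ennreal"
  assumes r: "0 < r" and W: "W < \<infinity>" and le: "\<And>n. w n \<le> W"
  shows "(\<lambda>n. ennreal ((1 - grid_discount r n) / r) * w n) \<longlonglongrightarrow> 0"
proof (rule tendsto_sandwich[OF _ _ tendsto_const])
  have "(\<lambda>n. ennreal ((1 - grid_discount r n) / r)) \<longlonglongrightarrow> ennreal ((1 - 1) / r)"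
    using r by (intro tendsto_ennrealI tendsto_intros grid_discount_tendsto) auto
  then show "(\<lambda>n. ennreal ((1 - grid_discount r n) / r) * W) \<longlonglongrightarrow> 0"
    using tendsto_mult_ennreal[OF _ tendsto_const, of _ 0 sequentially W] W by simp
qed (auto intro!: always_eventually mult_left_mono le)

text \<open>The boundary term vanishes and the remaining integral converges by domination.\<close>

lemma geometric_mean_tendsto:
  fixes c :: "nat \<Rightarrow> nat \<Rightarrow> ennreal"
  assumes r: "0 < r" and W: "W < \<infinity>" and le: "\<And>n k. c n k \<le> W"
    and lim: "\<And>t. 0 \<le> t \<Longrightarrow> (\<lambda>n. c n (next_grid n t)) \<longlonglongrightarrow> v t"
  shows "(\<lambda>n. geometric_mean r n (c n)) \<longlonglongrightarrow> (\<integral>\<^sup>+t. v t \<partial>discount_measure r)"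
proof -
  have meas: "(\<lambda>t. c n (next_grid n t)) \<in> borel_measurable (discount_measure r)" for n
    by (rule borel_measurable_next_grid)
  have "(\<lambda>n. \<integral>\<^sup>+t. c n (next_grid n t) \<partial>discount_measure r) \<longlonglongrightarrow> (\<integral>\<^sup>+t. v t \<partial>discount_measure r)"
  proof (rule nn_integral_dominated_convergence[where w = "\<lambda>_. W"])
    show "v \<in> borel_measurable (discount_measure r)"
      by (rule borel_measurable_LIMSEQ_order[OF _ meas]) (use lim in auto)
    show "(\<integral>\<^sup>+t. W \<partial>discount_measure r) < \<infinity>"
      using W emeasure_discount_measure_space[OF r] by (simp add: ennreal_mult_less_top)
  qed (use le lim meas in auto)
  moreover have "(\<lambda>n. ennreal (grid_discount r n)) \<longlonglongrightarrow> 1"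
    using tendsto_ennrealI[OF grid_discount_tendsto] by simp
  ultimately have "(\<lambda>n. ennreal (grid_discount r n) * (\<integral>\<^sup>+t. c n (next_grid n t) \<partial>discount_measure r))
      \<longlonglongrightarrow> 1 * (\<integral>\<^sup>+t. v t \<partial>discount_measure r)"
    by (intro tendsto_mult_ennreal) auto
  moreover have "(\<lambda>n. ennreal ((1 - grid_discount r n) / r) * c n 0) \<longlonglongrightarrow> 0"
    by (rule grid_discount_gap_vanishes[OF r W le])
  ultimately have "(\<lambda>n. ennreal ((1 - grid_discount r n) / r) * c n 0 +
     ennreal (grid_discount r n) * (\<integral>\<^sup>+t. c n (next_grid n t) \<partial>discount_measure r))
      \<longlonglongrightarrow> 0 + 1 * (\<integral>\<^sup>+t. v t \<partial>discount_measure r)"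
    by (intro tendsto_add)
  then show ?thesis by (simp only: geometric_mean_eq[OF r] mult_1 add_0)
qed

section \<open>The Wiener-Hopf factorization of a Levy process\<close>

lemma nn_integral_weighted_bounded_convergence:
  fixes h :: "nat \<Rightarrow> 'a \<Rightarrow> ennreal"
  assumes Z: "Z \<in> borel_measurable M" "(\<integral>\<^sup>+\<omega>. Z \<omega> \<partial>M) < \<infinity>"
    and h: "\<And>n. h n \<in> borel_measurable M" "\<And>n \<omega>. h n \<omega> \<le> c" and c: "c < \<infinity>"
    and lim: "\<And>\<omega>. \<omega> \<in> space M \<Longrightarrow> (\<lambda>n. h n \<omega>) \<longlonglongrightarrow> h' \<omega>"
  shows "(\<lambda>n. \<integral>\<^sup>+\<omega>. Z \<omega> * h n \<omega> \<partial>M) \<longlonglongrightarrow> (\<integral>\<^sup>+\<omega>. Z \<omega> * h' \<omega> \<partial>M)"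
proof (rule nn_integral_dominated_convergence[where w = "\<lambda>\<omega>. Z \<omega> * c"])
  have "h' \<in> borel_measurable M" by (rule borel_measurable_LIMSEQ_order[OF lim h(1)])
  then show "(\<lambda>\<omega>. Z \<omega> * h' \<omega>) \<in> borel_measurable M" using Z(1) by simp
  show "(\<integral>\<^sup>+\<omega>. Z \<omega> * c \<partial>M) < \<infinity>" using Z c by (simp add: nn_integral_multc ennreal_mult_less_top)
  have "AE \<omega> in M. Z \<omega> \<noteq> \<infinity>" using Z by (intro nn_integral_PInf_AE) auto
  then show "AE \<omega> in M. (\<lambda>n. Z \<omega> * h n \<omega>) \<longlonglongrightarrow> Z \<omega> * h' \<omega>"
    using AE_space
  proof eventually_elim
    case (elim \<omega>)
    show ?case by (rule tendsto_mult_ennreal[OF tendsto_const lim[OF elim(2)]])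
      (use elim(1) c h(2)[of _ \<omega>] lim[OF elim(2)] LIMSEQ_le_const2[OF lim[OF elim(2)], of c] in \<open>auto simp: top_unique\<close>)
  qed
qed (use Z h in \<open>auto intro!: mult_left_mono\<close>)

text \<open>As functionals of \<open>h\<close> both sides are integrals against measures on \<open>S\<close>, and independence says that
these measures agree on sets.\<close>

lemma (in prob_space) nn_integral_indep_event:
  assumes A [measurable]: "A \<in> events" and X [measurable]: "X \<in> measurable M S"
    and indep: "\<And>B. B \<in> sets S \<Longrightarrow> prob (A \<inter> (X -` B \<inter> space M)) = prob A * prob (X -` B \<inter> space M)"
    and h [measurable]: "h \<in> borel_measurable S"
  shows "(\<integral>\<^sup>+\<omega>. indicator A \<omega> * h (X \<omega>) \<partial>M) = emeasure M A * (\<integral>\<^sup>+\<omega>. h (X \<omega>) \<partial>M)"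
proof -
  have "distr (density M (indicator A)) S X = density (distr M S X) (\<lambda>_. emeasure M A)"
  proof (rule measure_eqI)
    fix B assume "B \<in> sets (distr (density M (indicator A)) S X)"
    then have B [measurable]: "B \<in> sets S" by simp
    have XB [measurable]: "X -` B \<inter> space M \<in> events" by measurable
    have "emeasure (distr (density M (indicator A)) S X) B = emeasure (density M (indicator A)) (X -` B \<inter> space M)"
      by (subst emeasure_distr) simp_all
    also have "\<dots> = emeasure M (A \<inter> (X -` B \<inter> space M))"
      by (subst emeasure_density) (auto simp: indicator_inter_arith[symmetric] intro!: nn_integral_indicator)
    also have "\<dots> = emeasure M A * emeasure M (X -` B \<inter> space M)"
      using indep[OF B] by (simp add: emeasure_eq_measure ennreal_mult)
    also have "\<dots> = emeasure (density (distr M S X) (\<lambda>_. emeasure M A)) B"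
      by (subst emeasure_density) (simp_all add: nn_integral_cmult_indicator emeasure_distr)
    finally show "emeasure (distr (density M (indicator A)) S X) B =
      emeasure (density (distr M S X) (\<lambda>_. emeasure M A)) B" .
  qed simp
  note eq = this
  have "(\<integral>\<^sup>+\<omega>. indicator A \<omega> * h (X \<omega>) \<partial>M) = (\<integral>\<^sup>+y. h y \<partial>distr (density M (indicator A)) S X)"
    by (subst nn_integral_distr) (simp_all add: nn_integral_density)
  also have "\<dots> = emeasure M A * (\<integral>\<^sup>+\<omega>. h (X \<omega>) \<partial>M)"
    unfolding eq by (subst nn_integral_density) (simp_all add: nn_integral_distr nn_integral_cmult)
  finally show ?thesis .
qed

context levy
begin

lemma measurable_sample_path [measurable]: "sample_path Y \<in> measurable N path_space"
  unfolding sample_path_def by (intro measurable_restrict) simp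

lemma exponential_time:
  assumes T: "independent_exponential r N Y T"
  shows measurable_exponential_time: "T \<in> borel_measurable N"
    and exponential_time_nonneg: "AE \<omega> in N. 0 \<le> T \<omega>"
proof -
  have D: "distributed N lborel T (exponential_density r)"
    using T by (simp add: independent_exponential_def)
  then show meas [measurable]: "T \<in> borel_measurable N"
    using distributed_measurable[OF D] by simp
  have "emeasure N (T -` {..<0} \<inter> space N) = (\<integral>\<^sup>+t. ennreal (exponential_density r t) * indicator {..<0} t \<partial>lborel)"
    by (rule distributed_emeasure[OF D]) simp
  also have "\<dots> = (\<integral>\<^sup>+t. 0 \<partial>(lborel :: real measure))"
    by (intro nn_integral_cong) (auto simp: exponential_density_def indicator_def)
  finally have "T -` {..<0} \<inter> space N \<in> null_sets N" by (intro null_setsI) auto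
  then show "AE \<omega> in N. 0 \<le> T \<omega>"
    by (rule AE_I') (auto simp: not_le)
qed

text \<open>The integral is split according to the grid cell that contains \<open>T\<close>. The cell is independent of the
path and its probability is \<open>r\<close> times its discount mass.\<close>

lemma nn_integral_at_exponential_time:
  fixes c :: "nat \<Rightarrow> (real \<Rightarrow> real) \<Rightarrow> ennreal"
  assumes r: "0 < r" and T: "independent_exponential r N Y T"
    and c [measurable]: "\<And>k. c k \<in> borel_measurable path_space"
  shows "(\<integral>\<^sup>+\<omega>. c (next_grid n (T \<omega>)) (sample_path Y \<omega>) \<partial>N) =
    ennreal r * (\<integral>\<^sup>+t. (\<integral>\<^sup>+\<omega>. c (next_grid n t) (sample_path Y \<omega>) \<partial>N) \<partial>discount_measure r)"
proof -
  note [measurable] = measurable_exponential_time[OF T]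
  let ?I = "\<lambda>k. {t\<in>{0..}. next_grid n t = Suc k}"
  let ?A = "\<lambda>k. T -` ?I k \<inter> space N"
  have D: "distributed N lborel T (exponential_density r)"
    and ind: "indep_set (sets (vimage_algebra (space N) T borel))
       (sets (vimage_algebra (space N) (sample_path Y) path_space))"
    using T by (simp_all add: independent_exponential_def)
  have I [measurable]: "?I k \<in> sets borel" for k unfolding grid_cell by simp
  have A: "?A k \<in> events" for k by measurable
  have mass: "emeasure N (?A k) = ennreal r * emeasure (discount_measure r) (?I k)" for k
  proof -
    have "emeasure N (?A k) = (\<integral>\<^sup>+t. ennreal (exponential_density r t) * indicator (?I k) t \<partial>lborel)"
      by (rule distributed_emeasure[OF D]) (simp only: sets_lborel I)
    also have "\<dots> = (\<integral>\<^sup>+t. ennreal r * (ennreal (exp (- r * t)) * indicator (?I k) t) \<partial>lborel)"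
      using r by (intro nn_integral_cong)
        (auto simp: exponential_density_def indicator_def ennreal_mult[symmetric] mult.commute)
    also have "\<dots> = ennreal r * emeasure (discount_measure r) (?I k)"
    proof -
      have "?I k \<subseteq> {0..}" by auto
      note emeasure_discount_measure[OF I this, of r]
      moreover have "(\<lambda>t. ennreal (exp (- r * t)) * indicator (?I k) t) \<in> borel_measurable lborel"
        using I[of k] by (intro borel_measurable_times_ennreal borel_measurable_indicator) auto
      ultimately show ?thesis by (simp only: nn_integral_cmult)
    qed
    finally show ?thesis .
  qed
  have "(\<integral>\<^sup>+\<omega>. c (next_grid n (T \<omega>)) (sample_path Y \<omega>) \<partial>N) =
     (\<integral>\<^sup>+\<omega>. (\<Sum>k. indicator (?A k) \<omega> * c (Suc k) (sample_path Y \<omega>)) \<partial>N)"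
  proof (rule nn_integral_cong_AE)
    show "AE \<omega> in N. c (next_grid n (T \<omega>)) (sample_path Y \<omega>) = (\<Sum>k. indicator (?A k) \<omega> * c (Suc k) (sample_path Y \<omega>))"
      using exponential_time_nonneg[OF T] AE_space
    proof eventually_elim
      case (elim \<omega>)
      have "(\<Sum>k. indicator (?A k) \<omega> * c (Suc k) (sample_path Y \<omega>)) =
        (\<Sum>k\<in>{nat \<lfloor>real (Suc n) * T \<omega>\<rfloor>}. indicator (?A k) \<omega> * c (Suc k) (sample_path Y \<omega>))"
        by (rule suminf_finite) (auto simp: next_grid_def indicator_def)
      also have "\<dots> = c (next_grid n (T \<omega>)) (sample_path Y \<omega>)"
        using elim by (simp add: next_grid_def)
      finally show ?case by (rule sym)
    qed
  qed
  also have "\<dots> = (\<Sum>k. \<integral>\<^sup>+\<omega>. indicator (?A k) \<omega> * c (Suc k) (sample_path Y \<omega>) \<partial>N)"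
    by (rule nn_integral_suminf) measurable
  also have "\<dots> = (\<Sum>k. emeasure N (?A k) * (\<integral>\<^sup>+\<omega>. c (Suc k) (sample_path Y \<omega>) \<partial>N))"
  proof (rule suminf_cong)
    fix k
    have "prob (?A k \<inter> (sample_path Y -` B \<inter> space N)) = prob (?A k) * prob (sample_path Y -` B \<inter> space N)"
      if B: "B \<in> sets path_space" for B
      by (rule indep_setD[OF ind in_vimage_algebra[OF I] in_vimage_algebra[OF B]])
    then show "(\<integral>\<^sup>+\<omega>. indicator (?A k) \<omega> * c (Suc k) (sample_path Y \<omega>) \<partial>N) =
        emeasure N (?A k) * (\<integral>\<^sup>+\<omega>. c (Suc k) (sample_path Y \<omega>) \<partial>N)"
      by (rule nn_integral_indep_event[OF A measurable_sample_path _ c])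
  qed
  also have "\<dots> = ennreal r * (\<Sum>k. emeasure (discount_measure r) (?I k) * (\<integral>\<^sup>+\<omega>. c (Suc k) (sample_path Y \<omega>) \<partial>N))"
    unfolding mass by (simp only: mult.assoc ennreal_suminf_cmult)
  also have "\<dots> = ennreal r * (\<integral>\<^sup>+t. (\<integral>\<^sup>+\<omega>. c (next_grid n t) (sample_path Y \<omega>) \<partial>N) \<partial>discount_measure r)"
    by (subst nn_integral_grid[OF r]) (simp only: emeasure_grid_cell[OF r])
  finally show ?thesis .
qed

text \<open>The grid version of the denominator in the definition of the threshold, divided by \<open>r\<close>.\<close>

definition grid_inf_mean :: "real \<Rightarrow> (real \<Rightarrow> real) \<Rightarrow> nat \<Rightarrow> real \<Rightarrow> ennreal" where
  "grid_inf_mean r q n a = geometric_mean r n (\<lambda>m.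
     \<integral>\<^sup>+z. ennreal (q (a + running_Min (partial_sum z) m)) \<partial>(\<Pi>\<^sub>M i\<in>UNIV. step_law (mesh n)))"

text \<open>Convergence is needed along sequences \<open>a\<close>, because the limit is later taken inside an expectation
at grid maxima that themselves converge to the running supremum.\<close>

lemma grid_inf_mean_tendsto:
  assumes start: "x = 0" and r: "0 < r" and T: "independent_exponential r N Y T"
    and q: "continuous_on UNIV q" "\<And>u. 0 \<le> q u" "\<And>u. q u \<le> C" and a: "a \<longlonglongrightarrow> a0"
    and int: "integrable N (\<lambda>\<omega>. q (a0 + running_inf Y (T \<omega>) \<omega>))"
  shows "(\<lambda>n. grid_inf_mean r q n (a n)) \<longlonglongrightarrow>
    ennreal ((\<integral>\<omega>. q (a0 + running_inf Y (T \<omega>) \<omega>) \<partial>N) / r)"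
proof -
  have [measurable]: "q \<in> borel_measurable borel" using q(1) by (rule borel_measurable_continuous_onI)
  note [measurable] = measurable_exponential_time[OF T]
  define c where "c n m p = ennreal (q (a n + running_Min (\<lambda>k. p (real k * mesh n) - p 0) m))" for n m and p :: "real \<Rightarrow> real"
  have grid0: "0 \<le> real k * mesh n" for k n using mesh_pos[of n] by simp
  have [measurable]: "(\<lambda>p. running_Min (\<lambda>k. p (real k * mesh n) - p 0) m) \<in> borel_measurable path_space" for n m
    by (induction m) (auto simp: running_Min_Suc grid0 simp del: of_nat_Suc intro!: borel_measurable_min borel_measurable_diff measurable_component_singleton)
  have c_meas [measurable]: "c n m \<in> borel_measurable path_space" for n m
    unfolding c_def by measurable
  have c_path: "c n m (sample_path Y \<omega>) = ennreal (q (a n + running_Min (\<lambda>k. Y (real k * mesh n) \<omega> - Y 0 \<omega>) m))" for n m \<omega>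
    using grid0 by (simp add: c_def sample_path_def)
  have c_le: "c n m p \<le> ennreal C" for n m p using q by (auto simp: c_def intro: ennreal_leI)
  define v where "v n = (\<integral>\<^sup>+\<omega>. c n (next_grid n (T \<omega>)) (sample_path Y \<omega>) \<partial>N)" for n
  have eq: "grid_inf_mean r q n (a n) = ennreal ((1 - grid_discount r n) / r) * (\<integral>\<^sup>+\<omega>. c n 0 (sample_path Y \<omega>) \<partial>N) +
      ennreal (grid_discount r n) * (ennreal (1 / r) * v n)" for n
  proof -
    have "grid_inf_mean r q n (a n) = geometric_mean r n (\<lambda>m. \<integral>\<^sup>+\<omega>. c n m (sample_path Y \<omega>) \<partial>N)"
      unfolding grid_inf_mean_def c_path
      using grid_running_Min_law[of "mesh n" "\<lambda>u. ennreal (q u)"] mesh_pos[of n] by simp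
    moreover have "ennreal (1 / r) * v n = (\<integral>\<^sup>+t. (\<integral>\<^sup>+\<omega>. c n (next_grid n t) (sample_path Y \<omega>) \<partial>N) \<partial>discount_measure r)"
      unfolding v_def nn_integral_at_exponential_time[OF r T, of "c n" n, OF c_meas] using r
      by (simp add: mult.assoc[symmetric] ennreal_mult[symmetric])
    ultimately show ?thesis by (simp add: geometric_mean_eq[OF r])
  qed
  have inf_lim: "AE \<omega> in N. (\<lambda>n. c n (next_grid n (T \<omega>)) (sample_path Y \<omega>)) \<longlonglongrightarrow>
      ennreal (q (a0 + running_inf Y (T \<omega>) \<omega>))"
    using exponential_time_nonneg[OF T] Y_0 AE_space
  proof eventually_elim
    case (elim \<omega>)
    have cad: "cadlag (\<lambda>t. Y t \<omega>)" by (rule cadlag_Y) fact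
    have "(\<lambda>n. running_Min (\<lambda>k. Y (real k * mesh n) \<omega>) (next_grid n (T \<omega>))) \<longlonglongrightarrow> running_inf Y (T \<omega>) \<omega>"
      unfolding running_inf_def using elim
      by (intro running_Min_grid_tendsto cadlag_continuous_at_right[OF cad] cadlag_bdd[OF cad]) auto
    then have "(\<lambda>n. a n + running_Min (\<lambda>k. Y (real k * mesh n) \<omega> - Y 0 \<omega>) (next_grid n (T \<omega>))) \<longlonglongrightarrow>
        a0 + running_inf Y (T \<omega>) \<omega>"
      using a elim start by (intro tendsto_add) simp_all
    then have "(\<lambda>n. q (a n + running_Min (\<lambda>k. Y (real k * mesh n) \<omega> - Y 0 \<omega>) (next_grid n (T \<omega>)))) \<longlonglongrightarrow>
        q (a0 + running_inf Y (T \<omega>) \<omega>)"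
      using q(1) by (intro continuous_on_tendsto_compose[of UNIV q]) auto
    then show ?case unfolding c_path by (rule tendsto_ennrealI)
  qed
  have meas_n: "(\<lambda>\<omega>. c n (next_grid n (T \<omega>)) (sample_path Y \<omega>)) \<in> borel_measurable N" for n
  proof (rule measurable_compose_countable)
    show "(\<lambda>\<omega>. next_grid n (T \<omega>)) \<in> measurable N (count_space UNIV)"
      unfolding next_grid_def by measurable
  qed measurable
  have lim_meas: "(\<lambda>\<omega>. q (a0 + running_inf Y (T \<omega>) \<omega>)) \<in> borel_measurable N"
    using int by (rule borel_measurable_integrable)
  have "v \<longlonglongrightarrow> (\<integral>\<^sup>+\<omega>. ennreal (q (a0 + running_inf Y (T \<omega>) \<omega>)) \<partial>N)"
    unfolding v_def
    by (rule nn_integral_dominated_convergence[where w = "\<lambda>_. ennreal C"])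
      (use meas_n lim_meas c_le inf_lim in \<open>auto simp: emeasure_space_1\<close>)
  also have "(\<integral>\<^sup>+\<omega>. ennreal (q (a0 + running_inf Y (T \<omega>) \<omega>)) \<partial>N) = ennreal (\<integral>\<omega>. q (a0 + running_inf Y (T \<omega>) \<omega>) \<partial>N)"
    using int q(2) by (intro nn_integral_eq_integral) auto
  finally have v: "v \<longlonglongrightarrow> ennreal (\<integral>\<omega>. q (a0 + running_inf Y (T \<omega>) \<omega>) \<partial>N)" .
  have "(\<integral>\<^sup>+\<omega>. c n 0 (sample_path Y \<omega>) \<partial>N) \<le> (\<integral>\<^sup>+\<omega>. ennreal C \<partial>N)" for n
    by (intro nn_integral_mono c_le)
  then have first: "(\<lambda>n. ennreal ((1 - grid_discount r n) / r) * (\<integral>\<^sup>+\<omega>. c n 0 (sample_path Y \<omega>) \<partial>N)) \<longlonglongrightarrow> 0"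
    by (intro grid_discount_gap_vanishes[OF r, of "ennreal C"]) (simp_all add: emeasure_space_1)
  have "(\<lambda>n. ennreal (grid_discount r n) * (ennreal (1 / r) * v n)) \<longlonglongrightarrow>
      1 * (ennreal (1 / r) * ennreal (\<integral>\<omega>. q (a0 + running_inf Y (T \<omega>) \<omega>) \<partial>N))"
    using r v tendsto_ennrealI[OF grid_discount_tendsto[of r]]
    by (intro tendsto_mult_ennreal tendsto_const) (auto simp: ennreal_mult_eq_top_iff)
  from tendsto_add[OF first this] have "(\<lambda>n. grid_inf_mean r q n (a n)) \<longlonglongrightarrow>
      ennreal (1 / r) * ennreal (\<integral>\<omega>. q (a0 + running_inf Y (T \<omega>) \<omega>) \<partial>N)"
    unfolding eq by simp
  moreover have "0 \<le> (\<integral>\<omega>. q (a0 + running_inf Y (T \<omega>) \<omega>) \<partial>N)"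
    using q(2) by (intro integral_nonneg_AE) auto
  ultimately show ?thesis
    using r by (simp add: ennreal_mult[symmetric])
qed

lemma grid_inf_mean_le:
  assumes r: "0 < r" and q: "\<And>u. q u \<le> C"
  shows "grid_inf_mean r q n a \<le> ennreal (1 / r) * ennreal C"
proof -
  have h: "0 \<le> mesh n" using mesh_pos[of n] by simp
  interpret random_walk "step_law (mesh n)" by (rule random_walk_step_law) fact
  have "(\<integral>\<^sup>+z. ennreal (q (a + running_Min (partial_sum z) m)) \<partial>S) \<le> (\<integral>\<^sup>+z. ennreal C \<partial>S)" for m
    using q by (intro nn_integral_mono ennreal_leI)
  then have "grid_inf_mean r q n a \<le> geometric_mean r n (\<lambda>_. ennreal C)"
    unfolding grid_inf_mean_def by (intro geometric_mean_mono) (simp add: P.emeasure_space_1)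
  then show ?thesis by (simp only: geometric_mean_const[OF r])
qed

definition sup_from :: "real \<Rightarrow> real \<Rightarrow> 'a \<Rightarrow> real" where
  "sup_from s t \<omega> = (SUP u\<in>{0..t}. Y (s + u) \<omega>)"

lemma grid_Max_tendsto_sup_from:
  assumes "\<omega> \<in> space N" "0 \<le> s" "0 \<le> t"
  shows "(\<lambda>n. running_Max (\<lambda>k. Y (s + real k * mesh n) \<omega>) (next_grid n t)) \<longlonglongrightarrow> sup_from s t \<omega>"
proof -
  have cad: "cadlag (\<lambda>t. Y (s + t) \<omega>)" using assms cadlag_Y by (intro cadlag_shift[of "\<lambda>t. Y t \<omega>"]) auto
  show ?thesis
    unfolding sup_from_def
    by (intro running_Max_grid_tendsto[of "\<lambda>u. Y (s + u) \<omega>"] cadlag_continuous_at_right[OF cad] cadlag_bdd[OF cad] assms)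
qed

lemma measurable_grid_Max:
  assumes "0 \<le> s"
  shows "(\<lambda>\<omega>. running_Max (\<lambda>k. Y (s + real k * mesh n) \<omega>) m) \<in> borel_measurable N"
proof (induction m)
  case (Suc m)
  have "0 \<le> s + real (Suc m) * mesh n" using assms mesh_pos[of n] by (simp del: of_nat_Suc)
  with Suc show ?case unfolding running_Max_Suc by (intro borel_measurable_max measurable_Y)
qed (use assms in simp)

lemma measurable_sup_from:
  assumes "0 \<le> s" "0 \<le> t" shows "sup_from s t \<in> borel_measurable N"
  by (rule borel_measurable_LIMSEQ_real[OF grid_Max_tendsto_sup_from measurable_grid_Max]) (use assms in auto)

text \<open>On every grid the identity holds by \<open>grid_Wiener_Hopf\<close>; both sides converge as the mesh
tends to \<open>0\<close>. The integrals over \<open>t\<close> stand for expectations at an independent exponential time,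
and the factor \<open>1 / r\<close> is their total mass.\<close>

theorem Wiener_Hopf_levy:
  assumes r: "0 < r" and s: "0 \<le> s" and Z: "Z \<in> borel_measurable (F s)" and Z_int: "(\<integral>\<^sup>+\<omega>. Z \<omega> \<partial>N) < \<infinity>"
    and f: "continuous_on UNIV f" "\<And>u. 0 \<le> f u" "\<And>u. f u \<le> C"
    and q: "continuous_on UNIV q" "\<And>u. 0 \<le> q u" "\<And>u. q u \<le> C"
    and g: "\<And>a a0. a \<longlonglongrightarrow> a0 \<Longrightarrow> (\<lambda>n. grid_inf_mean r q n (a n)) \<longlonglongrightarrow> ennreal (g a0)"
  shows "(\<integral>\<^sup>+t. (\<integral>\<^sup>+\<omega>. Z \<omega> * (ennreal (f (sup_from s t \<omega>)) * ennreal (q (Y (s + t) \<omega>))) \<partial>N) \<partial>discount_measure r) * ennreal (1 / r) =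
         (\<integral>\<^sup>+t. (\<integral>\<^sup>+\<omega>. Z \<omega> * (ennreal (f (sup_from s t \<omega>)) * ennreal (g (sup_from s t \<omega>))) \<partial>N) \<partial>discount_measure r)"
    (is "?L * _ = ?R")
proof -
  have [measurable]: "f \<in> borel_measurable borel" "q \<in> borel_measurable borel"
    using f(1) q(1) by (auto intro: borel_measurable_continuous_onI)
  have [measurable]: "Z \<in> borel_measurable N" by (rule measurable_from_subalg[OF subalgebra_F[OF s] Z])
  have h: "0 \<le> mesh n" for n using mesh_pos[of n] by simp
  have grid: "0 \<le> s + real k * mesh n" for k n using s h by simp
  let ?Mx = "\<lambda>n k \<omega>. running_Max (\<lambda>k. Y (s + real k * mesh n) \<omega>) k"
  note [measurable] = measurable_grid_Max[OF s]
  have C: "0 \<le> C" using f(2)[of 0] f(3)[of 0] by linarith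
  have G_meas [measurable]: "grid_inf_mean r q n \<in> borel_measurable borel" for n
  proof -
    interpret random_walk "step_law (mesh n)" by (rule random_walk_step_law) fact
    show ?thesis unfolding grid_inf_mean_def geometric_mean_def by measurable
  qed
  define l where "l n k = (\<integral>\<^sup>+\<omega>. Z \<omega> * (ennreal (f (?Mx n k \<omega>)) * ennreal (q (Y (s + real k * mesh n) \<omega>))) \<partial>N)" for n k
  define m where "m n k = (\<integral>\<^sup>+\<omega>. Z \<omega> * (ennreal (f (?Mx n k \<omega>)) * grid_inf_mean r q n (?Mx n k \<omega>)) \<partial>N)" for n k
  have identity: "geometric_mean r n (l n) * ennreal (1 / r) = geometric_mean r n (m n)" for n
  proof -
    let ?b = "ennreal (grid_discount r n)" and ?w = "ennreal ((1 - grid_discount r n) / r)"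
    let ?G = "\<lambda>a. \<Sum>m. ?b ^ m * (\<integral>\<^sup>+z. ennreal (q (a + running_Min (partial_sum z) m)) \<partial>(\<Pi>\<^sub>M i\<in>UNIV. step_law (mesh n)))"
    have [measurable]: "?G \<in> borel_measurable borel"
    proof -
      interpret random_walk "step_law (mesh n)" by (rule random_walk_step_law) fact
      show ?thesis by measurable
    qed
    have m_eq: "m n k = ?w * (\<integral>\<^sup>+\<omega>. Z \<omega> * (ennreal (f (?Mx n k \<omega>)) * ?G (?Mx n k \<omega>)) \<partial>N)" for k
    proof -
      have "Z \<omega> * (a * (?w * b)) = ?w * (Z \<omega> * (a * b))" for \<omega> a b by (simp only: mult_ac)
      moreover have "(\<lambda>\<omega>. Z \<omega> * (ennreal (f (?Mx n k \<omega>)) * ?G (?Mx n k \<omega>))) \<in> borel_measurable N"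
        by (intro borel_measurable_times_ennreal measurable_compose[OF measurable_grid_Max[OF s] \<open>?G \<in> borel_measurable borel\<close>]) measurable
      ultimately show ?thesis
        unfolding m_def grid_inf_mean_def geometric_mean_def by (simp only: nn_integral_cmult)
    qed
    have "geometric_mean r n (l n) * ennreal (1 / r) = geometric_mean r n (l n) * geometric_mean r n (\<lambda>_. 1)"
      by (simp add: geometric_mean_const[OF r])
    also have "\<dots> = ?w * ?w * ((\<Sum>k. ?b ^ k * l n k) * (\<Sum>k. ?b ^ k))"
      unfolding geometric_mean_def by (simp add: mult_ac)
    also have "(\<Sum>k. ?b ^ k * l n k) * (\<Sum>k. ?b ^ k) =
        (\<Sum>k. ?b ^ k * (\<integral>\<^sup>+\<omega>. Z \<omega> * (ennreal (f (?Mx n k \<omega>)) * ?G (?Mx n k \<omega>)) \<partial>N))"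
      unfolding l_def by (rule grid_Wiener_Hopf[OF s h Z]) measurable
    also have "?w * ?w * \<dots> = geometric_mean r n (m n)"
      unfolding geometric_mean_def m_eq mult.assoc ennreal_suminf_cmult[symmetric] by (simp only: mult_ac)
    finally show ?thesis .
  qed
  have Y_meas [measurable]: "(\<lambda>\<omega>. Y (s + real k * mesh n) \<omega>) \<in> borel_measurable N" for k n
    using grid by (rule measurable_Y)
  let ?l = "\<lambda>n k \<omega>. ennreal (f (?Mx n k \<omega>)) * ennreal (q (Y (s + real k * mesh n) \<omega>))"
  let ?m = "\<lambda>n k \<omega>. ennreal (f (?Mx n k \<omega>)) * grid_inf_mean r q n (?Mx n k \<omega>)"
  have le_l: "?l n k \<omega> \<le> ennreal C * ennreal C" for n k \<omega>
    using f q by (intro mult_mono ennreal_leI) auto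
  have le_m: "?m n k \<omega> \<le> ennreal C * (ennreal (1 / r) * ennreal C)" for n k \<omega>
    using f q grid_inf_mean_le[OF r q(3)] by (intro mult_mono ennreal_leI) auto
  have top_l: "ennreal C * ennreal C < \<infinity>" and top_m: "ennreal C * (ennreal (1 / r) * ennreal C) < \<infinity>"
    by (simp_all add: ennreal_mult_less_top)
  have fin: "(\<integral>\<^sup>+\<omega>. Z \<omega> * c \<partial>N) < \<infinity>" if "c < \<infinity>" for c
    using Z_int that by (simp add: nn_integral_multc ennreal_mult_less_top)
  have f_lim: "(\<lambda>n. ennreal (f (?Mx n (next_grid n t) \<omega>))) \<longlonglongrightarrow> ennreal (f (sup_from s t \<omega>))"
    if "\<omega> \<in> space N" "0 \<le> t" for \<omega> t
    using f(1) grid_Max_tendsto_sup_from[OF that(1) s that(2)]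
    by (intro tendsto_ennrealI continuous_on_tendsto_compose[of UNIV f]) auto
  have q_lim: "(\<lambda>n. ennreal (q (Y (s + real (next_grid n t) * mesh n) \<omega>))) \<longlonglongrightarrow> ennreal (q (Y (s + t) \<omega>))"
    if "\<omega> \<in> space N" "0 \<le> t" for \<omega> t
    using q(1) grid_value_tendsto[OF cadlag_continuous_at_right[OF cadlag_shift[OF cadlag_Y[OF that(1)] s] that(2)] that(2)]
    by (intro tendsto_ennrealI continuous_on_tendsto_compose[of UNIV q]) auto
  have "(\<lambda>n. geometric_mean r n (l n)) \<longlonglongrightarrow> ?L"
  proof (rule geometric_mean_tendsto[OF r fin[OF top_l]])
    show "l n k \<le> (\<integral>\<^sup>+\<omega>. Z \<omega> * (ennreal C * ennreal C) \<partial>N)" for n k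
      unfolding l_def by (intro nn_integral_mono mult_left_mono le_l) simp
    fix t :: real assume t: "0 \<le> t"
    show "(\<lambda>n. l n (next_grid n t)) \<longlonglongrightarrow> (\<integral>\<^sup>+\<omega>. Z \<omega> * (ennreal (f (sup_from s t \<omega>)) * ennreal (q (Y (s + t) \<omega>))) \<partial>N)"
      unfolding l_def
      by (rule nn_integral_weighted_bounded_convergence[OF _ Z_int _ le_l top_l])
        (use f_lim[OF _ t] q_lim[OF _ t] in \<open>auto intro!: tendsto_mult_ennreal\<close>)
  qed
  then have "(\<lambda>n. geometric_mean r n (l n) * ennreal (1 / r)) \<longlonglongrightarrow> ?L * ennreal (1 / r)"
    using r by (intro tendsto_mult_ennreal tendsto_const) auto
  moreover have "(\<lambda>n. geometric_mean r n (m n)) \<longlonglongrightarrow> ?R"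
  proof (rule geometric_mean_tendsto[OF r fin[OF top_m]])
    show "m n k \<le> (\<integral>\<^sup>+\<omega>. Z \<omega> * (ennreal C * (ennreal (1 / r) * ennreal C)) \<partial>N)" for n k
      unfolding m_def by (intro nn_integral_mono mult_left_mono le_m) simp
    fix t :: real assume t: "0 \<le> t"
    show "(\<lambda>n. m n (next_grid n t)) \<longlonglongrightarrow> (\<integral>\<^sup>+\<omega>. Z \<omega> * (ennreal (f (sup_from s t \<omega>)) * ennreal (g (sup_from s t \<omega>))) \<partial>N)"
      unfolding m_def
      by (rule nn_integral_weighted_bounded_convergence[OF _ Z_int _ le_m top_m])
        (use f_lim[OF _ t] g[OF grid_Max_tendsto_sup_from[OF _ s t]] in \<open>auto intro!: tendsto_mult_ennreal\<close>)
  qed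
  ultimately show ?thesis unfolding identity by (rule LIMSEQ_unique)
qed

end

section \<open>Discounted integrals along paths\<close>

lemma nn_integral_discount_measure_lborel:
  assumes [measurable]: "g \<in> borel_measurable (restrict_space borel {0..})"
  shows "(\<integral>\<^sup>+t. g t \<partial>discount_measure r) = (\<integral>\<^sup>+t. g t * ennreal (exp (- r * t)) * indicator {0..} t \<partial>lborel)"
  by (simp add: nn_integral_discount_measure nn_integral_restrict_space)

text \<open>The memoryless property of the exponential law.\<close>

lemma nn_integral_discount_from:
  assumes s: "0 \<le> s" and H: "H \<in> borel_measurable (discount_measure r)"
  shows "(\<integral>\<^sup>+t. H t * indicator {s..} t \<partial>discount_measure r) =
    ennreal (exp (- r * s)) * (\<integral>\<^sup>+t. H (s + t) \<partial>discount_measure r)"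
proof -
  have H' [measurable]: "H \<in> borel_measurable (restrict_space borel {0..})"
    using H by (simp cong: measurable_cong_sets)
  define h where "h t = H t * indicator {0..} t" for t
  have h [measurable]: "h \<in> borel_measurable borel"
    unfolding h_def using H' by (subst (asm) borel_measurable_restrict_space_iff_ennreal) (auto simp: mult.commute)
  have shift_meas: "(\<lambda>t. H (s + t)) \<in> borel_measurable (restrict_space borel {0..})"
  proof -
    have "(\<lambda>t. h (s + t)) \<in> borel_measurable (restrict_space borel {0..})"
      by (rule measurable_restrict_space1) measurable
    then show ?thesis
      by (rule measurable_cong[THEN iffD1, rotated]) (use s in \<open>simp add: h_def space_restrict_space\<close>)
  qed
  have ind_meas: "(\<lambda>t. H t * indicator {s..} t) \<in> borel_measurable (restrict_space borel {0..})"
    by (intro borel_measurable_times_ennreal H' measurable_restrict_space1) measurable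
  have "(\<integral>\<^sup>+t. H t * indicator {s..} t \<partial>discount_measure r) =
      (\<integral>\<^sup>+t. h t * indicator {s..} t * ennreal (exp (- r * t)) \<partial>lborel)"
    unfolding nn_integral_discount_measure_lborel[OF ind_meas]
    by (intro nn_integral_cong) (auto simp: h_def indicator_def)
  also have "\<dots> = (\<integral>\<^sup>+t. h (s + 1 * t) * indicator {s..} (s + 1 * t) * ennreal (exp (- r * (s + 1 * t))) \<partial>lborel)"
    by (subst nn_integral_real_affine[where c = 1 and t = s]) simp_all
  also have "\<dots> = (\<integral>\<^sup>+t. ennreal (exp (- r * s)) * (H (s + t) * ennreal (exp (- r * t)) * indicator {0..} t) \<partial>lborel)"
  proof (rule nn_integral_cong)
    fix t
    have "ennreal (exp (- r * (s + 1 * t))) = ennreal (exp (- r * s)) * ennreal (exp (- r * t))"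
      by (simp add: ennreal_mult[symmetric] exp_add[symmetric] algebra_simps)
    then show "h (s + 1 * t) * indicator {s..} (s + 1 * t) * ennreal (exp (- r * (s + 1 * t))) =
        ennreal (exp (- r * s)) * (H (s + t) * ennreal (exp (- r * t)) * indicator {0..} t)"
      using s by (auto simp: h_def indicator_def mult_ac)
  qed
  also have "\<dots> = ennreal (exp (- r * s)) * (\<integral>\<^sup>+t. H (s + t) \<partial>discount_measure r)"
    unfolding nn_integral_discount_measure_lborel[OF shift_meas]
  proof (rule nn_integral_cmult)
    have "(\<lambda>t. h (s + t) * ennreal (exp (- r * t)) * indicator {0..} t) \<in> borel_measurable lborel" by measurable
    then show "(\<lambda>t. H (s + t) * ennreal (exp (- r * t)) * indicator {0..} t) \<in> borel_measurable lborel"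
      by (rule measurable_cong[THEN iffD1, rotated]) (use s in \<open>auto simp: h_def indicator_def\<close>)
  qed
  finally show ?thesis .
qed

lemma emeasure_discount_from:
  assumes r: "0 < r" and s: "0 \<le> s" shows "emeasure (discount_measure r) {s..} = ennreal (exp (- r * s) / r)"
proof -
  have "emeasure (discount_measure r) {s..} = (\<integral>\<^sup>+t. 1 * indicator {s..} t \<partial>discount_measure r)"
    using s by (subst nn_integral_indicator[symmetric]) (auto simp: sets_restrict_space_iff)
  also have "\<dots> = ennreal (exp (- r * s)) * ennreal (1 / r)"
    using emeasure_discount_measure_space[OF r] by (subst nn_integral_discount_from[OF s]) simp_all
  finally show ?thesis using r by (simp add: ennreal_mult[symmetric])
qed

lemma finite_measure_discount: "0 < r \<Longrightarrow> finite_measure (discount_measure r)"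
  by (rule finite_measureI) (simp add: emeasure_discount_measure_space)

lemma AE_discount_measureI:
  assumes "countable D" "\<And>t. 0 \<le> t \<Longrightarrow> t \<notin> D \<Longrightarrow> Q t"
  shows "AE t in discount_measure r. Q t"
proof -
  have "D \<in> null_sets lborel" using countable_imp_null_set_lborel assms(1) by blast
  then have "AE t in lborel. t \<notin> D" by (rule AE_not_in)
  then have "AE t in lborel. t \<in> {0..} \<longrightarrow> Q t"
    by eventually_elim (use assms(2) in auto)
  then have "AE t in restrict_space lborel {0..}. Q t"
    by (subst AE_restrict_space_iff) auto
  then show ?thesis unfolding discount_measure_def
    by (subst AE_density) (auto simp: measurable_restrict_space1)
qed

lemma AE_discount_measureD:
  assumes "AE t in discount_measure r. Q t"
  shows "AE t in lborel. 0 \<le> t \<longrightarrow> Q t"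
proof -
  have "AE t in restrict_space lborel {0..}. 0 < ennreal (exp (- r * t)) \<longrightarrow> Q t"
    using assms unfolding discount_measure_def by (subst (asm) AE_density) (auto simp: measurable_restrict_space1)
  then show ?thesis by (subst (asm) AE_restrict_space_iff) auto
qed

text \<open>Integration by parts: \<open>exp (- r s)\<close> is \<open>r\<close> times the discount mass of \<open>{s..}\<close>, and exchanging the
integrals leaves the \<open>dg\<close>-mass of \<open>{0..t}\<close>, which is \<open>g t\<close> since the jump at time \<open>0\<close> is
counted.\<close>

lemma stieltjes_integral_exp:
  assumes r: "0 < r" and g: "cadlag g" "mono_on {0..} g" "0 \<le> g 0" and c: "0 \<le> c"
  shows "stieltjes_integral g (\<lambda>t. c * exp (- r * t)) =
    ennreal (r * c) * (\<integral>\<^sup>+t. ennreal (g t) \<partial>discount_measure r)"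
proof -
  define G where "G t = (if t < 0 then 0 else g t)" for t
  have g_nonneg: "0 \<le> g t" if "0 \<le> t" for t
    using mono_onD[OF g(2), of 0 t] that g(3) by simp
  have mono: "G s \<le> G t" if "s \<le> t" for s t
    using that g_nonneg mono_onD[OF g(2), of s t] by (auto simp: G_def)
  have right: "continuous (at_right t) G" for t
  proof (cases "t < 0")
    case True
    have "\<forall>\<^sub>F u in at_right t. G u = 0"
      unfolding eventually_at_right_field using True by (intro exI[of _ 0]) (auto simp: G_def)
    then have "(G \<longlongrightarrow> 0) (at_right t)" by (rule tendsto_eventually)
    then show ?thesis using True by (simp add: continuous_within G_def)
  next
    case False
    then have "(g \<longlongrightarrow> g t) (at_right t)"
      using cadlag_continuous_at_right[OF g(1), of t] by (simp add: continuous_within)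
    moreover have "\<forall>\<^sub>F u in at_right t. g u = G u"
      unfolding eventually_at_right_field using False by (intro exI[of _ "t + 1"]) (auto simp: G_def)
    ultimately have "(G \<longlongrightarrow> g t) (at_right t)" by (rule Lim_transform_eventually)
    then show ?thesis using False by (simp add: continuous_within G_def)
  qed
  let ?\<mu> = "interval_measure G" and ?E = "discount_measure r"
  have Ioc: "emeasure ?\<mu> {a<..b} = ennreal (G b - G a)" if "a \<le> b" for a b
    by (rule emeasure_interval_measure_Ioc[OF that mono right])
  \<comment> \<open>No mass lies on the negative times, so the interval from 0 to t carries all of the mass up to t.\<close>
  have null: "(\<Union>n. {-1 <.. - 1 / real (Suc n)}) \<in> null_sets ?\<mu>"
  proof (rule null_sets_UN)
    fix n :: nat show "{-1 <.. - 1 / real (Suc n)} \<in> null_sets ?\<mu>"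
      by (intro null_setsI) (simp_all add: Ioc G_def)
  qed
  have below: "(\<Union>n. {-1 <.. - 1 / real (Suc n)}) = {-1 <..< (0::real)}"
  proof safe
    fix u :: real assume u: "u \<in> {-1<..<0}"
    then obtain n where n: "1 / real (Suc n) < - u" using nat_approx_posE[of "- u"] by auto
    then have "u \<in> {-1 <.. - 1 / real (Suc n)}" using u by auto
    then show "u \<in> (\<Union>n. {-1 <.. - 1 / real (Suc n)})" by blast
  next
    fix u :: real and n :: nat assume "u \<in> {-1 <.. - 1 / real (Suc n)}"
    moreover have "- 1 / real (Suc n) < 0" by simp
    ultimately show "u \<in> {-1<..<0}" unfolding greaterThanLessThan_iff greaterThanAtMost_iff by linarith
  qed
  have mass: "emeasure ?\<mu> {0..t} = ennreal (g t)" if t: "0 \<le> t" for t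
  proof -
    have "{-1<..t} = {0..t} \<union> {-1<..<0}" using t by auto
    then have "emeasure ?\<mu> {-1<..t} = emeasure ?\<mu> {0..t}"
      using null below by (simp add: emeasure_Un_null_set)
    then show ?thesis using Ioc[of "-1" t] t by (simp add: G_def)
  qed
  interpret \<mu>: sigma_finite_measure ?\<mu> by (rule sigma_finite_interval_measure[OF mono right])
  interpret E: finite_measure ?E by (rule finite_measure_discount[OF r])
  interpret pair_sigma_finite ?\<mu> ?E ..
  let ?k = "\<lambda>s t. indicator {s. 0 \<le> s} s * indicator {p. fst p \<le> snd p} (s, t) :: ennreal"
  have id: "(\<lambda>t. t) \<in> borel_measurable ?E" by (simp add: measurable_cong_sets[OF sets_discount_measure refl] measurable_restrict_space1)
  have [measurable]: "snd \<in> borel_measurable (?\<mu> \<Otimes>\<^sub>M ?E)"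
    by (rule measurable_compose[OF measurable_snd id])
  have "stieltjes_integral g (\<lambda>t. c * exp (- r * t)) = (\<integral>\<^sup>+s. ennreal (c * exp (- r * s)) * indicator {0..} s \<partial>?\<mu>)"
    unfolding stieltjes_integral_def G_def[abs_def] ..
  also have "\<dots> = (\<integral>\<^sup>+s. ennreal (r * c) * (\<integral>\<^sup>+t. ?k s t \<partial>?E) \<partial>?\<mu>)"
  proof (rule nn_integral_cong)
    fix s :: real
    show "ennreal (c * exp (- r * s)) * indicator {0..} s = ennreal (r * c) * (\<integral>\<^sup>+t. ?k s t \<partial>?E)"
    proof (cases "0 \<le> s")
      case True
      have "(\<integral>\<^sup>+t. ?k s t \<partial>?E) = (\<integral>\<^sup>+t. indicator {s..} t \<partial>?E)"
        using True by (intro nn_integral_cong) (auto simp: indicator_def)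
      also have "\<dots> = ennreal (exp (- r * s) / r)"
        using True emeasure_discount_from[OF r True]
        by (subst nn_integral_indicator) (auto simp: sets_restrict_space_iff)
      finally show ?thesis using True r c by (simp add: ennreal_mult[symmetric])
    qed simp
  qed
  also have "\<dots> = ennreal (r * c) * (\<integral>\<^sup>+s. (\<integral>\<^sup>+t. ?k s t \<partial>?E) \<partial>?\<mu>)"
    by (rule nn_integral_cmult) measurable
  also have "(\<integral>\<^sup>+s. (\<integral>\<^sup>+t. ?k s t \<partial>?E) \<partial>?\<mu>) = (\<integral>\<^sup>+t. (\<integral>\<^sup>+s. ?k s t \<partial>?\<mu>) \<partial>?E)"
    by (rule Fubini'[symmetric]) measurable
  also have "\<dots> = (\<integral>\<^sup>+t. ennreal (g t) \<partial>?E)"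
  proof (rule nn_integral_cong)
    fix t assume t: "t \<in> space ?E"
    have "(\<integral>\<^sup>+s. ?k s t \<partial>?\<mu>) = (\<integral>\<^sup>+s. indicator {0..t} s \<partial>?\<mu>)"
      by (intro nn_integral_cong) (auto simp: indicator_def)
    then show "(\<integral>\<^sup>+s. ?k s t \<partial>?\<mu>) = ennreal (g t)" using t mass by simp
  qed
  finally show ?thesis .
qed

lemma running_sup_right_continuous:
  fixes f :: "real \<Rightarrow> real"
  assumes f: "continuous (at_right t) f" and bdd: "\<And>t. bdd_above (f ` {0..t})" and t: "0 \<le> t"
  shows "continuous (at_right t) (\<lambda>t. SUP u\<in>{0..t}. f u)"
  unfolding continuous_within
proof (rule order_tendstoI)
  fix c assume c: "c < (SUP u\<in>{0..t}. f u)"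
  have "(SUP u\<in>{0..t}. f u) \<le> (SUP u\<in>{0..v}. f u)" if "t < v" for v
    using that t by (intro cSUP_subset_mono bdd) auto
  then show "\<forall>\<^sub>F v in at_right t. c < (SUP u\<in>{0..v}. f u)"
    using c unfolding eventually_at_right_field by (intro exI[of _ "t + 1"]) (auto intro: less_le_trans)
next
  fix c assume c: "(SUP u\<in>{0..t}. f u) < c"
  then obtain e where e: "(SUP u\<in>{0..t}. f u) < e" "e < c" using dense by blast
  have le: "f u < e" if "u \<in> {0..t}" for u
    using cSUP_upper[OF that bdd] e by simp
  have "(f \<longlongrightarrow> f t) (at_right t)" using f by (simp add: continuous_within)
  then have "\<forall>\<^sub>F u in at_right t. f u < e" using le[of t] t by (auto dest: order_tendstoD)
  then obtain d where d: "t < d" "\<And>u. t < u \<Longrightarrow> u < d \<Longrightarrow> f u < e"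
    unfolding eventually_at_right_field by blast
  have "(SUP u\<in>{0..v}. f u) < c" if v: "t < v" "v < d" for v
  proof -
    have "f u \<le> e" if "u \<in> {0..v}" for u
      using le[of u] d(2)[of u] that v by (cases "u \<le> t") auto
    then have "(SUP u\<in>{0..v}. f u) \<le> e" using v t by (intro cSUP_least) auto
    with e show ?thesis by simp
  qed
  then show "\<forall>\<^sub>F v in at_right t. (SUP u\<in>{0..v}. f u) < c"
    using d(1) unfolding eventually_at_right_field by blast
qed

lemma cadlag_mono:
  fixes f :: "real \<Rightarrow> real"
  assumes right: "\<And>t. 0 \<le> t \<Longrightarrow> continuous (at_right t) f" and mono: "mono_on {0..} f"
  shows "cadlag f"
  unfolding cadlag_def
proof safe
  fix t :: real assume t: "0 < t"
  have bdd: "bdd_above (f ` {0..<t})"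
    using t by (intro bdd_aboveI[of _ "f t"]) (auto intro: mono_onD[OF mono])
  have "(f \<longlongrightarrow> (SUP u\<in>{0..<t}. f u)) (at_left t)"
  proof (rule order_tendstoI)
    fix c assume "c < (SUP u\<in>{0..<t}. f u)"
    then obtain s where s: "s \<in> {0..<t}" "c < f s" using t by (auto simp: less_cSUP_iff[OF _ bdd])
    then have "c < f u" if "s < u" for u using mono_onD[OF mono, of s u] that by force
    then show "\<forall>\<^sub>F u in at_left t. c < f u" using s unfolding eventually_at_left_field by auto
  next
    fix c assume c: "(SUP u\<in>{0..<t}. f u) < c"
    have "f u < c" if "0 < u" "u < t" for u using cSUP_upper[of u "{0..<t}" f] bdd that c by auto
    then show "\<forall>\<^sub>F u in at_left t. f u < c" using t unfolding eventually_at_left_field by blast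
  qed
  then show "\<exists>l. (f \<longlongrightarrow> l) (at_left t)" by blast
qed (rule right)

section \<open>Increasing controls and their approximation by step processes\<close>

locale discounted_levy = levy N F Y x for N :: "'a measure" and F Y x +
  fixes r :: real
  assumes r: "0 < r"

sublocale discounted_levy \<subseteq> E: finite_measure "discount_measure r"
  by (rule finite_measure_discount) (rule r)

sublocale discounted_levy \<subseteq> pair_sigma_finite N "discount_measure r" ..

context discounted_levy
begin

abbreviation "E \<equiv> discount_measure r"

abbreviation "Q \<equiv> N \<Otimes>\<^sub>M E"

text \<open>A right-continuous process is the limit of its values at the next grid time, and those take only
countably many forms.\<close>

lemma measurable_right_continuous_process:
  assumes W: "\<And>t. 0 \<le> t \<Longrightarrow> W t \<in> borel_measurable N"
    and right: "\<And>\<omega> t. \<omega> \<in> space N \<Longrightarrow> 0 \<le> t \<Longrightarrow> continuous (at_right t) (\<lambda>t. W t \<omega> :: real)"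
  shows "(\<lambda>p. W (snd p) (fst p)) \<in> borel_measurable Q"
proof (rule borel_measurable_LIMSEQ_real[where u = "\<lambda>n p. W (real (next_grid n (snd p)) * mesh n) (fst p)"])
  fix p assume "p \<in> space Q"
  then have "fst p \<in> space N" "0 \<le> snd p" by (auto simp: space_pair_measure)
  then show "(\<lambda>n. W (real (next_grid n (snd p)) * mesh n) (fst p)) \<longlonglongrightarrow> W (snd p) (fst p)"
    by (intro grid_value_tendsto[of _ "\<lambda>t. W t (fst p)"] right)
next
  fix n
  show "(\<lambda>p. W (real (next_grid n (snd p)) * mesh n) (fst p)) \<in> borel_measurable Q"
  proof (rule measurable_compose_countable[where f = "\<lambda>k p. W (real k * mesh n) (fst p)"])
    show "(\<lambda>p. next_grid n (snd p)) \<in> measurable Q (count_space UNIV)" by measurable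
    fix k :: nat
    have "0 \<le> real k * mesh n" using mesh_pos[of n] by simp
    from measurable_compose[OF measurable_fst W[OF this]]
    show "(\<lambda>p. W (real k * mesh n) (fst p)) \<in> borel_measurable Q" .
  qed
qed

definition increasing_control :: "(real \<Rightarrow> 'a \<Rightarrow> real) \<Rightarrow> bool" where
  "increasing_control \<theta> \<longleftrightarrow> adapted F \<theta> \<and>
     (\<forall>\<omega>\<in>space N. cadlag (\<lambda>t. \<theta> t \<omega>) \<and> mono_on {0..} (\<lambda>t. \<theta> t \<omega>) \<and> 0 \<le> \<theta> 0 \<omega>)"

lemma increasing_controlD:
  assumes "increasing_control \<theta>" "\<omega> \<in> space N"
  shows "cadlag (\<lambda>t. \<theta> t \<omega>)" "mono_on {0..} (\<lambda>t. \<theta> t \<omega>)" "0 \<le> \<theta> 0 \<omega>"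
  using assms by (auto simp: increasing_control_def)

lemma increasing_control_measurable_F:
  "increasing_control \<theta> \<Longrightarrow> 0 \<le> s \<Longrightarrow> s \<le> t \<Longrightarrow> \<theta> s \<in> borel_measurable (F t)"
  using measurable_from_subalg[OF subalgebra_mono[of s t], of "\<theta> s" borel]
  by (auto simp: increasing_control_def adapted_def)

lemma increasing_control_measurable [measurable]:
  "increasing_control \<theta> \<Longrightarrow> 0 \<le> s \<Longrightarrow> \<theta> s \<in> borel_measurable N"
  by (rule measurable_from_subalg[OF subalgebra_F increasing_control_measurable_F]) auto

lemma increasing_control_joint [measurable]:
  "increasing_control \<theta> \<Longrightarrow> (\<lambda>p. \<theta> (snd p) (fst p)) \<in> borel_measurable Q"
  by (rule measurable_right_continuous_process)
    (auto intro: increasing_control_measurable cadlag_continuous_at_right increasing_controlD)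

lemma increasing_control_mono:
  "increasing_control \<theta> \<Longrightarrow> \<omega> \<in> space N \<Longrightarrow> 0 \<le> s \<Longrightarrow> s \<le> t \<Longrightarrow> \<theta> s \<omega> \<le> \<theta> t \<omega>"
  by (rule mono_onD[OF increasing_controlD(2)]) auto

lemma increasing_control_nonneg:
  "increasing_control \<theta> \<Longrightarrow> \<omega> \<in> space N \<Longrightarrow> 0 \<le> t \<Longrightarrow> 0 \<le> \<theta> t \<omega>"
  using increasing_control_mono[of \<theta> \<omega> 0 t] increasing_controlD(3)[of \<theta> \<omega>] by auto

lemma Y_joint [measurable]: "(\<lambda>p. Y (snd p) (fst p)) \<in> borel_measurable Q"
  by (intro measurable_right_continuous_process measurable_Y) (auto intro: cadlag_continuous_at_right cadlag_Y)

lemma sup_from_joint [measurable]: "(\<lambda>p. sup_from 0 (snd p) (fst p)) \<in> borel_measurable Q"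
proof (intro measurable_right_continuous_process measurable_sup_from)
  fix \<omega> t assume "\<omega> \<in> space N" "0 \<le> (t :: real)"
  then show "continuous (at_right t) (\<lambda>t. sup_from 0 t \<omega>)"
    unfolding sup_from_def add_0
    by (intro running_sup_right_continuous cadlag_bdd cadlag_Y cadlag_continuous_at_right)
qed auto

lemma sup_from_mono_start:
  assumes "\<omega> \<in> space N" "0 \<le> s" "0 \<le> t"
  shows "sup_from s t \<omega> \<le> sup_from 0 (s + t) \<omega>"
proof -
  have "bdd_above ((\<lambda>u. Y (0 + u) \<omega>) ` {0..s + t})" using cadlag_bdd(1)[OF cadlag_Y[OF assms(1)], of "s + t"] by simp
  then show ?thesis
    unfolding sup_from_def using assms
    by (intro cSUP_least) (auto intro!: cSUP_upper2[where x = "s + _"])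
qed

text \<open>The control frozen at the last grid point. It lies below \<open>\<theta>\<close> and jumps only at deterministic times,
so that the Markov property at fixed times suffices to treat it.\<close>

definition grid_control :: "(real \<Rightarrow> 'a \<Rightarrow> real) \<Rightarrow> nat \<Rightarrow> real \<Rightarrow> 'a \<Rightarrow> real" where
  "grid_control \<theta> n t \<omega> = \<theta> (real (next_grid n t - 1) * mesh n) \<omega>"

text \<open>The jump with index \<open>0\<close> is the initial value, in accordance with \<open>\<theta> (0-) = 0\<close>.\<close>

definition grid_jump :: "(real \<Rightarrow> 'a \<Rightarrow> real) \<Rightarrow> nat \<Rightarrow> nat \<Rightarrow> 'a \<Rightarrow> real" where
  "grid_jump \<theta> n k \<omega> = \<theta> (real k * mesh n) \<omega> - (if k = 0 then 0 else \<theta> (real (k - 1) * mesh n) \<omega>)"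

lemma prev_grid:
  assumes "0 \<le> t"
  shows "real (next_grid n t - 1) * mesh n \<le> t" "real k * mesh n \<le> t \<longleftrightarrow> k \<le> next_grid n t - 1"
proof -
  have "next_grid n t = Suc (next_grid n t - 1)" by (simp add: next_grid_def)
  then have "t \<in> {t\<in>{0..}. next_grid n t = Suc (next_grid n t - 1)}" using assms by simp
  then have "t \<in> {t'\<in>{0..}. next_grid n t' = Suc (next_grid n t - 1)}" using assms by (simp add: next_grid_def)
  then have *: "real (next_grid n t - 1) * mesh n \<le> t" "t < real (Suc (next_grid n t - 1)) * mesh n"
    unfolding grid_cell by (simp_all del: of_nat_Suc)
  then show "real (next_grid n t - 1) * mesh n \<le> t" by simp
  show "real k * mesh n \<le> t \<longleftrightarrow> k \<le> next_grid n t - 1"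
  proof
    assume "real k * mesh n \<le> t"
    then have "real k * mesh n < real (Suc (next_grid n t - 1)) * mesh n" using *(2) by simp
    then have "k < Suc (next_grid n t - 1)" using mesh_pos[of n] by (simp only: mult_less_cancel_right_pos of_nat_less_iff)
    then show "k \<le> next_grid n t - 1" by simp
  next
    assume "k \<le> next_grid n t - 1"
    then have "real k * mesh n \<le> real (next_grid n t - 1) * mesh n" using mesh_pos[of n] by simp
    with *(1) show "real k * mesh n \<le> t" by simp
  qed
qed

lemma grid_jump_nonneg:
  assumes "increasing_control \<theta>" "\<omega> \<in> space N" shows "0 \<le> grid_jump \<theta> n k \<omega>"
  using increasing_control_mono[OF assms, of "real (k - 1) * mesh n" "real k * mesh n"]
    increasing_control_nonneg[OF assms, of "real k * mesh n"] mesh_pos[of n]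
  by (auto simp: grid_jump_def)

lemma grid_control_eq_jumps:
  assumes \<theta>: "increasing_control \<theta>" and \<omega>: "\<omega> \<in> space N" and t: "0 \<le> t"
  shows "ennreal (grid_control \<theta> n t \<omega>) = (\<Sum>k. ennreal (grid_jump \<theta> n k \<omega>) * indicator {real k * mesh n..} t)"
proof -
  have "grid_control \<theta> n t \<omega> = (\<Sum>k\<le>next_grid n t - 1. grid_jump \<theta> n k \<omega>)"
  proof -
    have "\<theta> (real j * mesh n) \<omega> = (\<Sum>k\<le>j. grid_jump \<theta> n k \<omega>)" for j
      by (induction j) (simp_all add: grid_jump_def)
    then show ?thesis by (simp add: grid_control_def)
  qed
  then have "ennreal (grid_control \<theta> n t \<omega>) = (\<Sum>k\<le>next_grid n t - 1. ennreal (grid_jump \<theta> n k \<omega>))"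
    using grid_jump_nonneg[OF \<theta> \<omega>] by (simp add: sum_ennreal)
  also have "\<dots> = (\<Sum>k\<le>next_grid n t - 1. ennreal (grid_jump \<theta> n k \<omega>) * indicator {real k * mesh n..} t)"
    using prev_grid(2)[OF t] by (intro sum.cong) (auto simp: indicator_def)
  also have "\<dots> = (\<Sum>k. ennreal (grid_jump \<theta> n k \<omega>) * indicator {real k * mesh n..} t)"
    using prev_grid(2)[OF t] by (intro suminf_finite[symmetric]) (auto simp: indicator_def)
  finally show ?thesis .
qed

lemma grid_control_le:
  "increasing_control \<theta> \<Longrightarrow> \<omega> \<in> space N \<Longrightarrow> 0 \<le> t \<Longrightarrow> grid_control \<theta> n t \<omega> \<le> \<theta> t \<omega>"
  unfolding grid_control_def
  by (rule increasing_control_mono[OF _ _ _ prev_grid(1)])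
    (assumption | intro mult_nonneg_nonneg of_nat_0_le_iff less_imp_le[OF mesh_pos])+

lemma grid_control_joint [measurable]:
  assumes "increasing_control \<theta>"
  shows "(\<lambda>p. grid_control \<theta> n (snd p) (fst p)) \<in> borel_measurable Q"
  unfolding grid_control_def
proof (rule measurable_compose_countable[where f = "\<lambda>k p. \<theta> (real (k - 1) * mesh n) (fst p)"])
  show "(\<lambda>p. next_grid n (snd p)) \<in> measurable Q (count_space UNIV)" by measurable
  fix k :: nat
  have "0 \<le> real (k - 1) * mesh n" using mesh_pos[of n] by simp
  from measurable_compose[OF measurable_fst increasing_control_measurable[OF assms this]]
  show "(\<lambda>p. \<theta> (real (k - 1) * mesh n) (fst p)) \<in> borel_measurable Q" .
qed

text \<open>The frozen control converges wherever the path is continuous, and an increasing path has at most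
countably many discontinuities.\<close>

lemma grid_control_tendsto:
  assumes \<theta>: "increasing_control \<theta>" and \<omega>: "\<omega> \<in> space N"
  shows "AE t in E. (\<lambda>n. grid_control \<theta> n t \<omega>) \<longlonglongrightarrow> \<theta> t \<omega>"
proof (rule AE_discount_measureI)
  let ?D = "{a\<in>{0..}. \<not> continuous (at a within {0..}) (\<lambda>t. \<theta> t \<omega>)}"
  show "countable ?D" by (rule mono_on_ctble_discont[OF increasing_controlD(2)[OF \<theta> \<omega>]])
  fix t :: real assume t: "0 \<le> t" "t \<notin> ?D"
  have lim: "(\<lambda>n. real (next_grid n t - 1) * mesh n) \<longlonglongrightarrow> t"
  proof (rule tendsto_sandwich[OF always_eventually always_eventually _ tendsto_const])
    show "\<forall>n. t - mesh n \<le> real (next_grid n t - 1) * mesh n"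
    proof
      fix n
      have "real (next_grid n t) = real (next_grid n t - 1) + 1" by (simp add: next_grid_def)
      then have "real (next_grid n t) * mesh n = real (next_grid n t - 1) * mesh n + mesh n"
        by (simp only: distrib_right mult_1)
      then show "t - mesh n \<le> real (next_grid n t - 1) * mesh n"
        using next_grid_gt[OF t(1), of n] by linarith
    qed
    show "\<forall>n. real (next_grid n t - 1) * mesh n \<le> t" using prev_grid(1)[OF t(1)] by simp
    show "(\<lambda>n. t - mesh n) \<longlonglongrightarrow> t" using tendsto_diff[OF tendsto_const mesh_tendsto_0, of t] by simp
  qed
  have "continuous (at t within {0..}) (\<lambda>t. \<theta> t \<omega>)" using t by auto
  then show "(\<lambda>n. grid_control \<theta> n t \<omega>) \<longlonglongrightarrow> \<theta> t \<omega>"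
    unfolding grid_control_def continuous_within_sequentially comp_def
    using lim mesh_pos by (simp add: less_imp_le)
qed

section \<open>The first-order inequality for increasing controls\<close>

lemma nn_integral_swap:
  assumes [measurable]: "(\<lambda>p. h (fst p) (snd p)) \<in> borel_measurable Q"
  shows "(\<integral>\<^sup>+t. (\<integral>\<^sup>+\<omega>. h \<omega> t \<partial>N) \<partial>E) = (\<integral>\<^sup>+p. h (fst p) (snd p) \<partial>Q)"
  using nn_integral_snd[of "\<lambda>p. h (fst p) (snd p)"] by simp

lemma increasing_control_mean_finite:
  assumes \<theta>: "increasing_control \<theta>" and fin: "(\<integral>\<^sup>+t. (\<integral>\<^sup>+\<omega>. ennreal (\<theta> t \<omega>) \<partial>N) \<partial>E) < \<infinity>"
    and s: "0 \<le> s"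
  shows "(\<integral>\<^sup>+\<omega>. ennreal (\<theta> s \<omega>) \<partial>N) < \<infinity>"
proof (rule ccontr)
  assume "\<not> (\<integral>\<^sup>+\<omega>. ennreal (\<theta> s \<omega>) \<partial>N) < \<infinity>"
  then have top: "(\<integral>\<^sup>+\<omega>. ennreal (\<theta> s \<omega>) \<partial>N) = \<infinity>" by (simp add: less_top[symmetric])
  have "(\<integral>\<^sup>+t. \<infinity> * indicator {s..} t \<partial>E) \<le> (\<integral>\<^sup>+t. (\<integral>\<^sup>+\<omega>. ennreal (\<theta> t \<omega>) \<partial>N) \<partial>E)"
  proof (rule nn_integral_mono)
    fix t assume "t \<in> space E"
    have "(\<integral>\<^sup>+\<omega>. ennreal (\<theta> s \<omega>) \<partial>N) \<le> (\<integral>\<^sup>+\<omega>. ennreal (\<theta> t \<omega>) \<partial>N)" if "s \<le> t"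
      using increasing_control_mono[OF \<theta> _ s that] by (intro nn_integral_mono ennreal_leI) auto
    then show "\<infinity> * indicator {s..} t \<le> (\<integral>\<^sup>+\<omega>. ennreal (\<theta> t \<omega>) \<partial>N)"
      using top by (auto simp: indicator_def)
  qed
  also have "\<dots> < \<infinity>" by (rule fin)
  finally have "\<infinity> * emeasure E {s..} < \<infinity>"
    using s by (subst (asm) nn_integral_cmult_indicator) (auto simp: sets_restrict_space_iff)
  moreover have "emeasure E {s..} \<noteq> 0" using r by (simp add: emeasure_discount_from[OF r s])
  ultimately show False by (simp add: ennreal_top_mult)
qed

text \<open>The assumption \<open>key\<close> says that a unit bought at a fixed time \<open>s\<close> returns at most \<open>K\<close> when its revenue
is computed from the supremum of the process since \<open>s\<close>. It is transferred to arbitrary increasing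
controls and to the supremum since time \<open>0\<close>.\<close>

context
  fixes f q :: "real \<Rightarrow> real" and K :: real
  assumes K: "0 \<le> K" and f: "antimono f"
    and meas [measurable]: "f \<in> borel_measurable borel" "q \<in> borel_measurable borel"
    and key: "\<And>s Z. 0 \<le> s \<Longrightarrow> Z \<in> borel_measurable (F s) \<Longrightarrow> (\<integral>\<^sup>+\<omega>. Z \<omega> \<partial>N) < \<infinity> \<Longrightarrow>
      (\<integral>\<^sup>+t. (\<integral>\<^sup>+\<omega>. Z \<omega> * (ennreal (f (sup_from s t \<omega>)) * ennreal (q (Y (s + t) \<omega>))) \<partial>N) \<partial>E) \<le>
      ennreal K * (\<integral>\<^sup>+\<omega>. Z \<omega> \<partial>N)"
begin

definition gain :: "real \<Rightarrow> 'a \<Rightarrow> ennreal" where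
  "gain t \<omega> = ennreal (f (sup_from 0 t \<omega>)) * ennreal (q (Y t \<omega>))"

lemma gain_joint [measurable]: "(\<lambda>p. gain (snd p) (fst p)) \<in> borel_measurable Q"
  unfolding gain_def by measurable

text \<open>After a shift of time to the jump, the supremum since \<open>0\<close> is replaced by the smaller supremum since
the jump, which can only increase the antitone \<open>f\<close>. The size of the jump is known at the jump time,
so it may serve as the weight \<open>Z\<close>.\<close>

lemma jump_gain_le:
  assumes \<theta>: "increasing_control \<theta>" and fin: "(\<integral>\<^sup>+t. (\<integral>\<^sup>+\<omega>. ennreal (\<theta> t \<omega>) \<partial>N) \<partial>E) < \<infinity>"
  shows "(\<integral>\<^sup>+t. (\<integral>\<^sup>+\<omega>. (ennreal (grid_jump \<theta> n k \<omega>) * indicator {real k * mesh n..} t) * gain t \<omega> \<partial>N) \<partial>E) \<le>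
      ennreal (r * K) * (\<integral>\<^sup>+t. (\<integral>\<^sup>+\<omega>. ennreal (grid_jump \<theta> n k \<omega>) * indicator {real k * mesh n..} t \<partial>N) \<partial>E)"
    (is "?A \<le> _ * ?B")
proof -
  let ?s = "real k * mesh n" and ?Z = "\<lambda>\<omega>. ennreal (grid_jump \<theta> n k \<omega>)"
  have s: "0 \<le> ?s" "0 \<le> real (k - 1) * mesh n" "real (k - 1) * mesh n \<le> ?s" using mesh_pos[of n] by simp_all
  have "grid_jump \<theta> n k \<in> borel_measurable (F ?s)"
    unfolding grid_jump_def using increasing_control_measurable_F[OF \<theta> s(2,3)] increasing_control_measurable_F[OF \<theta> s(1) order_refl]
    by (cases "k = 0") auto
  then have Z: "?Z \<in> borel_measurable (F ?s)" by measurable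
  have [measurable]: "?Z \<in> borel_measurable N" by (rule measurable_from_subalg[OF subalgebra_F[OF s(1)] Z])
  have "(\<integral>\<^sup>+\<omega>. ?Z \<omega> \<partial>N) \<le> (\<integral>\<^sup>+\<omega>. ennreal (\<theta> ?s \<omega>) \<partial>N)"
    using increasing_control_nonneg[OF \<theta> _ s(2)]
    by (intro nn_integral_mono ennreal_leI) (auto simp: grid_jump_def)
  also have "\<dots> < \<infinity>" by (rule increasing_control_mean_finite[OF \<theta> fin s(1)])
  finally have Z_fin: "(\<integral>\<^sup>+\<omega>. ?Z \<omega> \<partial>N) < \<infinity>" .
  have H_meas: "(\<lambda>t. \<integral>\<^sup>+\<omega>. ?Z \<omega> * gain t \<omega> \<partial>N) \<in> borel_measurable E"
  proof -
    have "(\<lambda>p. ?Z (snd p) * gain (fst p) (snd p)) \<in> borel_measurable (E \<Otimes>\<^sub>M N)"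
      using measurable_compose[OF measurable_pair_swap' gain_joint]
      by (intro borel_measurable_times_ennreal) (auto simp: case_prod_unfold)
    then show ?thesis
      by (intro sigma_finite_measure.borel_measurable_nn_integral[OF prob_space_imp_sigma_finite[OF prob_space_N]])
        (simp add: case_prod_unfold)
  qed
  have "?A = (\<integral>\<^sup>+t. (\<integral>\<^sup>+\<omega>. ?Z \<omega> * gain t \<omega> \<partial>N) * indicator {?s..} t \<partial>E)"
    by (intro nn_integral_cong) (auto simp: indicator_def)
  also have "\<dots> = ennreal (exp (- r * ?s)) * (\<integral>\<^sup>+t. (\<integral>\<^sup>+\<omega>. ?Z \<omega> * gain (?s + t) \<omega> \<partial>N) \<partial>E)"
    by (rule nn_integral_discount_from[OF s(1) H_meas])
  also have "\<dots> \<le> ennreal (exp (- r * ?s)) * (\<integral>\<^sup>+t. (\<integral>\<^sup>+\<omega>. ?Z \<omega> * (ennreal (f (sup_from ?s t \<omega>)) * ennreal (q (Y (?s + t) \<omega>))) \<partial>N) \<partial>E)"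
  proof (intro mult_left_mono nn_integral_mono)
    fix t \<omega> assume t: "t \<in> space E" and \<omega>: "\<omega> \<in> space N"
    have "f (sup_from 0 (?s + t) \<omega>) \<le> f (sup_from ?s t \<omega>)"
      using sup_from_mono_start[OF \<omega> s(1), of t] t by (intro antimonoD[OF f]) auto
    then show "gain (?s + t) \<omega> \<le> ennreal (f (sup_from ?s t \<omega>)) * ennreal (q (Y (?s + t) \<omega>))"
      unfolding gain_def by (intro mult_right_mono ennreal_leI) auto
  qed auto
  also have "\<dots> \<le> ennreal (exp (- r * ?s)) * (ennreal K * (\<integral>\<^sup>+\<omega>. ?Z \<omega> \<partial>N))"
    by (intro mult_left_mono key s Z Z_fin) simp
  also have "\<dots> = ennreal (r * K) * ((\<integral>\<^sup>+\<omega>. ?Z \<omega> \<partial>N) * ennreal (exp (- r * ?s) / r))"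
  proof -
    have "ennreal (exp (- r * ?s)) * ennreal K = ennreal (r * K) * ennreal (exp (- r * ?s) / r)"
      using r K by (simp add: ennreal_mult[symmetric] mult.commute)
    note eq = this
    have "a * (b * z) = c * (z * d)" if "a * b = c * d" for a b c d z :: ennreal
      using that by (metis mult.assoc mult.commute)
    from this[OF eq] show ?thesis .
  qed
  also have "(\<integral>\<^sup>+\<omega>. ?Z \<omega> \<partial>N) * ennreal (exp (- r * ?s) / r) = (\<integral>\<^sup>+t. (\<integral>\<^sup>+\<omega>. ?Z \<omega> \<partial>N) * indicator {?s..} t \<partial>E)"
    using s by (subst nn_integral_cmult_indicator) (auto simp: sets_restrict_space_iff emeasure_discount_from[OF r])
  also have "\<dots> = ?B"
    by (intro nn_integral_cong) (auto simp: indicator_def)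
  finally show ?thesis .
qed

lemma grid_control_gain_le:
  assumes \<theta>: "increasing_control \<theta>" and fin: "(\<integral>\<^sup>+t. (\<integral>\<^sup>+\<omega>. ennreal (\<theta> t \<omega>) \<partial>N) \<partial>E) < \<infinity>"
  shows "(\<integral>\<^sup>+p. ennreal (grid_control \<theta> n (snd p) (fst p)) * gain (snd p) (fst p) \<partial>Q) \<le>
      ennreal (r * K) * (\<integral>\<^sup>+p. ennreal (\<theta> (snd p) (fst p)) \<partial>Q)"
proof -
  note [measurable] = increasing_control_joint[OF \<theta>] grid_control_joint[OF \<theta>]
  have ge_meas [measurable]: "(\<lambda>p. indicator {s..} (snd p) :: ennreal) \<in> borel_measurable Q" for s :: real
  proof -
    have "(\<lambda>t. indicator {s..} t :: ennreal) \<in> borel_measurable E"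
      unfolding measurable_cong_sets[OF sets_discount_measure refl] by (rule measurable_restrict_space1) measurable
    then show ?thesis by (rule measurable_compose[OF measurable_snd])
  qed
  have jump_meas [measurable]: "(\<lambda>p. ennreal (grid_jump \<theta> n k (fst p))) \<in> borel_measurable Q" for n k
  proof -
    have "0 \<le> real k * mesh n" "0 \<le> real (k - 1) * mesh n" using mesh_pos[of n] by simp_all
    from this[THEN increasing_control_measurable[OF \<theta>]]
    have "grid_jump \<theta> n k \<in> borel_measurable N" unfolding grid_jump_def by (cases "k = 0") auto
    then show ?thesis by measurable
  qed
  let ?j = "\<lambda>k p. ennreal (grid_jump \<theta> n k (fst p)) * indicator {real k * mesh n..} (snd p)"
  have eq: "ennreal (grid_control \<theta> n (snd p) (fst p)) = (\<Sum>k. ?j k p)" if "p \<in> space Q" for p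
    using that by (intro grid_control_eq_jumps[OF \<theta>]) (auto simp: space_pair_measure)
  have "(\<integral>\<^sup>+p. ennreal (grid_control \<theta> n (snd p) (fst p)) * gain (snd p) (fst p) \<partial>Q) =
      (\<integral>\<^sup>+p. (\<Sum>k. ?j k p * gain (snd p) (fst p)) \<partial>Q)"
    by (intro nn_integral_cong) (simp add: eq)
  also have "\<dots> = (\<Sum>k. \<integral>\<^sup>+p. ?j k p * gain (snd p) (fst p) \<partial>Q)"
    by (rule nn_integral_suminf) measurable
  also have "\<dots> \<le> (\<Sum>k. ennreal (r * K) * (\<integral>\<^sup>+p. ?j k p \<partial>Q))"
  proof (intro suminf_le)
    fix k
    have "(\<integral>\<^sup>+t. (\<integral>\<^sup>+\<omega>. ?j k (\<omega>, t) * gain t \<omega> \<partial>N) \<partial>E) \<le> ennreal (r * K) * (\<integral>\<^sup>+t. (\<integral>\<^sup>+\<omega>. ?j k (\<omega>, t) \<partial>N) \<partial>E)"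
      using jump_gain_le[OF \<theta> fin, of n k] by simp
    moreover have "(\<integral>\<^sup>+t. (\<integral>\<^sup>+\<omega>. ?j k (\<omega>, t) * gain t \<omega> \<partial>N) \<partial>E) = (\<integral>\<^sup>+p. ?j k p * gain (snd p) (fst p) \<partial>Q)"
      using nn_integral_swap[of "\<lambda>\<omega> t. ?j k (\<omega>, t) * gain t \<omega>"] by simp
    moreover have "(\<integral>\<^sup>+t. (\<integral>\<^sup>+\<omega>. ?j k (\<omega>, t) \<partial>N) \<partial>E) = (\<integral>\<^sup>+p. ?j k p \<partial>Q)"
      using nn_integral_swap[of "\<lambda>\<omega> t. ?j k (\<omega>, t)"] by simp
    ultimately show "(\<integral>\<^sup>+p. ?j k p * gain (snd p) (fst p) \<partial>Q) \<le> ennreal (r * K) * (\<integral>\<^sup>+p. ?j k p \<partial>Q)"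
      by simp
  qed auto
  also have "\<dots> = ennreal (r * K) * (\<integral>\<^sup>+p. (\<Sum>k. ?j k p) \<partial>Q)"
    by (subst nn_integral_suminf) auto
  also have "(\<integral>\<^sup>+p. (\<Sum>k. ?j k p) \<partial>Q) = (\<integral>\<^sup>+p. ennreal (grid_control \<theta> n (snd p) (fst p)) \<partial>Q)"
    by (intro nn_integral_cong) (simp add: eq)
  also have "ennreal (r * K) * \<dots> \<le> ennreal (r * K) * (\<integral>\<^sup>+p. ennreal (\<theta> (snd p) (fst p)) \<partial>Q)"
    using grid_control_le[OF \<theta>] by (intro mult_left_mono nn_integral_mono ennreal_leI) (auto simp: space_pair_measure)
  finally show ?thesis .
qed

text \<open>Fatou's lemma along the frozen controls, which converge to \<open>\<theta>\<close> for almost every time and have no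
larger cost.\<close>

lemma control_gain_le:
  assumes \<theta>: "increasing_control \<theta>" and fin: "(\<integral>\<^sup>+t. (\<integral>\<^sup>+\<omega>. ennreal (\<theta> t \<omega>) \<partial>N) \<partial>E) < \<infinity>"
  shows "(\<integral>\<^sup>+t. (\<integral>\<^sup>+\<omega>. ennreal (\<theta> t \<omega>) * (ennreal (f (sup_from 0 t \<omega>)) * ennreal (q (Y t \<omega>))) \<partial>N) \<partial>E) \<le>
    ennreal (r * K) * (\<integral>\<^sup>+t. (\<integral>\<^sup>+\<omega>. ennreal (\<theta> t \<omega>) \<partial>N) \<partial>E)"
proof -
  note [measurable] = increasing_control_joint[OF \<theta>] grid_control_joint[OF \<theta>]
  have "(\<integral>\<^sup>+t. (\<integral>\<^sup>+\<omega>. ennreal (\<theta> t \<omega>) * gain t \<omega> \<partial>N) \<partial>E) = (\<integral>\<^sup>+\<omega>. (\<integral>\<^sup>+t. ennreal (\<theta> t \<omega>) * gain t \<omega> \<partial>E) \<partial>N)"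
    by (rule Fubini') (simp add: case_prod_unfold)
  also have "\<dots> \<le> (\<integral>\<^sup>+\<omega>. (\<integral>\<^sup>+t. liminf (\<lambda>n. ennreal (grid_control \<theta> n t \<omega>) * gain t \<omega>) \<partial>E) \<partial>N)"
  proof (rule nn_integral_mono, rule nn_integral_mono_AE)
    fix \<omega> assume \<omega>: "\<omega> \<in> space N"
    show "AE t in E. ennreal (\<theta> t \<omega>) * gain t \<omega> \<le> liminf (\<lambda>n. ennreal (grid_control \<theta> n t \<omega>) * gain t \<omega>)"
      using grid_control_tendsto[OF \<theta> \<omega>]
    proof eventually_elim
      case (elim t)
      then have "(\<lambda>n. ennreal (grid_control \<theta> n t \<omega>) * gain t \<omega>) \<longlonglongrightarrow> ennreal (\<theta> t \<omega>) * gain t \<omega>"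
        by (intro tendsto_mult_ennreal tendsto_ennrealI tendsto_const) (auto simp: gain_def ennreal_mult_eq_top_iff)
      then show ?case by (simp add: lim_imp_Liminf)
    qed
  qed
  also have "\<dots> = (\<integral>\<^sup>+p. liminf (\<lambda>n. ennreal (grid_control \<theta> n (snd p) (fst p)) * gain (snd p) (fst p)) \<partial>Q)"
    by (subst E.nn_integral_fst[symmetric]) simp_all
  also have "\<dots> \<le> liminf (\<lambda>n. \<integral>\<^sup>+p. ennreal (grid_control \<theta> n (snd p) (fst p)) * gain (snd p) (fst p) \<partial>Q)"
    by (rule nn_integral_liminf) measurable
  also have "\<dots> \<le> liminf (\<lambda>n::nat. ennreal (r * K) * (\<integral>\<^sup>+p. ennreal (\<theta> (snd p) (fst p)) \<partial>Q))"
    by (intro Liminf_mono always_eventually allI grid_control_gain_le[OF \<theta> fin])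
  also have "\<dots> = ennreal (r * K) * (\<integral>\<^sup>+t. (\<integral>\<^sup>+\<omega>. ennreal (\<theta> t \<omega>) \<partial>N) \<partial>E)"
    by (subst nn_integral_swap) (simp_all add: Liminf_const)
  finally show ?thesis unfolding gain_def .
qed

end

section \<open>Payoffs as integrals over paths and time\<close>

text \<open>Square integrability of the discounted cost implies its integrability, and by parts the cost is the
integral of the control.\<close>

lemma singular_controls_integrable:
  assumes "\<theta> \<in> singular_controls r N F"
  shows "increasing_control \<theta>" "integrable Q (\<lambda>p. \<theta> (snd p) (fst p))"
proof -
  show \<theta>: "increasing_control \<theta>" using assms by (simp add: singular_controls_def increasing_control_def)
  note [measurable] = increasing_control_joint[OF \<theta>]
  let ?I = "\<lambda>\<omega>. ennreal r * (\<integral>\<^sup>+t. ennreal (\<theta> t \<omega>) \<partial>E)"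
  have [measurable]: "?I \<in> borel_measurable N"
    by (intro borel_measurable_times_ennreal borel_measurable_const E.borel_measurable_nn_integral) (simp add: case_prod_unfold)
  have "(\<integral>\<^sup>+\<omega>. (?I \<omega>)\<^sup>2 \<partial>N) < \<infinity>"
  proof -
    have "(\<integral>\<^sup>+\<omega>. (?I \<omega>)\<^sup>2 \<partial>N) = (\<integral>\<^sup>+\<omega>. (stieltjes_integral (\<lambda>t. \<theta> t \<omega>) (\<lambda>t. exp (- r * t)))\<^sup>2 \<partial>N)"
      using stieltjes_integral_exp[OF r increasing_controlD[OF \<theta>], of _ 1] by (intro nn_integral_cong) simp
    then show ?thesis using assms by (simp add: singular_controls_def)
  qed
  moreover have "(\<integral>\<^sup>+\<omega>. ?I \<omega> \<partial>N) \<le> (\<integral>\<^sup>+\<omega>. 1 + (?I \<omega>)\<^sup>2 \<partial>N)"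
  proof (rule nn_integral_mono)
    have "x \<le> 1 + x\<^sup>2" for x :: ennreal
    proof (cases "x \<le> 1")
      case True then show ?thesis by (simp add: add_increasing2)
    next
      case False
      then have "x * 1 \<le> x * x" by (intro mult_left_mono) auto
      then show ?thesis by (simp add: power2_eq_square add_increasing)
    qed
    then show "?I \<omega> \<le> 1 + (?I \<omega>)\<^sup>2" for \<omega> by blast
  qed
  ultimately have "(\<integral>\<^sup>+\<omega>. ?I \<omega> \<partial>N) < \<infinity>"
    by (subst (asm) nn_integral_add) (auto simp: emeasure_space_1 less_top[symmetric] top_unique)
  then have "ennreal r * (\<integral>\<^sup>+\<omega>. (\<integral>\<^sup>+t. ennreal (\<theta> t \<omega>) \<partial>E) \<partial>N) < \<infinity>"
    by (subst (asm) nn_integral_cmult) (auto intro!: E.borel_measurable_nn_integral simp: case_prod_unfold)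
  then have "(\<integral>\<^sup>+\<omega>. (\<integral>\<^sup>+t. ennreal (\<theta> t \<omega>) \<partial>E) \<partial>N) < \<infinity>"
    using r by (auto simp: less_top[symmetric] ennreal_mult_eq_top_iff)
  then have "(\<integral>\<^sup>+p. ennreal (\<theta> (snd p) (fst p)) \<partial>Q) < \<infinity>"
    by (subst (asm) E.nn_integral_fst[of "\<lambda>p. ennreal (\<theta> (snd p) (fst p))", simplified]) auto
  moreover have "(\<integral>\<^sup>+p. ennreal (\<theta> (snd p) (fst p)) \<partial>Q) = (\<integral>\<^sup>+p. ennreal (norm (\<theta> (snd p) (fst p))) \<partial>Q)"
    using increasing_control_nonneg[OF \<theta>] by (intro nn_integral_cong) (auto simp: space_pair_measure)
  ultimately show "integrable Q (\<lambda>p. \<theta> (snd p) (fst p))"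
    by (intro integrableI_bounded) auto
qed

text \<open>Both pathwise integrals are almost surely finite by Fubini's theorem, so that the difference of extended
reals is a genuine one and no conventions on infinite values enter.\<close>

lemma ereal_integral_difference:
  assumes u: "integrable Q (\<lambda>p. u (fst p) (snd p))" "\<And>\<omega> t. \<omega> \<in> space N \<Longrightarrow> 0 \<le> t \<Longrightarrow> 0 \<le> u \<omega> t"
    and v: "integrable Q (\<lambda>p. v (fst p) (snd p))" "\<And>\<omega> t. \<omega> \<in> space N \<Longrightarrow> 0 \<le> t \<Longrightarrow> 0 \<le> v \<omega> t"
    and h: "\<And>\<omega>. \<omega> \<in> space N \<Longrightarrow> h \<omega> = enn2ereal (\<integral>\<^sup>+t. ennreal (u \<omega> t) \<partial>E) - enn2ereal (\<integral>\<^sup>+t. ennreal (v \<omega> t) \<partial>E)"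
  shows "ereal_integral N h =
    ereal (\<integral>p. u (fst p) (snd p) - v (fst p) (snd p) \<partial>Q)"
proof -
  let ?a = "\<lambda>\<omega>. \<integral>t. u \<omega> t \<partial>E" and ?b = "\<lambda>\<omega>. \<integral>t. v \<omega> t \<partial>E"
  have int: "integrable N ?a" "integrable N ?b"
    using integrable_fst'[OF u(1)] integrable_fst'[OF v(1)] by simp_all
  have "AE \<omega> in N. h \<omega> = ereal (?a \<omega> - ?b \<omega>)"
    using AE_integrable_fst'[OF u(1)] AE_integrable_fst'[OF v(1)] AE_space
  proof eventually_elim
    case (elim \<omega>)
    have "(\<integral>\<^sup>+t. ennreal (u \<omega> t) \<partial>E) = ennreal (?a \<omega>)" "(\<integral>\<^sup>+t. ennreal (v \<omega> t) \<partial>E) = ennreal (?b \<omega>)"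
      using elim u(2) v(2) by (auto intro!: nn_integral_eq_integral)
    moreover have "0 \<le> ?a \<omega>" "0 \<le> ?b \<omega>" using elim(3) u(2) v(2) by (auto intro!: integral_nonneg_AE AE_I2)
    ultimately show ?case using h[OF elim(3)] by (simp add: enn2ereal_ennreal)
  qed
  then have "(\<integral>\<^sup>+\<omega>. e2ennreal (h \<omega>) \<partial>N) = (\<integral>\<^sup>+\<omega>. ennreal (?a \<omega> - ?b \<omega>) \<partial>N)"
    "(\<integral>\<^sup>+\<omega>. e2ennreal (- h \<omega>) \<partial>N) = (\<integral>\<^sup>+\<omega>. ennreal (- (?a \<omega> - ?b \<omega>)) \<partial>N)"
    by (auto intro!: nn_integral_cong_AE elim!: eventually_mono simp only: uminus_ereal.simps e2ennreal_ereal)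
  moreover have int_diff: "integrable N (\<lambda>\<omega>. ?a \<omega> - ?b \<omega>)" using int by simp
  moreover have "enn2ereal y - enn2ereal z = ereal (enn2real y - enn2real z)" if "y \<noteq> \<infinity>" "z \<noteq> \<infinity>" for y z
    using that by (cases y; cases z) (auto simp: enn2ereal_ennreal)
  ultimately have "ereal_integral N h = ereal (\<integral>\<omega>. ?a \<omega> - ?b \<omega> \<partial>N)"
    unfolding ereal_integral_def real_lebesgue_integral_def[OF int_diff]
    using int_diff unfolding real_integrable_def by simp
  also have "(\<integral>\<omega>. ?a \<omega> - ?b \<omega> \<partial>N) = (\<integral>\<omega>. ?a \<omega> \<partial>N) - (\<integral>\<omega>. ?b \<omega> \<partial>N)"
    using int by simp
  also have "\<dots> = (\<integral>p. u (fst p) (snd p) \<partial>Q) - (\<integral>p. v (fst p) (snd p) \<partial>Q)"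
    using integral_fst'[OF u(1)] integral_fst'[OF v(1)] by simp
  also have "\<dots> = (\<integral>p. u (fst p) (snd p) - v (fst p) (snd p) \<partial>Q)"
    using u v by simp
  finally show ?thesis .
qed

lemma investment_payoff_eq:
  assumes \<theta>: "increasing_control \<theta>" and \<theta>_int: "integrable Q (\<lambda>p. \<theta> (snd p) (fst p))"
    and R_int: "integrable Q (\<lambda>s. p (\<theta> (snd s) (fst s)) * q (Y (snd s) (fst s)))"
    and p: "\<And>z. 0 \<le> z \<Longrightarrow> 0 \<le> p z" and q: "\<And>u. 0 \<le> q u" and K: "0 \<le> K"
  shows "investment_payoff r K p q Y N \<theta> =
    ereal (\<integral>s. p (\<theta> (snd s) (fst s)) * q (Y (snd s) (fst s)) - r * K * \<theta> (snd s) (fst s) \<partial>Q)"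
  unfolding investment_payoff_def
proof (rule ereal_integral_difference[where u = "\<lambda>\<omega> t. p (\<theta> t \<omega>) * q (Y t \<omega>)" and v = "\<lambda>\<omega> t. r * K * \<theta> t \<omega>"])
  note nonneg = increasing_control_nonneg[OF \<theta>]
  show "0 \<le> p (\<theta> t \<omega>) * q (Y t \<omega>)" "0 \<le> r * K * \<theta> t \<omega>" if "\<omega> \<in> space N" "0 \<le> t" for \<omega> t
    using nonneg[OF that] p q K r by auto
  fix \<omega> assume \<omega>: "\<omega> \<in> space N"
  have meas: "(\<lambda>t. p (\<theta> t \<omega>) * q (Y t \<omega>)) \<in> borel_measurable E" "(\<lambda>t. \<theta> t \<omega>) \<in> borel_measurable E"
    using measurable_compose_Pair1[OF \<omega> borel_measurable_integrable[OF R_int]]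
      measurable_compose_Pair1[OF \<omega> borel_measurable_integrable[OF \<theta>_int]] by simp_all
  have "discounted_integral r (\<lambda>t. ereal (p (\<theta> t \<omega>) * q (Y t \<omega>))) = enn2ereal (\<integral>\<^sup>+t. ennreal (p (\<theta> t \<omega>) * q (Y t \<omega>)) \<partial>E)"
  proof -
    have "(\<integral>\<^sup>+t. e2ennreal (ereal (p (\<theta> t \<omega>) * q (Y t \<omega>)) * ereal (exp (- r * t))) \<partial>restrict_space lborel {0..}) =
       (\<integral>\<^sup>+t. ennreal (p (\<theta> t \<omega>) * q (Y t \<omega>)) * ennreal (exp (- r * t)) \<partial>restrict_space lborel {0..})"
      using nonneg[OF \<omega>] p q by (intro nn_integral_cong) (simp add: ennreal_mult[symmetric] space_restrict_space)
    also have "\<dots> = (\<integral>\<^sup>+t. ennreal (p (\<theta> t \<omega>) * q (Y t \<omega>)) \<partial>E)"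
      using meas(1) by (subst nn_integral_discount_measure) (simp_all add: measurable_cong_sets[OF sets_discount_measure refl])
    finally have pos: "(\<integral>\<^sup>+t. e2ennreal (ereal (p (\<theta> t \<omega>) * q (Y t \<omega>)) * ereal (exp (- r * t))) \<partial>restrict_space lborel {0..}) = \<dots>" .
    have "(\<integral>\<^sup>+t. e2ennreal (- (ereal (p (\<theta> t \<omega>) * q (Y t \<omega>)) * ereal (exp (- r * t)))) \<partial>restrict_space lborel {0..}) =
       (\<integral>\<^sup>+(t::real). 0 \<partial>restrict_space lborel {0..})"
      using nonneg[OF \<omega>] p q by (intro nn_integral_cong) (simp add: space_restrict_space ennreal_neg)
    then show ?thesis unfolding discounted_integral_def ereal_integral_def pos
      by (simp add: zero_ennreal.rep_eq)
  qed
  moreover have "stieltjes_integral (\<lambda>t. \<theta> t \<omega>) (\<lambda>t. K * exp (- r * t)) = (\<integral>\<^sup>+t. ennreal (r * K * \<theta> t \<omega>) \<partial>E)"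
  proof -
    have "(\<integral>\<^sup>+t. ennreal (r * K * \<theta> t \<omega>) \<partial>E) = (\<integral>\<^sup>+t. ennreal (r * K) * ennreal (\<theta> t \<omega>) \<partial>E)"
      using nonneg[OF \<omega>] r K by (intro nn_integral_cong) (simp add: ennreal_mult[symmetric])
    also have "\<dots> = ennreal (r * K) * (\<integral>\<^sup>+t. ennreal (\<theta> t \<omega>) \<partial>E)"
      using meas(2) by (intro nn_integral_cmult) simp
    finally show ?thesis using stieltjes_integral_exp[OF r increasing_controlD[OF \<theta> \<omega>] K] by simp
  qed
  ultimately show "discounted_integral r (\<lambda>t. ereal (p (\<theta> t \<omega>) * q (Y t \<omega>))) -
       enn2ereal (stieltjes_integral (\<lambda>t. \<theta> t \<omega>) (\<lambda>t. K * exp (- r * t))) =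
     enn2ereal (\<integral>\<^sup>+t. ennreal (p (\<theta> t \<omega>) * q (Y t \<omega>)) \<partial>E) - enn2ereal (\<integral>\<^sup>+t. ennreal (r * K * \<theta> t \<omega>) \<partial>E)"
    by simp
qed (use \<theta>_int R_int in simp_all)

end

section \<open>The candidate control and its first-order conditions\<close>

lemma strictly_concave_below_tangent:
  fixes p p' :: "real \<Rightarrow> real"
  assumes deriv: "\<And>z. 0 \<le> z \<Longrightarrow> (p has_real_derivative p' z) (at z within {0..})"
    and anti: "strict_antimono_on {0..} p'" and a: "0 \<le> a" and y: "0 \<le> y" "y \<noteq> a"
  shows "p y < p a + p' a * (y - a)"
proof -
  have mvt: "\<exists>c\<in>{u<..<v}. p v - p u = p' c * (v - u)" if "0 \<le> u" "u < v" for u v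
  proof (rule mvt_simple[OF that(2)])
    fix z assume "u \<le> z" "z \<le> v"
    then have "0 \<le> z" "{u..v} \<subseteq> {0..}" using that(1) by auto
    then show "(p has_derivative (*) (p' z)) (at z within {u..v})"
      by (intro has_field_derivative_imp_has_derivative DERIV_subset[OF deriv])
  qed
  consider "a < y" | "y < a" using y by linarith
  then show ?thesis
  proof cases
    case 1
    then obtain c where c: "a < c" "p y - p a = p' c * (y - a)" using mvt[OF a 1] by auto
    then have "p' c < p' a" using monotone_onD[OF anti, of a c] a by auto
    then have "p' c * (y - a) < p' a * (y - a)" using 1 by simp
    with c show ?thesis by simp
  next
    case 2
    then obtain c where c: "y < c" "c < a" "p a - p y = p' c * (a - y)" using mvt[OF y(1) 2] by auto
    then have "p' a < p' c" using monotone_onD[OF anti, of c a] y by auto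
    then have "p' a * (a - y) < p' c * (a - y)" using 2 by simp
    with c show ?thesis by (simp add: algebra_simps)
  qed
qed

text \<open>Gives adaptedness of running suprema: all times in the countable index set are at most \<open>t\<close>, and \<open>t\<close>
itself is included because nothing to the right of it may be used.\<close>

lemma SUP_right_continuous_eq_countable:
  fixes f :: "real \<Rightarrow> real"
  assumes right: "\<And>u. 0 \<le> u \<Longrightarrow> continuous (at_right u) f" and bdd: "bdd_above (f ` {0..t})" and t: "0 \<le> t"
  shows "(SUP u\<in>{0..t}. f u) = (SUP u\<in>insert t (\<rat> \<inter> {0..t}). f u)" (is "?S = ?D")
proof (rule antisym)
  have bddD: "bdd_above (f ` insert t (\<rat> \<inter> {0..t}))"
    using t by (intro bdd_above_mono[OF bdd]) auto
  show "?S \<le> ?D"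
  proof (rule cSUP_least)
    fix s assume s: "s \<in> {0..t}"
    show "f s \<le> ?D"
    proof (rule ccontr)
      assume "\<not> f s \<le> ?D"
      then have less: "?D < f s" by simp
      then have "s \<noteq> t" using cSUP_upper[OF _ bddD, of t] by auto
      then have st: "s < t" using s by auto
      have "(f \<longlongrightarrow> f s) (at_right s)" using right[of s] s by (simp add: continuous_within)
      then have "\<forall>\<^sub>F u in at_right s. ?D < f u" using less by (rule order_tendstoD)
      then obtain b where b: "s < b" "\<And>u. s < u \<Longrightarrow> u < b \<Longrightarrow> ?D < f u"
        unfolding eventually_at_right_field by blast
      obtain u where u: "u \<in> \<rat>" "s < u" "u < min b t" using Rats_dense_in_real[of s "min b t"] b st by auto
      then have "f u \<le> ?D" using s by (intro cSUP_upper[OF _ bddD]) auto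
      with b(2)[of u] u show False by auto
    qed
  qed (use t in auto)
  show "?D \<le> ?S" using t by (intro cSUP_subset_mono bdd) auto
qed

text \<open>The problem under a single measure. The function \<open>g\<close> stands for the mean of \<open>q (u + inf)\<close> at the
exponential time; it enters only through its grid approximation \<open>g_limit\<close> and through the equation
\<open>first_order\<close> that defines the threshold \<open>L\<close>.\<close>

locale investment = discounted_levy N F Y x r for N :: "'a measure" and F Y x r +
  fixes K C B :: real and p p' q g L :: "real \<Rightarrow> real"
  assumes K: "0 < K"
    and q: "continuous_on UNIV q" "\<And>u. 0 < q u" "\<And>u. q u \<le> C"
    and p: "\<And>z. 0 \<le> z \<Longrightarrow> 0 \<le> p z"
    and p': "\<And>z. 0 \<le> z \<Longrightarrow> (p has_real_derivative p' z) (at z within {0..})" "continuous_on {0..} p'"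
      "strict_antimono_on {0..} p'" "\<And>z. 0 \<le> z \<Longrightarrow> 0 \<le> p' z"
    and L: "continuous_on UNIV L" "mono L" "\<And>u. 0 \<le> L u" "\<And>u. L u \<le> B"
    and g_nonneg: "\<And>u. 0 \<le> g u"
    and first_order: "\<And>u. p' (L u) * g u = r * K"
    and g_limit: "\<And>a a0. a \<longlonglongrightarrow> a0 \<Longrightarrow> (\<lambda>n. grid_inf_mean r q n (a n)) \<longlonglongrightarrow> ennreal (g a0 / r)"
begin

definition best :: "real \<Rightarrow> 'a \<Rightarrow> real" where
  "best t \<omega> = (SUP u\<in>{0..t}. L (Y u \<omega>))"

definition marginal :: "real \<Rightarrow> real" where
  "marginal u = p' (L u)"

lemma p'_antimono: "0 \<le> a \<Longrightarrow> a \<le> b \<Longrightarrow> p' b \<le> p' a"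
  using monotone_onD[OF p'(3), of a b] by (cases "a = b") auto

lemma marginal: "continuous_on UNIV marginal" "antimono marginal" "0 \<le> marginal u" "marginal u \<le> p' 0"
proof -
  have "continuous_on UNIV (\<lambda>u. p' (L u))"
    using L by (intro continuous_on_compose2[OF p'(2) L(1)]) auto
  then show "continuous_on UNIV marginal" by (simp add: marginal_def[abs_def])
  show "antimono marginal"
    unfolding marginal_def using L by (intro antimonoI p'_antimono) (auto dest: monoD)
  show "0 \<le> marginal u" "marginal u \<le> p' 0"
    unfolding marginal_def using L p'(4) p'_antimono by auto
qed

lemma B_nonneg: "0 \<le> B"
  using L(3,4)[of 0] by linarith

lemma L_Y_right: "\<omega> \<in> space N \<Longrightarrow> 0 \<le> t \<Longrightarrow> continuous (at_right t) (\<lambda>t. L (Y t \<omega>))"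
  using cadlag_continuous_at_right[OF cadlag_Y, of \<omega> t] L(1) unfolding continuous_within
  by (intro continuous_on_tendsto_compose[of UNIV L]) auto

lemma L_Y_bdd: "bdd_above ((\<lambda>t. L (Y t \<omega>)) ` A)"
  by (rule bdd_aboveI[of _ B]) (auto intro: L(4))

lemma best_eq:
  assumes "\<omega> \<in> space N" "0 \<le> t" shows "best t \<omega> = L (sup_from 0 t \<omega>)"
proof -
  have "L (Sup ((\<lambda>u. Y u \<omega>) ` {0..t})) = (SUP v\<in>(\<lambda>u. Y u \<omega>) ` {0..t}. L v)"
  proof (rule continuous_at_Sup_mono[OF L(2)])
    show "continuous (at_left (SUP u\<in>{0..t}. Y u \<omega>)) L"
      using L(1) by (simp add: continuous_on_eq_continuous_within continuous_at_imp_continuous_at_within)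
  qed (use assms cadlag_bdd(1)[OF cadlag_Y] in auto)
  then show ?thesis by (simp add: best_def sup_from_def image_image)
qed

lemma best_bounds: "0 \<le> t \<Longrightarrow> \<omega> \<in> space N \<Longrightarrow> 0 \<le> best t \<omega>" "0 \<le> t \<Longrightarrow> \<omega> \<in> space N \<Longrightarrow> best t \<omega> \<le> B"
  using L by (auto simp: best_eq)

lemma best_increasing_control: "increasing_control best"
  unfolding increasing_control_def
proof (intro conjI ballI)
  show "adapted F best"
    unfolding adapted_def
  proof (intro allI impI)
    fix t :: real assume t: "0 \<le> t"
    have "(\<lambda>\<omega>. SUP u\<in>insert t (\<rat> \<inter> {0..t}). L (Y u \<omega>)) \<in> borel_measurable (F t)"
    proof (rule borel_measurable_cSUP)
      show "countable (insert t (\<rat> \<inter> {0..t}))" using countable_rat by auto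
      fix u assume "u \<in> insert t (\<rat> \<inter> {0..t})"
      then have "Y u \<in> borel_measurable (F t)" using t by (intro measurable_Y_F) auto
      then show "(\<lambda>\<omega>. L (Y u \<omega>)) \<in> borel_measurable (F t)"
        by (rule measurable_compose) (rule borel_measurable_continuous_onI[OF L(1)])
    qed (rule L_Y_bdd)
    then show "best t \<in> borel_measurable (F t)"
    proof (rule measurable_cong[THEN iffD1, rotated])
      fix \<omega> assume "\<omega> \<in> space (F t)"
      then have "\<omega> \<in> space N" using space_F[OF t] by simp
      then show "(SUP u\<in>insert t (\<rat> \<inter> {0..t}). L (Y u \<omega>)) = best t \<omega>"
        unfolding best_def using t by (intro SUP_right_continuous_eq_countable[symmetric] L_Y_bdd L_Y_right)
    qed
  qed
  fix \<omega> assume \<omega>: "\<omega> \<in> space N"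
  show mono: "mono_on {0..} (\<lambda>t. best t \<omega>)"
    unfolding best_def by (intro mono_onI cSUP_subset_mono L_Y_bdd) auto
  show "cadlag (\<lambda>t. best t \<omega>)"
  proof (rule cadlag_mono[OF _ mono])
    show "continuous (at_right t) (\<lambda>t. best t \<omega>)" if "0 \<le> t" for t
      unfolding best_def using that \<omega> by (intro running_sup_right_continuous L_Y_bdd L_Y_right)
  qed
  show "0 \<le> best 0 \<omega>" by (rule best_bounds) (use \<omega> in auto)
qed

lemma best_singular_control: "best \<in> singular_controls r N F"
proof -
  have "(\<integral>\<^sup>+\<omega>. (stieltjes_integral (\<lambda>t. best t \<omega>) (\<lambda>t. exp (- r * t)))\<^sup>2 \<partial>N) \<le> (\<integral>\<^sup>+\<omega>. (ennreal B)\<^sup>2 \<partial>N)"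
  proof (rule nn_integral_mono)
    fix \<omega> assume \<omega>: "\<omega> \<in> space N"
    have "stieltjes_integral (\<lambda>t. best t \<omega>) (\<lambda>t. exp (- r * t)) = ennreal r * (\<integral>\<^sup>+t. ennreal (best t \<omega>) \<partial>E)"
      using stieltjes_integral_exp[OF r increasing_controlD[OF best_increasing_control \<omega>], of 1] by simp
    also have "\<dots> \<le> ennreal r * (\<integral>\<^sup>+t. ennreal B \<partial>E)"
      using best_bounds(2)[OF _ \<omega>] by (intro mult_left_mono nn_integral_mono ennreal_leI) auto
    also have "\<dots> = ennreal B"
      using r B_nonneg by (simp add: emeasure_discount_measure_space ennreal_mult[symmetric])
    finally show "(stieltjes_integral (\<lambda>t. best t \<omega>) (\<lambda>t. exp (- r * t)))\<^sup>2 \<le> (ennreal B)\<^sup>2"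
      by (rule power_mono) simp
  qed
  also have "\<dots> < \<infinity>" by (simp add: emeasure_space_1 power2_eq_square ennreal_mult_less_top)
  finally show ?thesis
    using best_increasing_control by (simp add: singular_controls_def increasing_control_def)
qed

text \<open>The factorization with \<open>f = h * marginal\<close>: the product of \<open>marginal\<close> and \<open>g\<close> that appears on its right
side is constant by the choice of \<open>L\<close>.\<close>

lemma Wiener_Hopf_marginal:
  assumes s: "0 \<le> s" and Z: "Z \<in> borel_measurable (F s)" "(\<integral>\<^sup>+\<omega>. Z \<omega> \<partial>N) < \<infinity>"
    and h: "continuous_on UNIV h" "\<And>u. 0 \<le> h u" "\<And>u. h u \<le> D"
  shows "(\<integral>\<^sup>+t. (\<integral>\<^sup>+\<omega>. Z \<omega> * (ennreal (h (sup_from s t \<omega>) * marginal (sup_from s t \<omega>)) * ennreal (q (Y (s + t) \<omega>))) \<partial>N) \<partial>E) =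
    ennreal (r * K) * (\<integral>\<^sup>+t. (\<integral>\<^sup>+\<omega>. Z \<omega> * ennreal (h (sup_from s t \<omega>)) \<partial>N) \<partial>E)" (is "?A = _ * ?B")
proof -
  define M where "M = max (D * p' 0) C"
  have M: "h u * marginal u \<le> M" "q u \<le> M" for u
  proof -
    have "h u * marginal u \<le> D * p' 0"
      using h(2,3)[of u] marginal(3,4)[of u] by (intro mult_mono) auto
    then show "h u * marginal u \<le> M" "q u \<le> M" using q(3)[of u] by (auto simp: M_def)
  qed
  have Zm [measurable]: "Z \<in> borel_measurable N" by (rule measurable_from_subalg[OF subalgebra_F[OF s] Z(1)])
  have hm: "(\<lambda>\<omega>. ennreal (h (sup_from s t \<omega>))) \<in> borel_measurable N" if "0 \<le> t" for t
    using measurable_sup_from[OF s that] borel_measurable_continuous_onI[OF h(1)] by measurable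
  have "?A * ennreal (1 / r) =
    (\<integral>\<^sup>+t. (\<integral>\<^sup>+\<omega>. Z \<omega> * (ennreal (h (sup_from s t \<omega>) * marginal (sup_from s t \<omega>)) * ennreal (g (sup_from s t \<omega>) / r)) \<partial>N) \<partial>E)"
  proof (rule Wiener_Hopf_levy[OF r s Z, where C = M])
    show "continuous_on UNIV (\<lambda>u. h u * marginal u)" by (intro continuous_intros h marginal)
  qed (use q h(2) marginal(3) M in \<open>auto intro: g_limit less_imp_le\<close>)
  also have "\<dots> = (\<integral>\<^sup>+t. ennreal K * (\<integral>\<^sup>+\<omega>. Z \<omega> * ennreal (h (sup_from s t \<omega>)) \<partial>N) \<partial>E)"
  proof (rule nn_integral_cong)
    fix t assume "t \<in> space E"
    then have t: "0 \<le> t" by simp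
    have "ennreal (h u * marginal u) * ennreal (g u / r) = ennreal K * ennreal (h u)" for u
    proof -
      have "h u * marginal u * (g u / r) = K * h u" using first_order[of u] r by (simp add: marginal_def field_simps)
      then show ?thesis using h(2)[of u] marginal(3)[of u] g_nonneg[of u] K r by (simp add: ennreal_mult[symmetric])
    qed
    then have "z * (ennreal (h u * marginal u) * ennreal (g u / r)) = ennreal K * (z * ennreal (h u))" for z u
      by (simp add: mult.left_commute)
    then show "(\<integral>\<^sup>+\<omega>. Z \<omega> * (ennreal (h (sup_from s t \<omega>) * marginal (sup_from s t \<omega>)) * ennreal (g (sup_from s t \<omega>) / r)) \<partial>N) =
        ennreal K * (\<integral>\<^sup>+\<omega>. Z \<omega> * ennreal (h (sup_from s t \<omega>)) \<partial>N)"
      using hm[OF t] by (simp add: nn_integral_cmult)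
  qed
  also have "\<dots> = ennreal K * ?B"
  proof (rule nn_integral_cmult)
    have grid_meas: "(\<lambda>t. \<integral>\<^sup>+\<omega>. Z \<omega> * ennreal (h (running_Max (\<lambda>k. Y (s + real k * mesh n) \<omega>) (next_grid n t))) \<partial>N) \<in> borel_measurable E" for n
      by (rule borel_measurable_next_grid)
    show "(\<lambda>t. \<integral>\<^sup>+\<omega>. Z \<omega> * ennreal (h (sup_from s t \<omega>)) \<partial>N) \<in> borel_measurable E"
    proof (rule borel_measurable_LIMSEQ_order[OF _ grid_meas])
      fix t assume "t \<in> space E"
      then have t: "0 \<le> t" by simp
      note [measurable] = measurable_grid_Max[OF s] borel_measurable_continuous_onI[OF h(1)]
      have "(\<lambda>n. ennreal (h (running_Max (\<lambda>k. Y (s + real k * mesh n) \<omega>) (next_grid n t)))) \<longlonglongrightarrow> ennreal (h (sup_from s t \<omega>))"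
        if "\<omega> \<in> space N" for \<omega>
        using h(1) grid_Max_tendsto_sup_from[OF that s t]
        by (intro tendsto_ennrealI continuous_on_tendsto_compose[of UNIV h]) auto
      then show "(\<lambda>n. \<integral>\<^sup>+\<omega>. Z \<omega> * ennreal (h (running_Max (\<lambda>k. Y (s + real k * mesh n) \<omega>) (next_grid n t))) \<partial>N) \<longlonglongrightarrow>
        (\<integral>\<^sup>+\<omega>. Z \<omega> * ennreal (h (sup_from s t \<omega>)) \<partial>N)"
        using h(3) Z(2)
        by (intro nn_integral_weighted_bounded_convergence[where c = "ennreal D"] ennreal_leI) auto
    qed
  qed
  finally have "?A * ennreal (1 / r) * ennreal r = ennreal K * ?B * ennreal r" by simp
  moreover have "ennreal (1 / r) * ennreal r = 1" using r by (simp add: ennreal_mult[symmetric])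
  ultimately have "?A = ennreal K * ?B * ennreal r" by (simp add: mult.assoc)
  also have "\<dots> = ennreal (r * K) * ?B" using r K by (simp add: ennreal_mult mult_ac)
  finally show ?thesis .
qed

text \<open>The case \<open>h = 1\<close>: a unit bought at time \<open>s\<close> returns its cost on average if its marginal revenue
ignores the path before \<open>s\<close>.\<close>

lemma marginal_value_eq_cost:
  assumes s: "0 \<le> s" and Z: "Z \<in> borel_measurable (F s)" "(\<integral>\<^sup>+\<omega>. Z \<omega> \<partial>N) < \<infinity>"
  shows "(\<integral>\<^sup>+t. (\<integral>\<^sup>+\<omega>. Z \<omega> * (ennreal (marginal (sup_from s t \<omega>)) * ennreal (q (Y (s + t) \<omega>))) \<partial>N) \<partial>E) =
    ennreal K * (\<integral>\<^sup>+\<omega>. Z \<omega> \<partial>N)"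
proof -
  have "(\<integral>\<^sup>+t. (\<integral>\<^sup>+\<omega>. Z \<omega> * (ennreal (marginal (sup_from s t \<omega>)) * ennreal (q (Y (s + t) \<omega>))) \<partial>N) \<partial>E) =
    ennreal (r * K) * ((\<integral>\<^sup>+\<omega>. Z \<omega> \<partial>N) * ennreal (1 / r))"
    using Wiener_Hopf_marginal[OF s Z, of "\<lambda>_. 1" 1] by (simp add: emeasure_discount_measure_space[OF r])
  also have "\<dots> = ennreal (r * K) * ennreal (1 / r) * (\<integral>\<^sup>+\<omega>. Z \<omega> \<partial>N)" by (simp only: mult_ac)
  also have "ennreal (r * K) * ennreal (1 / r) = ennreal K" using r K by (simp add: ennreal_mult[symmetric])
  finally show ?thesis .
qed

text \<open>The derivative of the profit at the candidate in the direction \<open>\<theta>\<close>.\<close>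

definition marginal_profit :: "(real \<Rightarrow> 'a \<Rightarrow> real) \<Rightarrow> 'a \<times> real \<Rightarrow> real" where
  "marginal_profit \<theta> s = (p' (best (snd s) (fst s)) * q (Y (snd s) (fst s)) - r * K) * \<theta> (snd s) (fst s)"

lemma q_measurable [measurable]: "q \<in> borel_measurable borel"
  by (rule borel_measurable_continuous_onI[OF q(1)])

lemma marginal_measurable [measurable]: "marginal \<in> borel_measurable borel"
  by (rule borel_measurable_continuous_onI[OF marginal(1)])

lemma p'_best: "s \<in> space Q \<Longrightarrow> p' (best (snd s) (fst s)) = marginal (sup_from 0 (snd s) (fst s))"
  by (auto simp: space_pair_measure best_eq marginal_def)

lemma gain_integrable:
  assumes \<theta>: "increasing_control \<theta>" "integrable Q (\<lambda>s. \<theta> (snd s) (fst s))"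
  shows "integrable Q (\<lambda>s. \<theta> (snd s) (fst s) * (marginal (sup_from 0 (snd s) (fst s)) * q (Y (snd s) (fst s))))"
proof (rule Bochner_Integration.integrable_bound[OF integrable_mult_left[OF \<theta>(2), of "p' 0 * C"]])
  note [measurable] = increasing_control_joint[OF \<theta>(1)]
  show "(\<lambda>s. \<theta> (snd s) (fst s) * (marginal (sup_from 0 (snd s) (fst s)) * q (Y (snd s) (fst s)))) \<in> borel_measurable Q" by measurable
  show "AE s in Q. norm (\<theta> (snd s) (fst s) * (marginal (sup_from 0 (snd s) (fst s)) * q (Y (snd s) (fst s)))) \<le> norm (\<theta> (snd s) (fst s) * (p' 0 * C))"
  proof (rule AE_I2)
    fix s
    have "marginal u * q v \<le> p' 0 * C" "0 \<le> marginal u * q v" for u v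
      using marginal(3,4)[of u] q(2,3)[of v] by (auto intro!: mult_mono)
    moreover have "norm (x * a) \<le> norm (x * b)" if "0 \<le> a" "a \<le> b" for x a b :: real
      using that by (simp add: abs_mult mult_left_mono)
    ultimately show "norm (\<theta> (snd s) (fst s) * (marginal (sup_from 0 (snd s) (fst s)) * q (Y (snd s) (fst s)))) \<le> norm (\<theta> (snd s) (fst s) * (p' 0 * C))"
      by blast
  qed
qed

text \<open>Passage between the signed integral over the product space and the iterated integrals of nonnegative
functions for which the first-order inequality is stated.\<close>

lemma marginal_profit_integral:
  assumes \<theta>: "increasing_control \<theta>" "integrable Q (\<lambda>s. \<theta> (snd s) (fst s))"
  shows "integrable Q (marginal_profit \<theta>)" "ennreal (\<integral>s. \<theta> (snd s) (fst s) \<partial>Q) = (\<integral>\<^sup>+t. (\<integral>\<^sup>+\<omega>. ennreal (\<theta> t \<omega>) \<partial>N) \<partial>E)"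
    "0 \<le> (\<integral>s. marginal_profit \<theta> s \<partial>Q) + r * K * (\<integral>s. \<theta> (snd s) (fst s) \<partial>Q)"
    "ennreal ((\<integral>s. marginal_profit \<theta> s \<partial>Q) + r * K * (\<integral>s. \<theta> (snd s) (fst s) \<partial>Q)) =
      (\<integral>\<^sup>+t. (\<integral>\<^sup>+\<omega>. ennreal (\<theta> t \<omega>) * (ennreal (marginal (sup_from 0 t \<omega>)) * ennreal (q (Y t \<omega>))) \<partial>N) \<partial>E)"
proof -
  let ?h = "\<lambda>s. \<theta> (snd s) (fst s) * (marginal (sup_from 0 (snd s) (fst s)) * q (Y (snd s) (fst s)))"
  note [measurable] = increasing_control_joint[OF \<theta>(1)]
  have nonneg: "0 \<le> \<theta> (snd s) (fst s)" if "s \<in> space Q" for s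
    using that by (intro increasing_control_nonneg[OF \<theta>(1)]) (auto simp: space_pair_measure)
  have h: "integrable Q ?h" by (rule gain_integrable[OF \<theta>])
  have marginal_profit_eq: "marginal_profit \<theta> s = ?h s - r * K * \<theta> (snd s) (fst s)" if "s \<in> space Q" for s
    using p'_best[OF that] by (simp add: marginal_profit_def algebra_simps)
  have diff: "integrable Q (\<lambda>s. ?h s - r * K * \<theta> (snd s) (fst s))" using h \<theta>(2) by simp
  show "integrable Q (marginal_profit \<theta>)" using diff marginal_profit_eq by (simp cong: Bochner_Integration.integrable_cong)
  have "(\<integral>s. marginal_profit \<theta> s \<partial>Q) = (\<integral>s. ?h s \<partial>Q) - r * K * (\<integral>s. \<theta> (snd s) (fst s) \<partial>Q)"
    using h \<theta>(2) marginal_profit_eq by (simp cong: Bochner_Integration.integral_cong)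
  then have eq: "(\<integral>s. marginal_profit \<theta> s \<partial>Q) + r * K * (\<integral>s. \<theta> (snd s) (fst s) \<partial>Q) = (\<integral>s. ?h s \<partial>Q)" by simp
  show "0 \<le> (\<integral>s. marginal_profit \<theta> s \<partial>Q) + r * K * (\<integral>s. \<theta> (snd s) (fst s) \<partial>Q)"
    unfolding eq using nonneg marginal(3) q(2) by (intro integral_nonneg_AE AE_I2) (auto simp: less_imp_le)
  have "ennreal ((\<integral>s. marginal_profit \<theta> s \<partial>Q) + r * K * (\<integral>s. \<theta> (snd s) (fst s) \<partial>Q)) = ennreal (\<integral>s. ?h s \<partial>Q)"
    unfolding eq ..
  also have "\<dots> = (\<integral>\<^sup>+s. ennreal (?h s) \<partial>Q)"
    using h nonneg marginal(3) q(2) by (intro nn_integral_eq_integral[symmetric] AE_I2) (auto simp: less_imp_le)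
  also have "\<dots> = (\<integral>\<^sup>+s. ennreal (\<theta> (snd s) (fst s)) * (ennreal (marginal (sup_from 0 (snd s) (fst s))) * ennreal (q (Y (snd s) (fst s)))) \<partial>Q)"
    using nonneg marginal(3) q(2) by (intro nn_integral_cong) (simp add: ennreal_mult less_imp_le)
  also have "\<dots> = (\<integral>\<^sup>+t. (\<integral>\<^sup>+\<omega>. ennreal (\<theta> t \<omega>) * (ennreal (marginal (sup_from 0 t \<omega>)) * ennreal (q (Y t \<omega>))) \<partial>N) \<partial>E)"
    using nn_integral_snd[of "\<lambda>s. ennreal (\<theta> (snd s) (fst s)) * (ennreal (marginal (sup_from 0 (snd s) (fst s))) * ennreal (q (Y (snd s) (fst s))))"]
    by simp
  finally show "ennreal ((\<integral>s. marginal_profit \<theta> s \<partial>Q) + r * K * (\<integral>s. \<theta> (snd s) (fst s) \<partial>Q)) = \<dots>" .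
  have "ennreal (\<integral>s. \<theta> (snd s) (fst s) \<partial>Q) = (\<integral>\<^sup>+s. ennreal (\<theta> (snd s) (fst s)) \<partial>Q)"
    using \<theta>(2) nonneg by (intro nn_integral_eq_integral[symmetric] AE_I2) auto
  also have "\<dots> = (\<integral>\<^sup>+t. (\<integral>\<^sup>+\<omega>. ennreal (\<theta> t \<omega>) \<partial>N) \<partial>E)"
    using nn_integral_snd[of "\<lambda>s. ennreal (\<theta> (snd s) (fst s))"] by simp
  finally show "ennreal (\<integral>s. \<theta> (snd s) (fst s) \<partial>Q) = \<dots>" .
qed

lemma marginal_profit_nonpos:
  assumes \<theta>: "increasing_control \<theta>" "integrable Q (\<lambda>s. \<theta> (snd s) (fst s))"
  shows "(\<integral>s. marginal_profit \<theta> s \<partial>Q) \<le> 0"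
proof -
  let ?I = "\<integral>s. \<theta> (snd s) (fst s) \<partial>Q"
  have I: "0 \<le> ?I"
    using increasing_control_nonneg[OF \<theta>(1)] by (intro integral_nonneg_AE AE_I2) (auto simp: space_pair_measure)
  have "ennreal ((\<integral>s. marginal_profit \<theta> s \<partial>Q) + r * K * ?I) \<le> ennreal (r * K) * ennreal ?I"
    unfolding marginal_profit_integral(2,4)[OF \<theta>]
  proof (rule control_gain_le[OF _ _ _ _ _ \<theta>(1)])
    show "(\<integral>\<^sup>+t. (\<integral>\<^sup>+\<omega>. ennreal (\<theta> t \<omega>) \<partial>N) \<partial>E) < \<infinity>" unfolding marginal_profit_integral(2)[OF \<theta>, symmetric] by simp
  qed (use K marginal(2) marginal_value_eq_cost in auto)
  also have "\<dots> = ennreal (r * K * ?I)" using r K I by (simp add: ennreal_mult)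
  finally show ?thesis using r K I by (subst (asm) ennreal_le_iff) auto
qed

lemma best_integrable: "integrable Q (\<lambda>s. best (snd s) (fst s))"
  by (rule singular_controls_integrable(2)[OF best_singular_control])

text \<open>The candidate is the function \<open>L\<close> of the running supremum, so that \<open>Wiener_Hopf_marginal\<close> applies
to it directly with \<open>h = L\<close> at time \<open>0\<close>.\<close>

lemma marginal_profit_best: "(\<integral>s. marginal_profit best s \<partial>Q) = 0"
proof -
  note best = best_increasing_control best_integrable
  let ?I = "\<integral>s. best (snd s) (fst s) \<partial>Q"
  have I: "0 \<le> ?I"
    using best_bounds(1) by (intro integral_nonneg_AE AE_I2) (auto simp: space_pair_measure)
  have "(\<integral>\<^sup>+t. (\<integral>\<^sup>+\<omega>. ennreal (best t \<omega>) * (ennreal (marginal (sup_from 0 t \<omega>)) * ennreal (q (Y t \<omega>))) \<partial>N) \<partial>E) =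
     (\<integral>\<^sup>+t. (\<integral>\<^sup>+\<omega>. ennreal (L (sup_from 0 t \<omega>) * marginal (sup_from 0 t \<omega>)) * ennreal (q (Y t \<omega>)) \<partial>N) \<partial>E)"
    using L(3) marginal(3) by (intro nn_integral_cong) (simp add: best_eq ennreal_mult mult.assoc)
  also have "\<dots> = ennreal (r * K) * (\<integral>\<^sup>+t. (\<integral>\<^sup>+\<omega>. ennreal (L (sup_from 0 t \<omega>)) \<partial>N) \<partial>E)"
    using Wiener_Hopf_marginal[of 0 "\<lambda>_. 1" L B] L by (simp add: emeasure_space_1)
  also have "(\<integral>\<^sup>+t. (\<integral>\<^sup>+\<omega>. ennreal (L (sup_from 0 t \<omega>)) \<partial>N) \<partial>E) = (\<integral>\<^sup>+t. (\<integral>\<^sup>+\<omega>. ennreal (best t \<omega>) \<partial>N) \<partial>E)"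
    by (intro nn_integral_cong) (simp add: best_eq)
  finally have "ennreal ((\<integral>s. marginal_profit best s \<partial>Q) + r * K * ?I) = ennreal (r * K) * ennreal ?I"
    unfolding marginal_profit_integral(2,4)[OF best] .
  also have "\<dots> = ennreal (r * K * ?I)" using r K I by (simp add: ennreal_mult)
  finally have "ennreal ((\<integral>s. marginal_profit best s \<partial>Q) + r * K * ?I) = ennreal (r * K * ?I)" .
  moreover have pos: "0 \<le> r * K * ?I" using r K I by simp
  ultimately show ?thesis
    using marginal_profit_integral(3)[OF best] by (subst (asm) ennreal_inj) auto
qed

end

section \<open>Optimality and uniqueness\<close>

lemma right_continuous_eqI_AE:
  fixes f g :: "real \<Rightarrow> real"
  assumes f: "continuous (at_right t) f" and g: "continuous (at_right t) g"
    and AE: "AE u in lborel. 0 \<le> u \<longrightarrow> f u = g u" and t: "0 \<le> t"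
  shows "f t = g t"
proof (rule ccontr)
  assume "f t \<noteq> g t"
  have "((\<lambda>u. \<bar>f u - g u\<bar>) \<longlongrightarrow> \<bar>f t - g t\<bar>) (at_right t)"
    using f g unfolding continuous_within by (intro tendsto_intros)
  then have "\<forall>\<^sub>F u in at_right t. 0 < \<bar>f u - g u\<bar>"
    using \<open>f t \<noteq> g t\<close> by (intro order_tendstoD(1)) auto
  then obtain b where b: "t < b" "\<And>u. t < u \<Longrightarrow> u < b \<Longrightarrow> f u \<noteq> g u"
    unfolding eventually_at_right_field by force
  from AE have "AE u in lborel. u \<notin> {t<..<b}"
    by eventually_elim (use b t in auto)
  then have "{t<..<b} \<in> null_sets lborel" by (subst AE_iff_null_sets) auto
  then have "emeasure lborel {t<..<b} = 0" by blast
  then show False using b by simp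
qed

text \<open>Since \<open>p'\<close> is strictly decreasing, \<open>L u\<close> lies on a given side of a level \<open>c\<close> if and only if \<open>v u\<close> lies
on the opposite side of \<open>p' c\<close>.\<close>

lemma inverse_marginal_continuous:
  fixes p' L v :: "real \<Rightarrow> real"
  assumes anti: "strict_antimono_on {0..} p'" and L: "\<And>u. 0 \<le> L u" and eq: "\<And>u. p' (L u) = v u"
    and v: "continuous_on UNIV v"
  shows "continuous_on UNIV L"
proof -
  have "(L \<longlongrightarrow> L x) (at x)" for x
  proof (rule order_tendstoI)
    have lim: "((\<lambda>u. p' (L u)) \<longlongrightarrow> p' (L x)) (at x)"
      using v unfolding eq by (simp add: continuous_on_def)
    fix c
    show "\<forall>\<^sub>F u in at x. c < L u" if c: "c < L x"
    proof (cases "c < 0")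
      case True
      then show ?thesis using L by (auto intro!: always_eventually less_le_trans[of c 0])
    next
      case False
      then have "p' (L x) < p' c" using monotone_onD[OF anti, of c "L x"] c L[of x] by auto
      with lim have "\<forall>\<^sub>F u in at x. p' (L u) < p' c" by (rule order_tendstoD)
      then show ?thesis
      proof eventually_elim
        case (elim u)
        show "c < L u"
        proof (rule ccontr)
          assume "\<not> c < L u"
          then have "L u = c \<or> L u < c" by auto
          then show False using elim monotone_onD[OF anti, of "L u" c] L[of u] False by auto
        qed
      qed
    qed
    show "\<forall>\<^sub>F u in at x. L u < c" if c: "L x < c"
    proof -
      have c0: "0 \<le> c" using c L[of x] by linarith
      then have "p' c < p' (L x)" using monotone_onD[OF anti, of "L x" c] c L[of x] by auto
      with lim have "\<forall>\<^sub>F u in at x. p' c < p' (L u)" by (rule order_tendstoD)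
      then show ?thesis
      proof eventually_elim
        case (elim u)
        show "L u < c"
        proof (rule ccontr)
          assume "\<not> L u < c"
          then have "L u = c \<or> c < L u" by auto
          then show False using elim monotone_onD[OF anti, of c "L u"] L[of u] c0 by auto
        qed
      qed
    qed
  qed
  then show ?thesis by (simp add: continuous_on_def)
qed

lemma (in prob_space) continuous_on_expectation_shift:
  fixes q :: "real \<Rightarrow> real" and I :: "'a \<Rightarrow> real"
  assumes q: "continuous_on UNIV q" "\<And>u. \<bar>q u\<bar> \<le> C" and meas: "\<And>a. (\<lambda>\<omega>. q (a + I \<omega>)) \<in> borel_measurable M"
  shows "continuous_on UNIV (\<lambda>a. \<integral>\<omega>. q (a + I \<omega>) \<partial>M)"
  unfolding continuous_on_sequentially comp_def
proof (intro ballI allI impI)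
  fix a and s :: "nat \<Rightarrow> real" assume s: "(\<forall>n. s n \<in> UNIV) \<and> s \<longlonglongrightarrow> a"
  show "(\<lambda>n. \<integral>\<omega>. q (s n + I \<omega>) \<partial>M) \<longlonglongrightarrow> (\<integral>\<omega>. q (a + I \<omega>) \<partial>M)"
  proof (rule integral_dominated_convergence[where w = "\<lambda>_. C"])
    show "AE \<omega> in M. (\<lambda>n. q (s n + I \<omega>)) \<longlonglongrightarrow> q (a + I \<omega>)"
      using s q(1) by (intro AE_I2 continuous_on_tendsto_compose[of UNIV q] tendsto_intros) auto
  qed (use q(2) meas in auto)
qed

context investment
begin

definition profit :: "(real \<Rightarrow> 'a \<Rightarrow> real) \<Rightarrow> 'a \<times> real \<Rightarrow> real" where
  "profit \<theta> s = p (\<theta> (snd s) (fst s)) * q (Y (snd s) (fst s)) - r * K * \<theta> (snd s) (fst s)"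

lemma control_nonneg: "increasing_control \<theta> \<Longrightarrow> s \<in> space Q \<Longrightarrow> 0 \<le> \<theta> (snd s) (fst s)"
  by (rule increasing_control_nonneg[of \<theta>]) (auto simp: space_pair_measure)

lemma below_tangent:
  assumes "0 \<le> a" "0 \<le> y" shows "p y \<le> p a + p' a * (y - a)" "p y = p a + p' a * (y - a) \<Longrightarrow> y = a"
proof -
  have strict: "p y < p a + p' a * (y - a)" if "y \<noteq> a"
    by (rule strictly_concave_below_tangent[OF p'(1,3) assms that])
  show "p y \<le> p a + p' a * (y - a)" using strict by (cases "y = a") auto
  show "y = a" if "p y = p a + p' a * (y - a)" using strict that by (cases "y = a") auto
qed

lemma revenue_integrable:
  assumes \<theta>: "increasing_control \<theta>" "integrable Q (\<lambda>s. \<theta> (snd s) (fst s))"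
  shows "integrable Q (\<lambda>s. p (\<theta> (snd s) (fst s)) * q (Y (snd s) (fst s)))"
proof (rule Bochner_Integration.integrable_bound)
  note [measurable] = increasing_control_joint[OF \<theta>(1)]
  interpret Q: finite_measure Q
    by (rule finite_measure_pair_measure) unfold_locales
  have "continuous_on {0..} p"
    using p'(1) by (intro DERIV_continuous_on) auto
  then have "continuous_on UNIV (\<lambda>z. p (max 0 z))"
    by (rule continuous_on_compose2) (auto intro!: continuous_intros)
  then have [measurable]: "(\<lambda>z. p (max 0 z)) \<in> borel_measurable borel"
    by (rule borel_measurable_continuous_onI)
  have "(\<lambda>s. p (max 0 (\<theta> (snd s) (fst s))) * q (Y (snd s) (fst s))) \<in> borel_measurable Q" by measurable
  then show "(\<lambda>s. p (\<theta> (snd s) (fst s)) * q (Y (snd s) (fst s))) \<in> borel_measurable Q"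
    by (rule measurable_cong[THEN iffD1, rotated]) (simp add: control_nonneg[OF \<theta>(1)] max_absorb2)
  show "integrable Q (\<lambda>s. (p 0 + p' 0 * \<theta> (snd s) (fst s)) * C)"
    using \<theta>(2) by simp
  show "AE s in Q. norm (p (\<theta> (snd s) (fst s)) * q (Y (snd s) (fst s))) \<le> norm ((p 0 + p' 0 * \<theta> (snd s) (fst s)) * C)"
  proof (rule AE_I2)
    fix s assume "s \<in> space Q"
    then have z: "0 \<le> \<theta> (snd s) (fst s)" by (rule control_nonneg[OF \<theta>(1)])
    have "p (\<theta> (snd s) (fst s)) * q (Y (snd s) (fst s)) \<le> (p 0 + p' 0 * \<theta> (snd s) (fst s)) * C"
      using below_tangent(1)[OF _ z, of 0] p[OF z] q(2,3)[of "Y (snd s) (fst s)"] z p(1)[of 0] p'(4)[of 0]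
      by (intro mult_mono) auto
    moreover have "0 \<le> p (\<theta> (snd s) (fst s)) * q (Y (snd s) (fst s))" using p[OF z] q(2) by (simp add: less_imp_le)
    ultimately show "norm (p (\<theta> (snd s) (fst s)) * q (Y (snd s) (fst s))) \<le> norm ((p 0 + p' 0 * \<theta> (snd s) (fst s)) * C)"
      by simp
  qed
qed

lemma payoff_eq_profit:
  assumes "\<theta> \<in> singular_controls r N F"
  shows "integrable Q (profit \<theta>)" "investment_payoff r K p q Y N \<theta> = ereal (\<integral>s. profit \<theta> s \<partial>Q)"
proof -
  note \<theta> = singular_controls_integrable[OF assms]
  note rev = revenue_integrable[OF \<theta>]
  show "integrable Q (profit \<theta>)" using rev \<theta>(2) unfolding profit_def by simp
  show "investment_payoff r K p q Y N \<theta> = ereal (\<integral>s. profit \<theta> s \<partial>Q)"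
    unfolding profit_def using investment_payoff_eq[OF \<theta> rev] p q(2) K by (simp add: less_imp_le)
qed

text \<open>The integrand \<open>D\<close> is \<open>q\<close> times the amount by which the tangent of \<open>p\<close> at the candidate exceeds \<open>p\<close> at
the competing control.\<close>

lemma profit_comparison:
  assumes \<theta>: "\<theta> \<in> singular_controls r N F"
  defines "D \<equiv> \<lambda>s. profit best s - profit \<theta> s + marginal_profit \<theta> s - marginal_profit best s"
  shows "integrable Q D" "s \<in> space Q \<Longrightarrow> 0 \<le> D s"
    "s \<in> space Q \<Longrightarrow> D s = 0 \<Longrightarrow> \<theta> (snd s) (fst s) = best (snd s) (fst s)"
    "(\<integral>s. D s \<partial>Q) \<le> (\<integral>s. profit best s \<partial>Q) - (\<integral>s. profit \<theta> s \<partial>Q)"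
proof -
  note \<theta>' = singular_controls_integrable[OF \<theta>]
  note ints = payoff_eq_profit(1)[OF \<theta>] payoff_eq_profit(1)[OF best_singular_control]
    marginal_profit_integral(1)[OF \<theta>'] marginal_profit_integral(1)[OF best_increasing_control best_integrable]
  show "integrable Q D" unfolding D_def using ints by simp
  have "(\<integral>s. D s \<partial>Q) = (\<integral>s. profit best s \<partial>Q) - (\<integral>s. profit \<theta> s \<partial>Q) + (\<integral>s. marginal_profit \<theta> s \<partial>Q)"
    unfolding D_def using ints marginal_profit_best by simp
  then show "(\<integral>s. D s \<partial>Q) \<le> (\<integral>s. profit best s \<partial>Q) - (\<integral>s. profit \<theta> s \<partial>Q)"
    using marginal_profit_nonpos[OF \<theta>'] by simp
  let ?b = "best (snd s) (fst s)" and ?z = "\<theta> (snd s) (fst s)"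
  assume s: "s \<in> space Q"
  have nonneg: "0 \<le> ?b" "0 \<le> ?z"
    using control_nonneg[OF best_increasing_control s] control_nonneg[OF \<theta>'(1) s] by auto
  have D: "D s = q (Y (snd s) (fst s)) * (p ?b + p' ?b * (?z - ?b) - p ?z)"
    unfolding D_def profit_def marginal_profit_def by (simp add: algebra_simps)
  show "0 \<le> D s"
    unfolding D using below_tangent(1)[OF nonneg] q(2) by (simp add: less_imp_le)
  show "?z = ?b" if "D s = 0"
    using that below_tangent(2)[OF nonneg] q(2)[of "Y (snd s) (fst s)"] unfolding D by auto
qed

theorem best_optimal:
  assumes "\<theta> \<in> singular_controls r N F"
  shows "investment_payoff r K p q Y N \<theta> \<le> investment_payoff r K p q Y N best"
proof -
  have "0 \<le> (\<integral>s. profit best s - profit \<theta> s + marginal_profit \<theta> s - marginal_profit best s \<partial>Q)"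
    using profit_comparison(2)[OF assms] by (intro integral_nonneg_AE AE_I2)
  then show ?thesis
    using profit_comparison(4)[OF assms] by (simp add: payoff_eq_profit(2)[OF assms] payoff_eq_profit(2)[OF best_singular_control])
qed

text \<open>Equal payoffs force the nonnegative integrand of \<open>profit_comparison\<close> to vanish almost everywhere.
By strict concavity the controls then agree for almost all times, and by right-continuity for all
times.\<close>

theorem best_unique:
  assumes \<theta>: "\<theta> \<in> singular_controls r N F"
    and eq: "investment_payoff r K p q Y N \<theta> = investment_payoff r K p q Y N best"
  shows "AE \<omega> in N. \<forall>t\<ge>0. \<theta> t \<omega> = best t \<omega>"
proof -
  let ?D = "\<lambda>s. profit best s - profit \<theta> s + marginal_profit \<theta> s - marginal_profit best s"
  note comp = profit_comparison[OF \<theta>]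
  have nonneg: "AE s in Q. 0 \<le> ?D s" using comp(2) by (intro AE_I2)
  have "(\<integral>s. profit best s \<partial>Q) = (\<integral>s. profit \<theta> s \<partial>Q)"
    using eq by (simp add: payoff_eq_profit(2)[OF \<theta>] payoff_eq_profit(2)[OF best_singular_control])
  then have "(\<integral>s. ?D s \<partial>Q) = 0" using comp(4) integral_nonneg_AE[OF nonneg] by simp
  then have "AE s in Q. ?D s = 0" using integral_nonneg_eq_0_iff_AE[OF comp(1) nonneg] by simp
  then have "AE s in Q. \<theta> (snd s) (fst s) = best (snd s) (fst s)"
    using AE_space by eventually_elim (rule comp(3))
  then have "AE \<omega> in N. AE t in E. \<theta> t \<omega> = best t \<omega>"
    using AE_pair[of "\<lambda>s. \<theta> (snd s) (fst s) = best (snd s) (fst s)"] by simp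
  then show ?thesis
    using AE_space
  proof eventually_elim
    case (elim \<omega>)
    note \<theta>' = increasing_controlD[OF singular_controls_integrable(1)[OF \<theta>] elim(2)]
    note b = increasing_controlD[OF best_increasing_control elim(2)]
    show ?case
      using right_continuous_eqI_AE[OF cadlag_continuous_at_right[OF \<theta>'(1)] cadlag_continuous_at_right[OF b(1)]
          AE_discount_measureD[OF elim(1)]] by blast
  qed
qed

end

section \<open>The investment problem\<close>

lemma levy_family_levy: "levy_family M F P X \<Longrightarrow> levy (P x) F X x"
  by (simp add: levy_family_def levy_def)

text \<open>Increments do not see the shift by which the laws of the family differ.\<close>

lemma levy_family_step_law:
  assumes fam: "levy_family M F P X" and h: "0 \<le> h"
  shows "levy.step_law (P x) X h = levy.step_law (P 0) X h"
proof -
  interpret A: levy "P x" F X x by (rule levy_family_levy[OF fam])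
  interpret B: levy "P 0" F X 0 by (rule levy_family_levy[OF fam])
  have [measurable]: "(\<lambda>w. w h - w 0) \<in> borel_measurable path_space"
    using h by (intro borel_measurable_diff measurable_component_singleton) auto
  have shifted: "sample_path (\<lambda>t \<omega>. X t \<omega> - x) \<in> measurable (P x) path_space"
    unfolding sample_path_def by (intro measurable_restrict borel_measurable_diff A.measurable_Y) auto
  have "A.step_law h = distr (distr (P x) path_space (sample_path (\<lambda>t \<omega>. X t \<omega> - x))) borel (\<lambda>w. w h - w 0)"
    using h shifted by (subst distr_distr) (auto simp: A.step_law_def sample_path_def comp_def)
  also have "distr (P x) path_space (sample_path (\<lambda>t \<omega>. X t \<omega> - x)) = distr (P 0) path_space (sample_path X)"
    using fam by (simp add: levy_family_def)
  also have "distr \<dots> borel (\<lambda>w. w h - w 0) = B.step_law h"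
    using h B.measurable_sample_path by (subst distr_distr) (auto simp: B.step_law_def sample_path_def comp_def)
  finally show ?thesis .
qed

text \<open>At the zero control the derivative of the running cost is \<open>- p' 0 * q x\<close>. Uniqueness of the one-sided
derivative identifies it with the bounded function from the regularity assumption.\<close>

lemma regular_cost_bounded_price:
  assumes cost: "regular_running_cost (\<lambda>t x z. - p z * q x)" and p': "(p has_real_derivative p' 0) (at 0 within {0..})" "0 < p' 0"
  shows "\<exists>C. \<forall>x. q x \<le> C"
proof -
  obtain c' :: "real \<Rightarrow> real \<Rightarrow> real \<Rightarrow> real" where witness: "(\<forall>t\<ge>0. \<forall>x. (\<forall>z\<ge>0. ((\<lambda>z. - p z * q x) has_real_derivative c' t x z) (at z within {0..})) \<and>
       continuous_on {0..} (c' t x) \<and> strict_mono_on {0..} (c' t x)) \<and>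
     (\<exists>b. \<forall>t\<ge>0. \<forall>x. \<forall>z\<ge>0. \<bar>c' t x z\<bar> \<le> b)"
    using cost unfolding regular_running_cost_def ..
  have c': "((\<lambda>z. - p z * q x) has_real_derivative c' t x z) (at z within {0..})" if "0 \<le> t" "0 \<le> z" for t x z
    using conjunct1[OF witness] that by blast
  obtain b where b: "\<forall>t\<ge>0. \<forall>x. \<forall>z\<ge>0. \<bar>c' t x z\<bar> \<le> b"
    using conjunct2[OF witness] ..
  have "q x \<le> b / p' 0" for x
  proof -
    have "((\<lambda>z. - p z * q x) has_real_derivative - p' 0 * q x) (at 0 within {0..})"
      by (intro DERIV_cmult_right DERIV_minus p'(1))
    moreover have "((\<lambda>z. - p z * q x) has_real_derivative c' 0 x 0) (at 0 within {0..})" using c' by simp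
    ultimately have "- p' 0 * q x = c' 0 x 0"
      unfolding has_field_derivative_iff at_within_Ici_at_right by (rule tendsto_unique[OF trivial_limit_at_right_real])
    moreover have "\<bar>c' 0 x 0\<bar> \<le> b" using b by simp
    ultimately have "p' 0 * q x \<le> b" by linarith
    then show ?thesis using p'(2) by (simp add: field_simps)
  qed
  then show ?thesis by blast
qed

theorem theorem17:
  fixes M :: "'a measure" and F :: "real \<Rightarrow> 'a measure" and P :: "real \<Rightarrow> 'a measure"
    and X :: "real \<Rightarrow> 'a \<Rightarrow> real" and T :: "'a \<Rightarrow> real"
    and r K :: real and p p' q L :: "real \<Rightarrow> real"
  assumes levy: "levy_family M F P X"
    and r: "0 < r"
    and K: "0 < K"
    and T: "\<forall>x. independent_exponential r (P x) X T"
    and q: "continuous_on UNIV q" "strict_mono q" "\<forall>x. 0 < q x"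
    and p: "\<forall>z\<ge>0. 0 \<le> p z" "mono_on {0..} p" "concave_on {0..} p"
    and p': "\<forall>z\<ge>0. (p has_real_derivative p' z) (at z within {0..})"
      "continuous_on {0..} p'" "strict_antimono_on {0..} p'" "(p' \<longlongrightarrow> 0) at_top"
    and cost: "regular_running_cost (\<lambda>t x z. - p z * q x)"
      "finite_cost_of_constant_control r P X (\<lambda>t x z. - p z * q x)"
      "finite_minimal_cost r P X (\<lambda>t x z. - p z * q x) (\<lambda>t \<omega>. K)"
    and L_well_defined:
      "\<forall>x. integrable (P 0) (\<lambda>\<omega>. q (x + running_inf X (T \<omega>) \<omega>)) \<and>
           r * K / (\<integral>\<omega>. q (x + running_inf X (T \<omega>) \<omega>) \<partial>P 0) \<in> p' ` {0..}"
    and L: "\<forall>x. L x = the_inv_into {0..} p'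
                 (r * K / (\<integral>\<omega>. q (x + running_inf X (T \<omega>) \<omega>) \<partial>P 0))"
  shows "\<forall>x. is_the_optimal_control r K p q X F P x (\<lambda>t \<omega>. SUP u\<in>{0..t}. L (X u \<omega>))"
proof
  fix x
  interpret Z: levy "P 0" F X 0 by (rule levy_family_levy[OF levy])
  define g where "g a = (\<integral>\<omega>. q (a + running_inf X (T \<omega>) \<omega>) \<partial>P 0)" for a
  have p'_nonneg: "0 \<le> p' z" if "0 \<le> z" for z
  proof (rule tendsto_upperbound[OF p'(4)])
    have "p' y \<le> p' z" if "z \<le> y" for y
      using monotone_onD[OF p'(3), of z y] that \<open>0 \<le> z\<close> by (cases "z = y") auto
    then show "\<forall>\<^sub>F y in at_top. p' y \<le> p' z" using eventually_ge_at_top[of z] by (rule eventually_mono[rotated])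
  qed simp
  have p'_pos: "0 < p' z" if "0 \<le> z" for z
    using monotone_onD[OF p'(3), of z "z + 1"] p'_nonneg[of "z + 1"] that by auto
  obtain C where C: "q u \<le> C" for u
    using regular_cost_bounded_price[OF cost(1), of p'] p'(1) p'_pos by auto
  have C_pos: "0 < C" using C[of 0] q(3) by (auto intro: less_le_trans)
  have int: "integrable (P 0) (\<lambda>\<omega>. q (a + running_inf X (T \<omega>) \<omega>))" for a
    using L_well_defined by blast
  have g_nonneg: "0 \<le> g a" for a
    unfolding g_def using q(3) by (intro integral_nonneg_AE AE_I2) (auto simp: less_imp_le)
  have inj: "inj_on p' {0..}"
  proof (rule linorder_inj_onI)
    show "p' a \<noteq> p' b" if "a < b" "a \<in> {0..}" "b \<in> {0..}" for a b
      using monotone_onD[OF p'(3) that(2,3,1)] by simp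
  qed auto
  have range: "r * K / g a \<in> p' ` {0..}" for a using L_well_defined by (simp add: g_def)
  have L_eq: "L a = the_inv_into {0..} p' (r * K / g a)" for a using L by (simp add: g_def)
  have L_nonneg: "0 \<le> L a" for a
    using the_inv_into_into[OF inj range order_refl, of a] by (simp add: L_eq)
  have p'_L: "p' (L a) = r * K / g a" for a
    unfolding L_eq by (rule f_the_inv_into_f[OF inj range])
  have g_pos: "0 < g a" for a
    using p'_L[of a] p'_pos[OF L_nonneg[of a]] g_nonneg[of a] by (cases "g a = 0") auto
  have g_le: "g a \<le> C" for a
    unfolding g_def using int C by (intro Z.integral_le_const AE_I2) auto
  have g_cont: "continuous_on UNIV g"
    unfolding g_def[abs_def] using q C int
    by (intro Z.continuous_on_expectation_shift[where C = C]) (auto simp: abs_of_pos intro: borel_measurable_integrable)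
  have L_cont: "continuous_on UNIV L"
  proof (rule inverse_marginal_continuous[OF p'(3) L_nonneg p'_L])
    show "continuous_on UNIV (\<lambda>a. r * K / g a)"
      using g_pos by (intro continuous_intros g_cont) (simp add: less_imp_neq[symmetric])
  qed
  have g_mono: "g a \<le> g b" if "a \<le> b" for a b
    unfolding g_def using that q(2) by (intro integral_mono int) (simp add: strict_mono_less_eq)
  have L_mono: "mono L"
  proof (rule monoI, rule ccontr)
    fix a b :: real assume "a \<le> b" "\<not> L a \<le> L b"
    then have "p' (L a) < p' (L b)" using monotone_onD[OF p'(3), of "L b" "L a"] L_nonneg by auto
    moreover have "r * K / g b \<le> r * K / g a"
      using g_mono[OF \<open>a \<le> b\<close>] g_pos r K by (intro divide_left_mono) auto
    ultimately show False by (simp add: p'_L)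
  qed
  \<comment> \<open>Since p' (L a) is at least r K / C, a point B with p' B below this value bounds the threshold.\<close>
  have "\<forall>\<^sub>F z in at_top. p' z < r * K / C" using p'(4) r K C_pos by (intro order_tendstoD(2)) auto
  then have "\<forall>\<^sub>F z in at_top. p' z < r * K / C \<and> 0 \<le> z" using eventually_ge_at_top[of 0] by (rule eventually_conj)
  then obtain B where B: "p' B < r * K / C" "0 \<le> B" using eventually_happens by fastforce
  have L_le: "L a \<le> B" for a
  proof (rule ccontr)
    assume "\<not> L a \<le> B"
    then have "p' (L a) < p' B" using monotone_onD[OF p'(3), of B "L a"] B L_nonneg[of a] by auto
    moreover have "r * K / C \<le> r * K / g a" using g_le[of a] g_pos[of a] r K C_pos by (intro divide_left_mono) auto
    ultimately show False using B p'_L[of a] by simp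
  qed
  interpret A: levy "P x" F X x by (rule levy_family_levy[OF levy])
  have same_law: "A.grid_inf_mean r q n a = Z.grid_inf_mean r q n a" for n a
    unfolding A.grid_inf_mean_def Z.grid_inf_mean_def
    using levy_family_step_law[OF levy, of "mesh n" x] mesh_pos[of n] by simp
  interpret investment "P x" F X x r K C B p p' q g L
  proof unfold_locales
    show "(\<lambda>n. A.grid_inf_mean r q n (a n)) \<longlonglongrightarrow> ennreal (g a0 / r)" if "a \<longlonglongrightarrow> a0" for a a0
      unfolding same_law g_def using q T C by (intro Z.grid_inf_mean_tendsto r that int) (auto simp: less_imp_le)
    show "p' (L u) * g u = r * K" for u using p'_L[of u] g_pos[of u] by simp
  qed (use r K q p p' C p'_nonneg L_cont L_mono L_nonneg L_le g_nonneg in auto)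
  have attained: "investment_payoff r K p q X (P x) best = investment_value r K p q X F P x"
    unfolding investment_value_def using best_singular_control best_optimal
    by (intro antisym SUP_upper SUP_least) auto
  have "is_the_optimal_control r K p q X F P x best"
    unfolding is_the_optimal_control_def using best_singular_control attained best_unique by auto
  then show "is_the_optimal_control r K p q X F P x (\<lambda>t \<omega>. SUP u\<in>{0..t}. L (X u \<omega>))"
    by (simp add: best_def[abs_def])
qed

end
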